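(* Let $k\ge -\tfrac12$ and $M=(a,b;c,d)\in SL(2,\mathbb{R})$ with $b\ne 0$. Let $1<p_1\le p_2\le 2$ with conjugate exponents $q_1,q_2$ respectively. If $f\in L_k^{p_1}(\mathbb{R})\cap L_k^{p_2}(\mathbb{R})$, then $$\|D_k^M(f)\|_{L_k^{q_2}(\mathbb{R})} \le C_{k,b}^{1-\frac{2}{q_1}}\, \big(\gamma_k(A_{D_k^M(f)})\big)^{\frac{q_1-q_2}{q_1q_2}}\, \big(\gamma_k(A_f)\big)^{\frac{p_2-p_1}{p_1p_2}}\, \|f\|_{L^{p_2}_k(\mathbb{R})},$$ where $C_{k,b}=|b|^{-(k+1)}$, $A_{D_k^M(f)}= \{x\in \mathbb{R}: D_k^M(f)(x) \neq 0\}$ and $A_f = \{ t\in \mathbb{R}:f(t)\neq0\}$ (the right-hand side is read in $[0,\infty]$, with $0\cdot\infty=0$ and $x^0=1$ for all $x\in[0,\infty]$).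
   Context: For $k\ge-\frac12$ let $d\mu_k(x)=\frac{|x|^{2k+1}}{2^{k+1}\Gamma(k+1)}\,dx$ on $\mathbb{R}$, and let $L^p_k(\mathbb{R})=L^p(\mathbb{R},\mu_k)$ (complex-valued functions) with its usual norm, $1\le p\le\infty$. For measurable $E\subseteq\mathbb{R}$, $\gamma_k(E)=\mu_k(E)\in[0,\infty]$. The Dunkl kernel is $E_k(-i\lambda,x)=j_k(\lambda x)-\frac{i\lambda x}{2(k+1)}j_{k+1}(\lambda x)$, where $j_k(u)=\Gamma(k+1)\sum_{n\ge0}\frac{(-1)^n(u/2)^{2n}}{n!\,\Gamma(n+k+1)}$. For $M=(a,b;c,d)$, meaning the matrix $\begin{bmatrix}a&b\\c&d\end{bmatrix}\in SL(2,\mathbb{R})$, with $b\neq0$, the linear canonical Dunkl transform of $f\in L^1_k(\mathbb{R})$ is $$D_k^M(f)(\lambda)=\frac{1}{(ib)^{k+1}}\int_{\mathbb{R}}f(x)\,e^{\frac i2\left(\frac db\lambda^2+\frac ab x^2\right)}E_k(-i\lambda/b,x)\,d\mu_k(x),$$ with $(ib)^{k+1}$ the principal branch. For $1<p\le2$ with conjugate exponent $q$, $D_k^M$ on $L^p_k(\mathbb{R})$ denotes the unique bounded extension $L^p_k(\mathbb{R})\to L^q_k(\mathbb{R})$ of this integral transform from $L^1_k(\mathbb{R})\cap L^p_k(\mathbb{R})$. *)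

theory Defs
  imports "HOL-Analysis.Analysis"
begin

text \<open>Real powers on $[0,\infty]$ for exponents \<open>a \<ge> 0\<close> (the only ones used), with
  \<open>x\<^sup>0 = 1\<close> for every \<open>x\<close>, including \<open>0\<close> and \<open>\<infinity>\<close>.\<close>

definition ennreal_rpow :: "ennreal \<Rightarrow> real \<Rightarrow> ennreal" where
  "ennreal_rpow x a =
     (if a = 0 then 1 else if x = \<infinity> then \<infinity> else ennreal (enn2real x powr a))"

text \<open>$L^p$ for finite exponents. Its elements are functions, not classes, so
  equality in $L^p$ is rendered as equality almost everywhere.\<close>

definition Lp_norm :: "'a measure \<Rightarrow> real \<Rightarrow> ('a \<Rightarrow> complex) \<Rightarrow> ennreal" where
  "Lp_norm \<mu> p f = ennreal_rpow (\<integral>\<^sup>+x. ennreal (norm (f x) powr p) \<partial>\<mu>) (1 / p)"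

definition Lp_space :: "'a measure \<Rightarrow> real \<Rightarrow> ('a \<Rightarrow> complex) set" where
  "Lp_space \<mu> p = {f. f \<in> borel_measurable \<mu> \<and> Lp_norm \<mu> p f < \<infinity>}"

definition dunkl_measure :: "real \<Rightarrow> real measure" where
  "dunkl_measure k =
     density lborel (\<lambda>x. ennreal (\<bar>x\<bar> powr (2 * k + 1) / (2 powr (k + 1) * Gamma (k + 1))))"

definition bessel_j :: "real \<Rightarrow> real \<Rightarrow> real" where
  "bessel_j k u =
     Gamma (k + 1) * (\<Sum>n. (-1) ^ n * (u / 2) ^ (2 * n) / (fact n * Gamma (real n + k + 1)))"

text \<open>\<open>dunkl_kernel k l x\<close> is $E_k(-il, x)$.\<close>

definition dunkl_kernel :: "real \<Rightarrow> real \<Rightarrow> real \<Rightarrow> complex" where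
  "dunkl_kernel k l x =
     of_real (bessel_j k (l * x)) -
     \<i> * of_real (l * x) / of_real (2 * (k + 1)) * of_real (bessel_j (k + 1) (l * x))"

text \<open>The integral transform on $L^1$ for $M = (a,b;c,d)$; \<open>powr\<close> on complex numbers is
  the principal branch.\<close>

definition lcdt_integral ::
    "real \<Rightarrow> real^2^2 \<Rightarrow> (real \<Rightarrow> complex) \<Rightarrow> real \<Rightarrow> complex" where
  "lcdt_integral k M f l =
     (let a = M $ 1 $ 1; b = M $ 1 $ 2; d = M $ 2 $ 2 in
        1 / ((\<i> * of_real b) powr of_real (k + 1)) *
        (\<integral>x. f x * exp (\<i> / 2 * of_real (d / b * l\<^sup>2 + a / b * x\<^sup>2)) *
               dunkl_kernel k (l / b) x \<partial>dunkl_measure k))"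

text \<open>Bounded linear operators $L^p \to L^q$, $q = p/(p-1)$, extending the integral
  transform from $L^1 \cap L^p$. Linearity and boundedness make such a \<open>T\<close> respect
  equality almost everywhere.\<close>

definition is_lcdt_extension ::
    "real \<Rightarrow> real^2^2 \<Rightarrow> real \<Rightarrow> ((real \<Rightarrow> complex) \<Rightarrow> real \<Rightarrow> complex) \<Rightarrow> bool" where
  "is_lcdt_extension k M p T \<longleftrightarrow>
     (let \<mu> = dunkl_measure k; q = p / (p - 1) in
        (\<forall>f\<in>Lp_space \<mu> p. T f \<in> Lp_space \<mu> q) \<and>
        (\<forall>f\<in>Lp_space \<mu> p. \<forall>g\<in>Lp_space \<mu> p. \<forall>\<alpha> \<beta>.
           AE x in \<mu>. T (\<lambda>t. \<alpha> * f t + \<beta> * g t) x = \<alpha> * T f x + \<beta> * T g x) \<and>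
        (\<exists>C::real. \<forall>f\<in>Lp_space \<mu> p. Lp_norm \<mu> q (T f) \<le> ennreal C * Lp_norm \<mu> p f) \<and>
        (\<forall>f\<in>Lp_space \<mu> 1 \<inter> Lp_space \<mu> p. AE x in \<mu>. T f x = lcdt_integral k M f x))"

text \<open>The extension is unique only up to equality almost everywhere, so a representative
  is chosen.\<close>

definition lcdt ::
    "real \<Rightarrow> real^2^2 \<Rightarrow> real \<Rightarrow> (real \<Rightarrow> complex) \<Rightarrow> real \<Rightarrow> complex" where
  "lcdt k M p = (SOME T. is_lcdt_extension k M p T)"

end

theory Submission
  imports Defs "HOL-Complex_Analysis.Conformal_Mappings"
begin

text \<open>The transform has a kernel bounded by \<open>|b|\<^bsup>-(k+1)\<^esup>\<close> and contracts $L^2$, so the Riesz--Thorin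
  argument gives the Hausdorff--Young inequality with constant \<open>|b|\<^bsup>-(k+1)(1 - 2/q)\<^esup>\<close>; the theorem
  follows by applying Hoelder's inequality to the transform on its support and to \<open>f\<close> on its support.

  The kernel bound comes from the decreasing energy \<open>j\<^sub>k\<^sup>2 + j\<^sub>k'\<^sup>2\<close> of Bessel's equation. For the $L^2$
  bound, the inversion formula is checked on \<open>e\<^bsup>-s x\<^sup>2\<^esup>\<close> and \<open>x e\<^bsup>-s x\<^sup>2\<^esup>\<close>; with the multiplication
  formula it makes the transform isometric on their span, and duality against this span, which is dense
  by Weierstrass' theorem in the variable \<open>e\<^bsup>-x\<^sup>2\<^esup>\<close>, yields the contraction property.

  Since the extension to $L^p$ is only a chosen operator, its existence is part of the proof. The
  truncations of \<open>f\<close> to \<open>{|f| \<ge> 1/n}\<close> lie in $L^1$ and approximate \<open>f\<close> in every $L^p$ containing it, so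
  the extensions for \<open>p\<^sub>1\<close> and \<open>p\<^sub>2\<close> satisfy the same bounds.\<close>

section \<open>The three lines theorem\<close>

text \<open>Since \<open>p1\<close> <= \<open>p2\<close> forces \<open>q2\<close> <=
  \<open>q1\<close>, Hoelder passes from q2 up to q1 on the support of the transform and from p1 up
  to p2 on the support of f. Hausdorff-Young is thus applied at p1 alone, which is why the constant
  carries q1. The endpoint constants are \<open>C\<close> = |b|^(-(k+1)) from L^1 to L^infinity and
  1 on L^2, because the dilation by b contributes |b|^(2k+2) and cancels the squared prefactor.
  Interpolation at theta = 2 - 2/p leaves C^(1 - theta) = C^(2/p - 1) = C^(1 - 2/q). Interpolation
  is carried out for the bilinear pairing of the transform of f with a second function g. Both
  arguments then lie in the same L^p, one analytic family serves for both, and duality returns the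
  L^q norm. The obstacle is that the transform is selected by \<open>SOME\<close> for a single
  exponent: all that is known is linearity almost everywhere, boundedness with an unspecified
  constant, and its values on the intersection with L^1. It must still obey the sharp bound at p1
  when selected for p2. Hence sharp bounds are proved for the convergent integral and carried over
  by an a.e. convergent subsequence and Fatou.\<close>

lemma three_lines_bounded:
  fixes F :: "complex \<Rightarrow> complex"
  assumes hol: "F holomorphic_on UNIV"
    and K: "\<And>z. 0 \<le> Re z \<Longrightarrow> Re z \<le> 1 \<Longrightarrow> norm (F z) \<le> K"
    and F0: "\<And>z. Re z = 0 \<Longrightarrow> norm (F z) \<le> 1" and F1: "\<And>z. Re z = 1 \<Longrightarrow> norm (F z) \<le> 1"
    and \<theta>: "0 \<le> \<theta>" "\<theta> \<le> 1"
  shows "norm (F (of_real \<theta>)) \<le> 1"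
proof -
  have eps: "norm (F (of_real \<theta>)) * exp (\<epsilon> * (\<theta>\<^sup>2 - 1)) \<le> 1" if \<epsilon>: "\<epsilon> > 0" for \<epsilon> :: real
  proof -
    \<comment> \<open>The Phragmen-Lindelof factor: on the strip its modulus is at most exp(-eps (Im
      z)^2), so the maximum modulus principle on a tall rectangle suffices; at a fixed point it
      tends to 1 as eps tends to 0.\<close>
    define G where "G z = F z * exp (of_real \<epsilon> * (z\<^sup>2 - 1))" for z
    have nG: "norm (G z) = norm (F z) * exp (\<epsilon> * ((Re z)\<^sup>2 - (Im z)\<^sup>2 - 1))" for z
      by (simp add: G_def norm_mult norm_exp_eq_Re power2_eq_square)
    have nG1: "norm (G z) \<le> norm (F z) * exp (- \<epsilon> * (Im z)\<^sup>2)" if "0 \<le> Re z" "Re z \<le> 1" for z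
    proof -
      have "(Re z)\<^sup>2 \<le> 1" using that by (simp add: power_le_one)
      then have "\<epsilon> * ((Re z)\<^sup>2 - (Im z)\<^sup>2 - 1) \<le> \<epsilon> * (- (Im z)\<^sup>2)"
        using \<epsilon> by (intro mult_left_mono) auto
      then show ?thesis unfolding nG by (intro mult_left_mono) auto
    qed
    \<comment> \<open>On the horizontal edges the factor is at most exp(-eps R^2), and |K| <= exp
      |K|; this choice of R makes the product at most 1 there.\<close>
    obtain R :: real where R: "R > 0" "\<epsilon> * R\<^sup>2 \<ge> \<bar>K\<bar>"
    proof
      let ?R = "sqrt (\<bar>K\<bar> / \<epsilon>) + 1"
      show "?R > 0" using \<epsilon> by (intro add_nonneg_pos) auto
      have "(sqrt (\<bar>K\<bar> / \<epsilon>))\<^sup>2 \<le> ?R\<^sup>2" using \<epsilon> by (intro power_mono) auto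
      then show "\<epsilon> * ?R\<^sup>2 \<ge> \<bar>K\<bar>" using \<epsilon> by (simp add: field_simps)
    qed
    define S where "S = cbox (Complex 0 (- R)) (Complex 1 R)"
    have S: "z \<in> S \<longleftrightarrow> 0 \<le> Re z \<and> Re z \<le> 1 \<and> - R \<le> Im z \<and> Im z \<le> R" for z
      by (auto simp: S_def in_cbox_complex_iff)
    have holG: "G holomorphic_on UNIV"
      unfolding G_def by (intro holomorphic_intros hol)
    have "norm (G (of_real \<theta>)) \<le> 1"
    proof (rule maximum_modulus_frontier[of G S 1 "of_real \<theta>"])
      show "G holomorphic_on interior S" by (rule holomorphic_on_subset[OF holG]) simp
      show "continuous_on (closure S) G"
        by (rule continuous_on_subset[OF holomorphic_on_imp_continuous_on[OF holG]]) simp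
      show "bounded S" by (simp add: S_def)
      show "of_real \<theta> \<in> S" using \<theta> R by (simp add: S)
      fix z assume "z \<in> frontier S"
      then have zS: "z \<in> S" and zb: "z \<notin> box (Complex 0 (- R)) (Complex 1 R)"
        by (auto simp: S_def frontier_def interior_cbox)
      then consider "Re z = 0" | "Re z = 1" | "\<bar>Im z\<bar> = R"
        unfolding S in_box_complex_iff by fastforce
      then show "norm (G z) \<le> 1"
      proof cases
        case 1
        then have "norm (F z) * exp (- \<epsilon> * (Im z)\<^sup>2) \<le> 1 * 1"
          using F0 \<epsilon> by (intro mult_mono) auto
        then show ?thesis using nG1[of z] zS by (simp add: S)
      next
        case 2
        then have "norm (F z) * exp (- \<epsilon> * (Im z)\<^sup>2) \<le> 1 * 1"
          using F1 \<epsilon> by (intro mult_mono) auto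
        then show ?thesis using nG1[of z] zS by (simp add: S)
      next
        case 3
        have "norm (F z) \<le> \<bar>K\<bar>" using K[of z] zS unfolding S by linarith
        also have "\<bar>K\<bar> \<le> exp \<bar>K\<bar>" using exp_ge_add_one_self[of "\<bar>K\<bar>"] by linarith
        also have "\<dots> \<le> exp (\<epsilon> * R\<^sup>2)" using R by simp
        finally have "norm (F z) * exp (- \<epsilon> * R\<^sup>2) \<le> exp (\<epsilon> * R\<^sup>2) * exp (- \<epsilon> * R\<^sup>2)"
          by (intro mult_right_mono) auto
        also have "\<dots> = 1" by (simp flip: exp_add)
        finally have "norm (F z) * exp (- \<epsilon> * R\<^sup>2) \<le> 1" .
        moreover have "(Im z)\<^sup>2 = R\<^sup>2" using 3 by (metis power2_abs)
        ultimately show ?thesis using nG1[of z] zS by (simp add: S)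
      qed
    qed
    then show ?thesis by (simp add: nG)
  qed
  have "((\<lambda>\<epsilon>. norm (F (of_real \<theta>)) * exp (\<epsilon> * (\<theta>\<^sup>2 - 1))) \<longlongrightarrow>
      norm (F (of_real \<theta>)) * exp (0 * (\<theta>\<^sup>2 - 1))) (at_right 0)"
    by (intro tendsto_intros)
  then have "norm (F (of_real \<theta>)) * exp (0 * (\<theta>\<^sup>2 - 1)) \<le> 1"
    by (rule tendsto_upperbound) (use eps in \<open>auto intro: eventually_mono[OF eventually_at_right_less]\<close>)
  then show ?thesis by simp
qed

text \<open>Dividing by \<open>A\<^bsup>1-z\<^esup> B\<^bsup>z\<^esup>\<close> reduces to the case \<open>A = B = 1\<close>.\<close>

theorem three_lines:
  fixes F :: "complex \<Rightarrow> complex"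
  assumes hol: "F holomorphic_on UNIV"
    and K: "\<And>z. 0 \<le> Re z \<Longrightarrow> Re z \<le> 1 \<Longrightarrow> norm (F z) \<le> K"
    and F0: "\<And>z. Re z = 0 \<Longrightarrow> norm (F z) \<le> A" and F1: "\<And>z. Re z = 1 \<Longrightarrow> norm (F z) \<le> B"
    and A: "A > 0" and B: "B > 0" and \<theta>: "0 \<le> \<theta>" "\<theta> \<le> 1"
  shows "norm (F (of_real \<theta>)) \<le> A powr (1 - \<theta>) * B powr \<theta>"
proof -
  define G where "G z = F z * (exp (of_real (ln A) * (z - 1)) * exp (of_real (ln B) * (- z)))" for z
  have nG: "norm (G z) = norm (F z) * (A powr (Re z - 1) * B powr (- Re z))" for z
    using A B by (simp add: G_def norm_mult norm_exp_eq_Re powr_def mult.commute)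
  have "norm (G (of_real \<theta>)) \<le> 1"
  proof (rule three_lines_bounded[OF _ _ _ _ \<theta>])
    show "G holomorphic_on UNIV" unfolding G_def by (intro holomorphic_intros hol)
  next
    fix z assume z: "0 \<le> Re z" "Re z \<le> 1"
    \<comment> \<open>The exponents have modulus at most 1 on the strip. This crude bound only
      supplies the boundedness hypothesis and leaves no trace in the final constant.\<close>
    have "A powr (Re z - 1) \<le> exp \<bar>ln A\<bar>" "B powr (- Re z) \<le> exp \<bar>ln B\<bar>"
    proof -
      have 1: "\<bar>t * u\<bar> \<le> \<bar>u\<bar>" if "\<bar>t\<bar> \<le> 1" for t u :: real
        using mult_right_mono[OF that, of "\<bar>u\<bar>"] by (simp add: abs_mult)
      show "A powr (Re z - 1) \<le> exp \<bar>ln A\<bar>" "B powr (- Re z) \<le> exp \<bar>ln B\<bar>"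
        using A B z 1[of "Re z - 1" "ln A"] 1[of "- Re z" "ln B"] by (auto simp: powr_def)
    qed
    moreover have "norm (F z) \<le> \<bar>K\<bar>" using K[OF z] by linarith
    ultimately show "norm (G z) \<le> \<bar>K\<bar> * (exp \<bar>ln A\<bar> * exp \<bar>ln B\<bar>)"
      unfolding nG by (intro mult_mono) auto
  next
    fix z assume z: "Re z = 0"
    then show "norm (G z) \<le> 1" using F0[OF z] A B by (simp add: nG powr_minus field_simps)
  next
    fix z assume z: "Re z = 1"
    then show "norm (G z) \<le> 1" using F1[OF z] A B by (simp add: nG powr_minus field_simps)
  qed
  then have "norm (F (of_real \<theta>)) * (A powr (\<theta> - 1) * B powr (- \<theta>)) \<le> 1"
    by (simp add: nG)
  moreover have "A powr (\<theta> - 1) = inverse (A powr (1 - \<theta>))" by (simp flip: powr_minus)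
  ultimately show ?thesis using A B by (simp add: powr_minus field_simps)
qed

section \<open>Interpolation between $L^1$ and $L^2$ for integral kernels\<close>

text \<open>The value 0 is left out of \<open>U\<close> because its level set may have infinite
  measure; all other level sets have finite measure by integrability. The condition on \<psi> at 0
  makes the omission harmless.\<close>

lemma simple_integrable_comp:
  fixes f :: "'a \<Rightarrow> complex" and \<psi> :: "complex \<Rightarrow> 'b :: {banach, second_countable_topology}"
  assumes f: "simple_function M f" "integrable M f" and \<psi>: "\<psi> 0 = 0"
  defines "U \<equiv> f ` space M - {0}" and "A \<equiv> \<lambda>u. f -` {u} \<inter> space M"
  shows "finite U"
    and "\<And>u. u \<in> U \<Longrightarrow> integrable M (indicator (A u) :: 'a \<Rightarrow> real)"
    and "\<And>u. A u \<in> sets M"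
    and "\<And>x. x \<in> space M \<Longrightarrow> \<psi> (f x) = (\<Sum>u\<in>U. indicator (A u) x *\<^sub>R \<psi> u)"
    and "integrable M (\<lambda>x. \<psi> (f x))"
proof -
  show fin: "finite U" using f(1) by (simp add: U_def simple_function_def)
  show A: "A u \<in> sets M" for u
    unfolding A_def by (rule measurable_sets[OF borel_measurable_simple_function[OF f(1)]]) simp
  show int: "integrable M (indicator (A u) :: 'a \<Rightarrow> real)" if "u \<in> U" for u
  proof (rule Bochner_Integration.integrable_bound)
    show "integrable M (\<lambda>x. norm (f x) / norm u)" using f(2) by simp
    show "indicator (A u) \<in> borel_measurable M" using A by simp
    show "AE x in M. norm (indicator (A u) x :: real) \<le> norm (norm (f x) / norm u)"
      using that by (auto simp: A_def U_def indicator_def)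
  qed
  show *: "\<psi> (f x) = (\<Sum>u\<in>U. indicator (A u) x *\<^sub>R \<psi> u)" if "x \<in> space M" for x
  proof (cases "f x = 0")
    case True
    then show ?thesis using \<psi> by (auto simp: A_def U_def intro!: sum.neutral[symmetric])
  next
    case False
    then have "f x \<in> U" using that by (auto simp: U_def)
    have "(\<Sum>u\<in>U. indicator (A u) x *\<^sub>R \<psi> u) = (\<Sum>u\<in>U. if f x = u then \<psi> u else 0)"
      using that by (intro sum.cong) (auto simp: A_def)
    also have "\<dots> = \<psi> (f x)" using \<open>f x \<in> U\<close> fin by (simp add: sum.delta')
    finally show ?thesis by simp
  qed
  have "integrable M (\<lambda>x. \<Sum>u\<in>U. indicator (A u) x *\<^sub>R \<psi> u)"
    using int by (intro Bochner_Integration.integrable_sum integrable_scaleR_left) auto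
  then show "integrable M (\<lambda>x. \<psi> (f x))"
    using * by (subst Bochner_Integration.integrable_cong[OF refl]) auto
qed

text \<open>The analytic family \<open>f\<^sub>z = |f|\<^bsup>p (1 - z/2)\<^esup> sgn f\<close> of the interpolation argument is
  \<open>\<lambda>x. rt_family p z (f x)\<close>.\<close>

definition rt_family :: "real \<Rightarrow> complex \<Rightarrow> complex \<Rightarrow> complex" where
  "rt_family p z v = (if v = 0 then 0 else sgn v * exp (of_real (p * ln (norm v)) * (1 - z / 2)))"

lemma rt_family_0 [simp]: "rt_family p z 0 = 0"
  by (simp add: rt_family_def)

lemma norm_rt_family: "norm (rt_family p z v) = norm v powr (p * (1 - Re z / 2))"
  by (simp add: rt_family_def norm_mult norm_sgn norm_exp_eq_Re powr_def mult_ac)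

text \<open>The interpolation point: theta = 2 - 2/p solves 1/p = (1 - theta)/1 + theta/2, so the
  exponent p (1 - theta/2) is 1. The modulus is |v|^p on Re z = 0 and |v|^(p/2) on Re z = 1, which
  turns an L^p function into an L^1 and an L^2 function respectively.\<close>

lemma rt_family_self:
  assumes "p > 0"
  shows "rt_family p (of_real (2 - 2 / p)) v = v"
proof (cases "v = 0")
  case False
  have "(1 - complex_of_real (2 - 2 / p) / 2) = of_real (1 / p)" by (simp add: field_simps)
  then have "of_real (p * ln (norm v)) * (1 - complex_of_real (2 - 2 / p) / 2) =
      of_real (p * ln (norm v) * (1 / p))"
    by (simp only: of_real_mult)
  also have "\<dots> = of_real (ln (norm v))" using assms by simp
  finally have "of_real (p * ln (norm v)) * (1 - complex_of_real (2 - 2 / p) / 2) =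
      complex_of_real (ln (norm v))" .
  then have "exp (of_real (p * ln (norm v)) * (1 - complex_of_real (2 - 2 / p) / 2)) = of_real (norm v)"
    using False by (simp only: exp_of_real exp_ln zero_less_norm_iff not_False_eq_True)
  then show ?thesis
    using False by (simp only: rt_family_def if_False) (simp add: sgn_eq)
qed simp

lemma holomorphic_rt_family [holomorphic_intros]: "(\<lambda>z. rt_family p z v) holomorphic_on S"
  by (cases "v = 0") (auto simp: rt_family_def intro!: holomorphic_intros)

section \<open>Cauchy-Schwarz and Fatou inequalities\<close>

lemma cauchy_schwarz_nn_integral:
  fixes f g :: "'a \<Rightarrow> complex"
  assumes fg: "integrable M (\<lambda>x. f x * g x)" and [measurable]: "f \<in> borel_measurable M" "g \<in> borel_measurable M"
  shows "ennreal ((norm (\<integral>x. f x * g x \<partial>M))\<^sup>2) \<le>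
    (\<integral>\<^sup>+x. ennreal ((norm (f x))\<^sup>2) \<partial>M) * (\<integral>\<^sup>+x. ennreal ((norm (g x))\<^sup>2) \<partial>M)"
proof -
  let ?n = "norm (\<integral>x. f x * g x \<partial>M)"
  have "ennreal ?n \<le> (\<integral>\<^sup>+x. ennreal (norm (f x * g x)) \<partial>M)"
    by (rule integral_norm_bound_ennreal[OF fg])
  also have "\<dots> = (\<integral>\<^sup>+x. ennreal (norm (f x)) * ennreal (norm (g x)) \<partial>M)"
    by (simp add: norm_mult ennreal_mult)
  finally have "(ennreal ?n)\<^sup>2 \<le> (\<integral>\<^sup>+x. ennreal (norm (f x)) * ennreal (norm (g x)) \<partial>M)\<^sup>2"
    by (intro power_mono) auto
  also have "\<dots> \<le> (\<integral>\<^sup>+x. (ennreal (norm (f x)))\<^sup>2 \<partial>M) * (\<integral>\<^sup>+x. (ennreal (norm (g x)))\<^sup>2 \<partial>M)"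
    by (rule Cauchy_Schwarz_nn_integral) measurable
  finally show ?thesis by (simp add: ennreal_power)
qed

lemma cauchy_schwarz_integral:
  fixes f g :: "'a \<Rightarrow> complex"
  assumes fg: "integrable M (\<lambda>x. f x * g x)" and m: "f \<in> borel_measurable M" "g \<in> borel_measurable M"
    and f: "integrable M (\<lambda>x. (norm (f x))\<^sup>2)" and g: "integrable M (\<lambda>x. (norm (g x))\<^sup>2)"
  shows "(norm (\<integral>x. f x * g x \<partial>M))\<^sup>2 \<le> (\<integral>x. (norm (f x))\<^sup>2 \<partial>M) * (\<integral>x. (norm (g x))\<^sup>2 \<partial>M)"
  using cauchy_schwarz_nn_integral[OF fg m] f g
  by (simp add: nn_integral_eq_integral flip: ennreal_mult)

text \<open>Fatou's lemma, packaged so that upper bounds along an a.e. convergent sequence survive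
  the limit.\<close>

lemma nn_integral_le_limit:
  fixes u :: "nat \<Rightarrow> 'a \<Rightarrow> ennreal"
  assumes [measurable]: "\<And>n. u n \<in> borel_measurable M"
    and lim: "AE x in M. (\<lambda>n. u n x) \<longlonglongrightarrow> v x"
    and le: "\<And>n. (\<integral>\<^sup>+x. u n x \<partial>M) \<le> c n" and c: "c \<longlonglongrightarrow> c'"
  shows "(\<integral>\<^sup>+x. v x \<partial>M) \<le> c'"
proof -
  have "(\<integral>\<^sup>+x. v x \<partial>M) = (\<integral>\<^sup>+x. liminf (\<lambda>n. u n x) \<partial>M)"
    using lim by (intro nn_integral_cong_AE) (auto elim!: eventually_mono dest: lim_imp_Liminf[rotated])
  also have "\<dots> \<le> liminf (\<lambda>n. \<integral>\<^sup>+x. u n x \<partial>M)" by (rule nn_integral_liminf) measurable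
  also have "\<dots> \<le> liminf c" by (rule Liminf_mono) (simp add: le)
  also have "\<dots> = c'" by (rule lim_imp_Liminf[OF _ c]) simp
  finally show ?thesis .
qed

text \<open>The two endpoints of the interpolation. The L^2 bound is asked only where the integral
  converges absolutely, and as an inequality in [0,\<infinity>], so that no integrability of the
  transform has to be known beforehand.\<close>

locale L2_contractive_kernel = sigma_finite_measure M for M :: "'a measure" +
  fixes K :: "'a \<Rightarrow> 'a \<Rightarrow> complex" and C :: real
  assumes measurable_kernel: "(\<lambda>(l, x). K l x) \<in> borel_measurable (M \<Otimes>\<^sub>M M)"
    and kernel_bound: "norm (K l x) \<le> C"
    and C_pos: "C > 0"
    and L2_contraction: "\<And>f :: 'a \<Rightarrow> complex. integrable M f \<Longrightarrow> integrable M (\<lambda>x. (norm (f x))\<^sup>2) \<Longrightarrow>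
      (\<integral>\<^sup>+l. ennreal ((norm (\<integral>x. f x * K l x \<partial>M))\<^sup>2) \<partial>M) \<le> (\<integral>\<^sup>+x. ennreal ((norm (f x))\<^sup>2) \<partial>M)"
begin

lemma measurable_kernel' [measurable (raw)]:
  assumes "g \<in> N \<rightarrow>\<^sub>M M" "h \<in> N \<rightarrow>\<^sub>M M"
  shows "(\<lambda>z. K (g z) (h z)) \<in> borel_measurable N"
  using measurable_compose[OF measurable_Pair[OF assms] measurable_kernel] by simp

definition kop :: "('a \<Rightarrow> complex) \<Rightarrow> 'a \<Rightarrow> complex" where
  "kop f l = (\<integral>x. f x * K l x \<partial>M)"

lemma norm_mult_kernel_le: "norm (c * K l x) \<le> C * norm c"
  by (simp add: norm_mult mult.commute[of C] mult_left_mono kernel_bound)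

lemma integrable_mult_kernel:
  assumes "integrable M f" "l \<in> space M"
  shows "integrable M (\<lambda>x. f x * K l x)"
proof (rule Bochner_Integration.integrable_bound)
  show "integrable M (\<lambda>x. C * norm (f x))" using assms by simp
  have [measurable]: "f \<in> borel_measurable M" using assms(1) by simp
  show "(\<lambda>x. f x * K l x) \<in> borel_measurable M" using assms(2) by measurable
  show "AE x in M. norm (f x * K l x) \<le> norm (C * norm (f x))"
    using norm_mult_kernel_le C_pos by (simp add: abs_mult)
qed

lemma measurable_kop [measurable]:
  assumes [measurable]: "f \<in> borel_measurable M"
  shows "kop f \<in> borel_measurable M"
  unfolding kop_def by measurable

lemma norm_kop_le:
  assumes "integrable M f" "l \<in> space M"
  shows "norm (kop f l) \<le> C * (\<integral>x. norm (f x) \<partial>M)"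
proof -
  have "norm (kop f l) \<le> (\<integral>x. norm (f x * K l x) \<partial>M)"
    unfolding kop_def by (rule integral_norm_bound)
  also have "\<dots> \<le> (\<integral>x. C * norm (f x) \<partial>M)"
    using assms integrable_mult_kernel
    by (intro integral_mono integrable_norm norm_mult_kernel_le) auto
  finally show ?thesis by simp
qed

lemma kop_diff:
  assumes "integrable M f" "integrable M g" "l \<in> space M"
  shows "kop (\<lambda>x. f x - g x) l = kop f l - kop g l"
  using integrable_mult_kernel[OF assms(1,3)] integrable_mult_kernel[OF assms(2,3)]
  by (simp add: kop_def left_diff_distrib)

lemma kop_lincomb:
  assumes "integrable M f" "integrable M g" "l \<in> space M"
  shows "kop (\<lambda>x. \<alpha> * f x + \<beta> * g x) l = \<alpha> * kop f l + \<beta> * kop g l"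
  using integrable_mult_kernel[OF assms(1,3)] integrable_mult_kernel[OF assms(2,3)]
  by (simp add: kop_def distrib_right mult.assoc)

lemma integrable_kop_mult:
  assumes f: "integrable M f" and g: "integrable M g"
  shows "integrable M (\<lambda>l. kop f l * g l)"
proof (rule Bochner_Integration.integrable_bound)
  show "integrable M (\<lambda>l. C * (\<integral>x. norm (f x) \<partial>M) * norm (g l))" using g by simp
  have [measurable]: "f \<in> borel_measurable M" "g \<in> borel_measurable M" using f g by auto
  show "(\<lambda>l. kop f l * g l) \<in> borel_measurable M" by measurable
  show "AE l in M. norm (kop f l * g l) \<le> norm (C * (\<integral>x. norm (f x) \<partial>M) * norm (g l))"
    using norm_kop_le[OF f] C_pos
    by (auto simp: norm_mult abs_mult intro!: AE_I2 mult_right_mono)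
qed

lemma kop_pairing_L1:
  assumes f: "integrable M f" and g: "integrable M g"
  shows "norm (\<integral>l. kop f l * g l \<partial>M) \<le> C * (\<integral>x. norm (f x) \<partial>M) * (\<integral>x. norm (g x) \<partial>M)"
proof -
  have "norm (\<integral>l. kop f l * g l \<partial>M) \<le> (\<integral>l. norm (kop f l * g l) \<partial>M)"
    by (rule integral_norm_bound)
  also have "\<dots> \<le> (\<integral>l. C * (\<integral>x. norm (f x) \<partial>M) * norm (g l) \<partial>M)"
    using norm_kop_le[OF f] integrable_kop_mult[OF f g] g
    by (intro integral_mono integrable_norm) (auto simp: norm_mult intro!: mult_right_mono)
  finally show ?thesis by simp
qed

lemma kop_pairing_L2:
  assumes f: "integrable M f" "integrable M (\<lambda>x. (norm (f x))\<^sup>2)"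
    and g: "integrable M g" "integrable M (\<lambda>x. (norm (g x))\<^sup>2)"
  shows "norm (\<integral>l. kop f l * g l \<partial>M)
    \<le> sqrt ((\<integral>x. (norm (f x))\<^sup>2 \<partial>M) * (\<integral>x. (norm (g x))\<^sup>2 \<partial>M))"
proof -
  have m: "f \<in> borel_measurable M" "g \<in> borel_measurable M" using f g by auto
  let ?n = "norm (\<integral>l. kop f l * g l \<partial>M)"
  have "ennreal (?n\<^sup>2) \<le> (\<integral>\<^sup>+l. ennreal ((norm (kop f l))\<^sup>2) \<partial>M) * (\<integral>\<^sup>+l. ennreal ((norm (g l))\<^sup>2) \<partial>M)"
    by (rule cauchy_schwarz_nn_integral[OF integrable_kop_mult[OF f(1) g(1)] measurable_kop[OF m(1)] m(2)])
  also have "\<dots> \<le> (\<integral>\<^sup>+x. ennreal ((norm (f x))\<^sup>2) \<partial>M) * (\<integral>\<^sup>+l. ennreal ((norm (g l))\<^sup>2) \<partial>M)"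
    using L2_contraction[OF f] by (intro mult_right_mono) (auto simp: kop_def)
  also have "\<dots> = ennreal ((\<integral>x. (norm (f x))\<^sup>2 \<partial>M) * (\<integral>x. (norm (g x))\<^sup>2 \<partial>M))"
    using f g by (simp add: nn_integral_eq_integral ennreal_mult)
  finally have "?n\<^sup>2 \<le> (\<integral>x. (norm (f x))\<^sup>2 \<partial>M) * (\<integral>x. (norm (g x))\<^sup>2 \<partial>M)" by simp
  then show ?thesis by (rule real_le_rsqrt)
qed

text \<open>For simple functions the pairing along the analytic families is a finite combination of
  exponentials in z, hence entire and bounded on the strip. It is at most C X Y on Re z = 0 by the
  kernel bound and at most sqrt(X Y) on Re z = 1 by the L^2 contraction. At theta = 2 - 2/p the
  powers of X Y combine as (2/p - 1) + (1 - 1/p) = 1/p.\<close>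

lemma kop_pairing_interpolated_simple:
  assumes p: "1 < p" "p \<le> 2"
    and f: "simple_function M f" "integrable M f" and g: "simple_function M g" "integrable M g"
  shows "norm (\<integral>l. kop f l * g l \<partial>M) \<le> C powr (2 / p - 1) *
    ((\<integral>x. norm (f x) powr p \<partial>M) * (\<integral>x. norm (g x) powr p \<partial>M)) powr (1 / p)"
proof -
  define X where "X = (\<integral>x. norm (f x) powr p \<partial>M)"
  define Y where "Y = (\<integral>x. norm (g x) powr p \<partial>M)"
  \<comment> \<open>The three lines theorem asks for positive boundary constants. If X or Y is 0,
    then f or g vanishes almost everywhere and the L^1 bound already gives 0.\<close>
  have zero: "(\<integral>x. norm (h x) \<partial>M) = 0"
    if "simple_function M h" "integrable M h" "(\<integral>x. norm (h x) powr p \<partial>M) \<le> 0" for h :: "'a \<Rightarrow> complex"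
  proof -
    have "integrable M (\<lambda>x. norm (h x) powr p)"
      using simple_integrable_comp(5)[OF that(1,2), of "\<lambda>v. norm v powr p"] p by simp
    moreover have "(\<integral>x. norm (h x) powr p \<partial>M) = 0"
      by (intro antisym that(3) integral_nonneg_AE) simp
    ultimately have "AE x in M. norm (h x) powr p = 0"
      by (subst (asm) integral_nonneg_eq_0_iff_AE) auto
    then have "AE x in M. norm (h x) = 0" by simp
    then show ?thesis using integral_cong_AE[of "\<lambda>x. norm (h x)" M "\<lambda>_. 0"] that(2) by auto
  qed
  show ?thesis
  proof (cases "X > 0 \<and> Y > 0")
    case False
    then have "(\<integral>x. norm (f x) \<partial>M) = 0 \<or> (\<integral>x. norm (g x) \<partial>M) = 0"
      using zero[OF f] zero[OF g] unfolding X_def Y_def by linarith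
    then have "norm (\<integral>l. kop f l * g l \<partial>M) \<le> 0"
      using kop_pairing_L1[OF f(2) g(2)] by auto
    also have "0 \<le> C powr (2 / p - 1) * (X * Y) powr (1 / p)" by simp
    finally show ?thesis unfolding X_def Y_def .
  next
    case True
    define U V where "U = f ` space M - {0}" and "V = g ` space M - {0}"
    define A B where "A u = f -` {u} \<inter> space M" and "B u = g -` {u} \<inter> space M" for u
    define b where "b u v = (\<integral>l. kop (indicator (A u)) l * indicator (B v) l \<partial>M)" for u v
    define F where "F z = (\<Sum>u\<in>U. \<Sum>v\<in>V. rt_family p z u * rt_family p z v * b u v)" for z
    note fs = simple_integrable_comp[OF f, folded U_def A_def]
    note gs = simple_integrable_comp[OF g, folded V_def B_def]
    have intA: "integrable M (indicator (A u) :: 'a \<Rightarrow> complex)" if "u \<in> U" for u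
      using integrable_of_real[OF fs(2)[of "\<lambda>_. 0::complex", OF refl that], where 'a = complex]
      by (simp add: of_real_indicator)
    have intB: "integrable M (indicator (B u) :: 'a \<Rightarrow> complex)" if "u \<in> V" for u
      using integrable_of_real[OF gs(2)[of "\<lambda>_. 0::complex", OF refl that], where 'a = complex]
      by (simp add: of_real_indicator)
    have F_eq: "F z = (\<integral>l. kop (\<lambda>x. rt_family p z (f x)) l * rt_family p z (g l) \<partial>M)" for z
    proof -
      have 1: "kop (\<lambda>x. rt_family p z (f x)) l = (\<Sum>u\<in>U. rt_family p z u * kop (indicator (A u)) l)"
        if l: "l \<in> space M" for l
      proof -
        have "kop (\<lambda>x. rt_family p z (f x)) l =
            (\<integral>x. (\<Sum>u\<in>U. rt_family p z u * (indicator (A u) x * K l x)) \<partial>M)"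
          unfolding kop_def
          by (intro Bochner_Integration.integral_cong refl,
              subst fs(4)[of "rt_family p z"])
            (auto simp: sum_distrib_left scaleR_conv_of_real mult_ac of_real_indicator)
        also have "\<dots> = (\<Sum>u\<in>U. rt_family p z u * kop (indicator (A u)) l)"
          unfolding kop_def using intA integrable_mult_kernel[OF _ l]
          by (subst Bochner_Integration.integral_sum) auto
        finally show ?thesis .
      qed
      have "(\<integral>l. kop (\<lambda>x. rt_family p z (f x)) l * rt_family p z (g l) \<partial>M) =
        (\<integral>l. (\<Sum>u\<in>U. \<Sum>v\<in>V. rt_family p z u * rt_family p z v * (kop (indicator (A u)) l * indicator (B v) l)) \<partial>M)"
      proof (rule Bochner_Integration.integral_cong[OF refl])
        fix l assume l: "l \<in> space M"
        have 2: "rt_family p z (g l) = (\<Sum>v\<in>V. rt_family p z v * indicator (B v) l)"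
          using gs(4)[of "rt_family p z", OF _ l]
          by (simp add: scaleR_conv_of_real of_real_indicator mult.commute)
        show "kop (\<lambda>x. rt_family p z (f x)) l * rt_family p z (g l) =
          (\<Sum>u\<in>U. \<Sum>v\<in>V. rt_family p z u * rt_family p z v * (kop (indicator (A u)) l * indicator (B v) l))"
          unfolding 1[OF l] 2 sum_product by (simp add: mult_ac)
      qed
      also have "\<dots> = F z"
        unfolding F_def b_def using integrable_kop_mult[OF intA intB]
        by (subst Bochner_Integration.integral_sum | auto intro!: sum.cong)+
      finally show ?thesis by simp
    qed
    have int: "integrable M (\<lambda>x. rt_family p z (f x))" "integrable M (\<lambda>x. rt_family p z (g x))"
      "integrable M (\<lambda>x. (norm (rt_family p z (f x)))\<^sup>2)" "integrable M (\<lambda>x. (norm (rt_family p z (g x)))\<^sup>2)" for z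
      using simple_integrable_comp(5)[OF f, of "rt_family p z"] simple_integrable_comp(5)[OF g, of "rt_family p z"]
       simple_integrable_comp(5)[OF f, of "\<lambda>v. (norm (rt_family p z v))\<^sup>2"]
       simple_integrable_comp(5)[OF g, of "\<lambda>v. (norm (rt_family p z v))\<^sup>2"] by simp_all
    have "norm (F (of_real (2 - 2 / p))) \<le>
        (C * X * Y) powr (1 - (2 - 2 / p)) * (sqrt (X * Y)) powr (2 - 2 / p)"
    proof (rule three_lines)
      show "F holomorphic_on UNIV" unfolding F_def by (intro holomorphic_intros)
    next
      fix z assume z: "0 \<le> Re z" "Re z \<le> 1"
      \<comment> \<open>The exponent p (1 - Re z/2) stays between p/2 and p, so this bound is
        uniform in z.\<close>
      have le: "norm (rt_family p z v) \<le> 1 + norm v powr p" for v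
      proof (cases "norm v \<ge> 1")
        case True
        then have "norm v powr (p * (1 - Re z / 2)) \<le> norm v powr p"
          using z p by (intro powr_mono) (auto simp: mult_le_cancel_left1)
        then show ?thesis by (simp add: norm_rt_family add_increasing)
      next
        case False
        then have "norm v powr (p * (1 - Re z / 2)) \<le> 1"
          using z p by (intro powr_le1) (auto intro!: mult_nonneg_nonneg)
        then show ?thesis by (simp add: norm_rt_family add_increasing2)
      qed
      show "norm (F z) \<le> (\<Sum>u\<in>U. \<Sum>v\<in>V. (1 + norm u powr p) * (1 + norm v powr p) * norm (b u v))"
        unfolding F_def
        by (intro sum_norm_le) (auto simp: norm_mult intro!: mult_mono le)
    next
      fix z :: complex assume z: "Re z = 0"
      show "norm (F z) \<le> C * X * Y"
        using kop_pairing_L1[OF int(1,2), of z z] z by (simp add: F_eq norm_rt_family X_def Y_def)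
    next
      fix z :: complex assume z: "Re z = 1"
      have "(norm v powr (p / 2))\<^sup>2 = norm v powr p" for v :: complex
        by (simp add: power2_eq_square flip: powr_add)
      then show "norm (F z) \<le> sqrt (X * Y)"
        using kop_pairing_L2[OF int(1,3) int(2,4), of z z] z
        by (simp add: F_eq norm_rt_family X_def Y_def)
    qed (use True C_pos p in \<open>auto simp: field_simps\<close>)
    also have "F (of_real (2 - 2 / p)) = (\<integral>l. kop f l * g l \<partial>M)"
      unfolding F_eq using p by (simp add: rt_family_self del: of_real_diff)
    also have "(C * X * Y) powr (1 - (2 - 2 / p)) * (sqrt (X * Y)) powr (2 - 2 / p) =
        C powr (2 / p - 1) * (X * Y) powr (1 / p)"
    proof -
      have "sqrt (X * Y) powr (2 - 2 / p) = (X * Y) powr (1 - 1 / p)"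
        using True by (simp add: powr_powr powr_half_sqrt[symmetric] diff_divide_distrib)
      moreover have "(C * X * Y) powr (1 - (2 - 2 / p)) = C powr (2 / p - 1) * (X * Y) powr (2 / p - 1)"
        using True C_pos by (simp add: powr_mult mult.assoc)
      moreover have "(X * Y) powr (2 / p - 1) * (X * Y) powr (1 - 1 / p) = (X * Y) powr (1 / p)"
        using True by (simp flip: powr_add)
      ultimately show ?thesis by (simp add: mult.assoc)
    qed
    finally show ?thesis unfolding X_def Y_def .
  qed
qed

lemma simple_approximation:
  fixes f :: "'a \<Rightarrow> complex"
  assumes "integrable M f"
  obtains F :: "nat \<Rightarrow> 'a \<Rightarrow> complex" where
    "\<And>i. simple_function M (F i)" "\<And>i. integrable M (F i)"
    "\<And>x. x \<in> space M \<Longrightarrow> (\<lambda>i. F i x) \<longlonglongrightarrow> f x"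
    "\<And>i x. x \<in> space M \<Longrightarrow> norm (F i x) \<le> 2 * norm (f x)"
proof -
  have "f \<in> borel_measurable M" using assms by simp
  from borel_measurable_implies_sequence_metric[OF this, of 0]
  obtain F where F: "\<And>i. simple_function M (F i)" "\<And>x. x \<in> space M \<Longrightarrow> (\<lambda>i. F i x) \<longlonglongrightarrow> f x"
    "\<And>i x. x \<in> space M \<Longrightarrow> norm (F i x) \<le> 2 * norm (f x)"
    unfolding norm_conv_dist by metis
  moreover have "integrable M (F i)" for i
  proof (rule Bochner_Integration.integrable_bound)
    show "integrable M (\<lambda>x. 2 * norm (f x))" using assms by simp
    show "F i \<in> borel_measurable M" by (rule borel_measurable_simple_function[OF F(1)])
    show "AE x in M. norm (F i x) \<le> norm (2 * norm (f x))" using F(3) by (intro AE_I2) simp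
  qed
  ultimately show ?thesis using that by blast
qed

lemma tendsto_integral_norm_powr:
  fixes f :: "'a \<Rightarrow> complex"
  assumes "integrable M (\<lambda>x. norm (f x) powr p)" "p > 0" and [measurable]: "f \<in> borel_measurable M"
    and F: "\<And>i. F i \<in> borel_measurable M" "\<And>x. x \<in> space M \<Longrightarrow> (\<lambda>i. F i x) \<longlonglongrightarrow> f x"
    "\<And>i x. x \<in> space M \<Longrightarrow> norm (F i x) \<le> 2 * norm (f x)"
  shows "(\<lambda>i. \<integral>x. norm (F i x) powr p \<partial>M) \<longlonglongrightarrow> (\<integral>x. norm (f x) powr p \<partial>M)"
proof (rule integral_dominated_convergence)
  note F(1) [measurable]
  show "(\<lambda>x. norm (f x) powr p) \<in> borel_measurable M"
    and "\<And>i. (\<lambda>x. norm (F i x) powr p) \<in> borel_measurable M" by measurable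
  show "integrable M (\<lambda>x. 2 powr p * norm (f x) powr p)" using assms(1) by simp
  show "AE x in M. (\<lambda>i. norm (F i x) powr p) \<longlonglongrightarrow> norm (f x) powr p"
    using F(2) \<open>p > 0\<close> by (intro AE_I2 tendsto_powr' tendsto_norm tendsto_const) auto
  show "AE x in M. norm (norm (F i x) powr p) \<le> 2 powr p * norm (f x) powr p" for i
    using F(3) \<open>p > 0\<close> by (intro AE_I2) (auto simp flip: powr_mult intro!: powr_mono2)
qed

text \<open>Since the approximants satisfy |F_i| <= 2 |f|, the same sequence converges in L^1, which
  controls the pairing, and in L^p, which controls the bound.\<close>

lemma kop_pairing_interpolated:
  assumes p: "1 < p" "p \<le> 2"
    and f: "integrable M f" "integrable M (\<lambda>x. norm (f x) powr p)"
    and g: "integrable M g" "integrable M (\<lambda>x. norm (g x) powr p)"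
  shows "norm (\<integral>l. kop f l * g l \<partial>M) \<le> C powr (2 / p - 1) *
    ((\<integral>x. norm (f x) powr p \<partial>M) * (\<integral>x. norm (g x) powr p \<partial>M)) powr (1 / p)"
proof -
  obtain F where F: "\<And>i. simple_function M (F i)" "\<And>i. integrable M (F i)"
    "\<And>x. x \<in> space M \<Longrightarrow> (\<lambda>i. F i x) \<longlonglongrightarrow> f x" "\<And>i x. x \<in> space M \<Longrightarrow> norm (F i x) \<le> 2 * norm (f x)"
    using simple_approximation[OF f(1)] by blast
  obtain G where G: "\<And>i. simple_function M (G i)" "\<And>i. integrable M (G i)"
    "\<And>x. x \<in> space M \<Longrightarrow> (\<lambda>i. G i x) \<longlonglongrightarrow> g x" "\<And>i x. x \<in> space M \<Longrightarrow> norm (G i x) \<le> 2 * norm (g x)"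
    using simple_approximation[OF g(1)] by blast
  have [measurable]: "f \<in> borel_measurable M" "g \<in> borel_measurable M"
    "F i \<in> borel_measurable M" "G i \<in> borel_measurable M" for i
    using f g F(2) G(2) by auto
  have lim_kop: "(\<lambda>i. kop (F i) l) \<longlonglongrightarrow> kop f l" if l: "l \<in> space M" for l
    unfolding kop_def
  proof (rule integral_dominated_convergence)
    show "(\<lambda>x. f x * K l x) \<in> borel_measurable M" "(\<lambda>x. F i x * K l x) \<in> borel_measurable M" for i
      using l by measurable
    show "integrable M (\<lambda>x. C * (2 * norm (f x)))" using f by simp
    show "AE x in M. (\<lambda>i. F i x * K l x) \<longlonglongrightarrow> f x * K l x"
      using F(3) by (intro AE_I2 tendsto_intros)
    show "AE x in M. norm (F i x * K l x) \<le> C * (2 * norm (f x))" for i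
    proof (intro AE_I2)
      fix x assume "x \<in> space M"
      then show "norm (F i x * K l x) \<le> C * (2 * norm (f x))"
        using order_trans[OF norm_mult_kernel_le mult_left_mono[OF F(4)[of x i], of C]] C_pos by simp
    qed
  qed
  have bound_kop: "norm (kop (F i) l) \<le> C * (2 * (\<integral>x. norm (f x) \<partial>M))" if l: "l \<in> space M" for l i
  proof -
    have "(\<integral>x. norm (F i x) \<partial>M) \<le> (\<integral>x. 2 * norm (f x) \<partial>M)"
      using F f by (intro integral_mono) auto
    then have "C * (\<integral>x. norm (F i x) \<partial>M) \<le> C * (2 * (\<integral>x. norm (f x) \<partial>M))"
      using C_pos by (intro mult_left_mono) auto
    then show ?thesis by (rule order_trans[OF norm_kop_le[OF F(2) l]])
  qed
  have "(\<lambda>i. \<integral>l. kop (F i) l * G i l \<partial>M) \<longlonglongrightarrow> (\<integral>l. kop f l * g l \<partial>M)"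
  proof (rule integral_dominated_convergence)
    show "(\<lambda>l. kop f l * g l) \<in> borel_measurable M" "(\<lambda>l. kop (F i) l * G i l) \<in> borel_measurable M" for i
      by measurable
    show "integrable M (\<lambda>l. C * (2 * (\<integral>x. norm (f x) \<partial>M)) * (2 * norm (g l)))" using g by simp
    show "AE l in M. (\<lambda>i. kop (F i) l * G i l) \<longlonglongrightarrow> kop f l * g l"
      using lim_kop G(3) by (intro AE_I2 tendsto_mult)
    show "AE l in M. norm (kop (F i) l * G i l) \<le> C * (2 * (\<integral>x. norm (f x) \<partial>M)) * (2 * norm (g l))" for i
      unfolding norm_mult using C_pos
      by (intro AE_I2 mult_mono bound_kop G(4)) auto
  qed
  then have lim: "(\<lambda>i. norm (\<integral>l. kop (F i) l * G i l \<partial>M)) \<longlonglongrightarrow> norm (\<integral>l. kop f l * g l \<partial>M)"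
    by (rule tendsto_norm)
  have "(\<lambda>i. C powr (2 / p - 1) *
      ((\<integral>x. norm (F i x) powr p \<partial>M) * (\<integral>x. norm (G i x) powr p \<partial>M)) powr (1 / p)) \<longlonglongrightarrow>
    C powr (2 / p - 1) * ((\<integral>x. norm (f x) powr p \<partial>M) * (\<integral>x. norm (g x) powr p \<partial>M)) powr (1 / p)"
    using p f(2) g(2) F(3,4) G(3,4)
    by (intro tendsto_mult tendsto_const tendsto_powr' tendsto_integral_norm_powr)
      (auto intro!: always_eventually mult_nonneg_nonneg integral_nonneg_AE)
  from LIMSEQ_le[OF lim this] show ?thesis
    using kop_pairing_interpolated_simple[OF p F(1,2) G(1,2)] by blast
qed

text \<open>Duality with the extremal function: g is the conjugate sign of \<open>kop f\<close>
  times |kop f|^(q-1), cut to a set of finite measure. Then |g|^p and \<open>kop f\<close> times g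
  both equal |kop f|^q there, and their integral Y satisfies Y <= N Y^(1/p). As \<open>kop f\<close>
  is bounded, the cut makes Y finite, so division yields Y^(1/q) <= N; exhausting the space finishes
  the argument.\<close>

theorem hausdorff_young:
  assumes p: "1 < p" "p \<le> 2" and q: "q = p / (p - 1)"
    and f: "integrable M f" "integrable M (\<lambda>x. norm (f x) powr p)"
  shows "(\<integral>\<^sup>+l. ennreal (norm (kop f l) powr q) \<partial>M)
    \<le> ennreal ((C powr (2 / p - 1) * (\<integral>x. norm (f x) powr p \<partial>M) powr (1 / p)) powr q)"
proof -
  have q1: "q > 1" "(q - 1) * p = q" "1 - 1 / p = 1 / q"
    using p by (auto simp: q field_simps)
  define X where "X = (\<integral>x. norm (f x) powr p \<partial>M)"
  define N where "N = C powr (2 / p - 1) * X powr (1 / p)"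
  have [measurable]: "f \<in> borel_measurable M" using f by simp
  obtain A :: "nat \<Rightarrow> 'a set" where A: "range A \<subseteq> sets M" "(\<Union>i. A i) = space M"
    "\<And>i. emeasure M (A i) \<noteq> \<infinity>" "incseq A"
    using sigma_finite_incseq by blast
  have [measurable]: "A i \<in> sets M" for i using A(1) by auto
  define u where "u n l = indicator (A n) l * norm (kop f l) powr q" for n l
  have le: "(\<integral>\<^sup>+l. ennreal (u n l) \<partial>M) \<le> ennreal (N powr q)" for n
  proof -
    define g where "g l = indicator (A n) l * (cnj (sgn (kop f l)) * of_real (norm (kop f l) powr (q - 1)))" for l
    define c where "c = C * (\<integral>x. norm (f x) \<partial>M)"
    have c: "c \<ge> 0" using C_pos by (simp add: c_def)
    have ind: "integrable M (indicator (A n) :: 'a \<Rightarrow> real)"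
      using A(3) by (simp add: less_top)
    have sgn_meas: "(\<lambda>l. sgn (kop f l)) \<in> borel_measurable M"
      unfolding sgn_div_norm by measurable
    have "cnj \<in> borel_measurable borel"
      by (intro borel_measurable_continuous_onI continuous_intros)
    note [measurable] = sgn_meas this
    have [measurable]: "g \<in> borel_measurable M"
      unfolding g_def by measurable
    have ng: "norm (g l) powr p = u n l" for l
      using q1 by (auto simp: g_def u_def norm_mult norm_sgn indicator_def powr_powr)
    have gi: "integrable M g"
    proof (rule Bochner_Integration.integrable_bound)
      show "integrable M (\<lambda>l. indicator (A n) l * c powr (q - 1))" using ind by simp
      show "AE l in M. norm (g l) \<le> norm (indicator (A n) l * c powr (q - 1))"
        using norm_kop_le[OF f(1)] q1
        by (intro AE_I2) (auto simp: g_def norm_mult norm_sgn indicator_def c_def intro!: powr_mono2)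
    qed fact
    have ui: "integrable M (u n)"
    proof (rule Bochner_Integration.integrable_bound)
      show "integrable M (\<lambda>l. indicator (A n) l * c powr q)" using ind by simp
      show "u n \<in> borel_measurable M" unfolding u_def by measurable
      show "AE l in M. norm (u n l) \<le> norm (indicator (A n) l * c powr q)"
        using norm_kop_le[OF f(1)] q1
        by (intro AE_I2) (auto simp: u_def indicator_def c_def intro!: powr_mono2)
    qed
    have kg: "kop f l * g l = of_real (u n l)" for l
    proof (cases "kop f l = 0")
      case False
      have "kop f l * cnj (sgn (kop f l)) = kop f l * cnj (kop f l) / of_real (norm (kop f l))"
        by (simp add: sgn_eq)
      also have "\<dots> = of_real ((norm (kop f l))\<^sup>2) / of_real (norm (kop f l))"
        by (simp only: complex_norm_square)
      also have "\<dots> = of_real (norm (kop f l))"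
        using False by (simp add: power2_eq_square)
      finally have 1: "kop f l * cnj (sgn (kop f l)) = of_real (norm (kop f l))" .
      have 2: "norm (kop f l) * norm (kop f l) powr (q - 1) = norm (kop f l) powr q"
        using False by (simp add: powr_diff)
      have "kop f l * g l = indicator (A n) l *
          ((kop f l * cnj (sgn (kop f l))) * of_real (norm (kop f l) powr (q - 1)))"
        by (simp add: g_def mult_ac)
      also have "\<dots> = indicator (A n) l * of_real (norm (kop f l) powr q)"
        unfolding 1 of_real_mult[symmetric] 2 ..
      finally show ?thesis by (simp add: u_def of_real_indicator)
    qed (simp add: g_def u_def)
    define Y where "Y = (\<integral>l. u n l \<partial>M)"
    have Y0: "Y \<ge> 0" unfolding Y_def by (intro integral_nonneg_AE) (simp add: u_def)
    have "norm (\<integral>l. kop f l * g l \<partial>M) = Y"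
      unfolding kg using Y0 by (simp add: Y_def)
    then have "Y \<le> C powr (2 / p - 1) * (X * Y) powr (1 / p)"
      using kop_pairing_interpolated[OF p f gi] ui by (simp add: ng X_def Y_def)
    also have "\<dots> = N * Y powr (1 / p)"
      using Y0 by (simp add: N_def powr_mult X_def)
    finally have YN: "Y \<le> N * Y powr (1 / p)" .
    have "Y \<le> N powr q"
    proof (cases "Y = 0")
      case False
      then have "Y powr (1 / q) = Y / Y powr (1 / p)" using Y0 by (simp add: powr_diff flip: q1(3))
      also have "\<dots> \<le> N" using YN False Y0 by (simp add: divide_le_eq)
      finally have "(Y powr (1 / q)) powr q \<le> N powr q" using q1 by (intro powr_mono2) auto
      then show ?thesis using Y0 q1 False by (simp add: powr_powr)
    qed simp
    moreover have "(\<integral>\<^sup>+l. ennreal (u n l) \<partial>M) = ennreal Y"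
      unfolding Y_def by (rule nn_integral_eq_integral[OF ui]) (simp add: u_def)
    ultimately show ?thesis by (simp add: ennreal_leI)
  qed
  have "(\<integral>\<^sup>+l. ennreal (norm (kop f l) powr q) \<partial>M) \<le> ennreal (N powr q)"
  proof (rule nn_integral_le_limit[OF _ _ le tendsto_const])
    show "(\<lambda>l. ennreal (u n l)) \<in> borel_measurable M" for n unfolding u_def by measurable
    show "AE l in M. (\<lambda>n. ennreal (u n l)) \<longlonglongrightarrow> ennreal (norm (kop f l) powr q)"
    proof (intro AE_I2 tendsto_ennrealI)
      fix l assume "l \<in> space M"
      then obtain i where "l \<in> A i" using A(2) by auto
      then have "l \<in> A n" if "n \<ge> i" for n using A(4) that by (auto dest: incseqD)
      then have "eventually (\<lambda>n. u n l = norm (kop f l) powr q) sequentially"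
        unfolding eventually_sequentially u_def by (intro exI[of _ i]) auto
      then show "(\<lambda>n. u n l) \<longlonglongrightarrow> norm (kop f l) powr q" by (rule tendsto_eventually)
    qed
  qed
  then show ?thesis unfolding N_def X_def .
qed

end

section \<open>Completeness of $L^p$ and truncation\<close>

text \<open>The p-th power of the norm, as a real number. A Bochner integral defaults to 0 without
  integrability, so its bounds are meaningful only together with membership in
  \<open>Lp_space\<close>.\<close>

definition Lp_int :: "'a measure \<Rightarrow> real \<Rightarrow> ('a \<Rightarrow> complex) \<Rightarrow> real" where
  "Lp_int M p f = (\<integral>x. norm (f x) powr p \<partial>M)"

lemma Lp_int_nonneg [simp]: "0 \<le> Lp_int M p f"
  by (simp add: Lp_int_def integral_nonneg_AE)

lemma Lp_int_cong: "(\<And>x. x \<in> space M \<Longrightarrow> f x = g x) \<Longrightarrow> Lp_int M p f = Lp_int M p g"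
  unfolding Lp_int_def by (intro Bochner_Integration.integral_cong) auto

lemma ennreal_rpow_less_top_iff: "a \<noteq> 0 \<Longrightarrow> ennreal_rpow x a < top \<longleftrightarrow> x < top"
  by (auto simp: ennreal_rpow_def less_top)

lemma ennreal_rpow_ennreal: "a \<noteq> 0 \<Longrightarrow> x \<ge> 0 \<Longrightarrow> ennreal_rpow (ennreal x) a = ennreal (x powr a)"
  by (simp add: ennreal_rpow_def)

lemma Lp_space_iff:
  assumes "p > 0"
  shows "f \<in> Lp_space M p \<longleftrightarrow> f \<in> borel_measurable M \<and> integrable M (\<lambda>x. norm (f x) powr p)"
proof -
  have "f \<in> borel_measurable M \<Longrightarrow> (\<lambda>x. norm (f x) powr p) \<in> borel_measurable M" by measurable
  then show ?thesis
    using assms by (auto simp: Lp_space_def Lp_norm_def ennreal_rpow_less_top_iff integrable_iff_bounded)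
qed

lemma Lp_space_measurable: "f \<in> Lp_space M p \<Longrightarrow> f \<in> borel_measurable M"
  by (simp add: Lp_space_def)

lemma Lp_space_1_iff: "f \<in> Lp_space M 1 \<longleftrightarrow> integrable M f"
  by (auto simp: Lp_space_iff integrable_norm_iff)

lemma nn_integral_Lp_int:
  assumes "p > 0" "f \<in> Lp_space M p"
  shows "(\<integral>\<^sup>+x. ennreal (norm (f x) powr p) \<partial>M) = ennreal (Lp_int M p f)"
  unfolding Lp_int_def using assms by (intro nn_integral_eq_integral) (auto simp: Lp_space_iff)

lemma Lp_norm_eq:
  assumes "p > 0" "f \<in> Lp_space M p"
  shows "Lp_norm M p f = ennreal (Lp_int M p f powr (1 / p))"
  using assms by (simp add: Lp_norm_def nn_integral_Lp_int ennreal_rpow_ennreal)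

lemma Lp_spaceI_bound:
  assumes "p > 0" "c \<ge> 0" and [measurable]: "f \<in> borel_measurable M"
    and le: "(\<integral>\<^sup>+x. ennreal (norm (f x) powr p) \<partial>M) \<le> ennreal c"
  shows "f \<in> Lp_space M p" "Lp_int M p f \<le> c"
proof -
  have "(\<integral>\<^sup>+x. ennreal (norm (norm (f x) powr p)) \<partial>M) < \<infinity>"
    using le by (simp add: le_less_trans[OF _ ennreal_less_top])
  then show *: "f \<in> Lp_space M p"
    using assms(1) by (simp add: Lp_space_iff integrable_iff_bounded)
  show "Lp_int M p f \<le> c"
    using le unfolding nn_integral_Lp_int[OF assms(1) *] using assms(2) by simp
qed

lemma Lp_int_eq_0_AE:
  assumes "p > 0" "f \<in> Lp_space M p" "Lp_int M p f \<le> 0"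
  shows "AE x in M. f x = 0"
proof -
  have "(\<integral>x. norm (f x) powr p \<partial>M) = 0"
    using assms(3) Lp_int_nonneg[of M p f] unfolding Lp_int_def by linarith
  then have "AE x in M. norm (f x) powr p = 0"
    using assms by (subst (asm) integral_nonneg_eq_0_iff_AE) (auto simp: Lp_space_iff)
  then show ?thesis by simp
qed

text \<open>From |u + v| <= 2 max(|u|,|v|). This replaces Minkowski's inequality: the factor 2^p is
  harmless for convergence and qualitative boundedness, and the sharp constants come from
  elsewhere.\<close>

lemma Lp_lincomb:
  assumes p: "p > 0" and a: "a \<in> Lp_space M p" and b: "b \<in> Lp_space M p"
  shows "(\<lambda>x. \<alpha> * a x + \<beta> * b x) \<in> Lp_space M p" (is ?th1)
    and "Lp_int M p (\<lambda>x. \<alpha> * a x + \<beta> * b x) \<le>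
      2 powr p * (norm \<alpha> powr p * Lp_int M p a + norm \<beta> powr p * Lp_int M p b)" (is ?th2)
proof -
  have [measurable]: "a \<in> borel_measurable M" "b \<in> borel_measurable M"
    using a b by (auto simp: Lp_space_def)
  have i: "integrable M (\<lambda>x. norm (a x) powr p)" "integrable M (\<lambda>x. norm (b x) powr p)"
    using a b p by (auto simp: Lp_space_iff)
  have le: "norm (\<alpha> * u + \<beta> * v) powr p \<le>
      2 powr p * (norm \<alpha> powr p * norm u powr p + norm \<beta> powr p * norm v powr p)" for u v
  proof -
    let ?m = "max (norm (\<alpha> * u)) (norm (\<beta> * v))"
    have "norm (\<alpha> * u + \<beta> * v) \<le> 2 * ?m"
      using norm_triangle_ineq[of "\<alpha> * u" "\<beta> * v"] by linarith
    then have "norm (\<alpha> * u + \<beta> * v) powr p \<le> (2 * ?m) powr p"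
      using p by (intro powr_mono2) auto
    also have "\<dots> = 2 powr p * ?m powr p" by (simp add: powr_mult)
    also have "?m powr p \<le> norm (\<alpha> * u) powr p + norm (\<beta> * v) powr p"
      by (cases "norm (\<alpha> * u) \<le> norm (\<beta> * v)") (auto simp: max_def)
    finally show ?thesis by (simp add: norm_mult powr_mult)
  qed
  have int: "integrable M (\<lambda>x. 2 powr p * (norm \<alpha> powr p * norm (a x) powr p + norm \<beta> powr p * norm (b x) powr p))"
    using i by simp
  have int': "integrable M (\<lambda>x. norm (\<alpha> * a x + \<beta> * b x) powr p)"
    by (rule Bochner_Integration.integrable_bound[OF int]) (use le in \<open>auto intro!: AE_I2\<close>)
  then show ?th1 using p by (simp add: Lp_space_iff)
  show ?th2
    unfolding Lp_int_def using integral_mono[OF int' int le] i by simp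
qed

lemma Lp_diff:
  assumes p: "p > 0" and a: "a \<in> Lp_space M p" and b: "b \<in> Lp_space M p"
  shows "(\<lambda>x. a x - b x) \<in> Lp_space M p"
    and "Lp_int M p (\<lambda>x. a x - b x) \<le> 2 powr p * (Lp_int M p a + Lp_int M p b)"
  using Lp_lincomb[OF p a b, of 1 "-1"] by simp_all

lemma Lp_add:
  assumes p: "p > 0" and a: "a \<in> Lp_space M p" and b: "b \<in> Lp_space M p"
  shows "(\<lambda>x. a x + b x) \<in> Lp_space M p"
    and "Lp_int M p (\<lambda>x. a x + b x) \<le> 2 powr p * (Lp_int M p a + Lp_int M p b)"
  using Lp_lincomb[OF p a b, of 1 1] by simp_all

lemma convergent_if_dyadic_steps:
  fixes x :: "nat \<Rightarrow> 'a :: banach"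
  assumes "eventually (\<lambda>j. norm (x (Suc j) - x j) \<le> (1 / 2) ^ j) sequentially"
  shows "convergent x"
proof -
  have "summable (\<lambda>j. (1 / 2 :: real) ^ j)" by (simp add: summable_geometric)
  with assms have "summable (\<lambda>j. x (Suc j) - x j)" by (rule summable_comparison_test_ev)
  then have "convergent (\<lambda>n. x n - x 0)"
    unfolding summable_iff_convergent sum_lessThan_telescope .
  then show ?thesis using convergent_diff_const_right_iff by blast
qed

text \<open>Riesz-Fischer with a rate: a fast subsequence converges almost everywhere, and Fatou
  applied to its distance from \<open>h n\<close> preserves the bound \<open>d n\<close>.\<close>

lemma Lp_complete:
  fixes h :: "nat \<Rightarrow> 'a \<Rightarrow> complex"
  assumes q: "q > 0" and h: "\<And>n. h n \<in> Lp_space M q" and d: "d \<longlonglongrightarrow> 0"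
    and cauchy: "\<And>m n. n \<le> m \<Longrightarrow> Lp_int M q (\<lambda>x. h m x - h n x) \<le> d n"
  obtains h' where "h' \<in> Lp_space M q" "\<And>n. Lp_int M q (\<lambda>x. h' x - h n x) \<le> d n"
proof -
  note [measurable] = Lp_space_measurable[OF h]
  \<comment> \<open>The second factor compensates the weight (2^j)^q below and the first makes the
    weighted integrals summable. Almost everywhere the weighted terms then tend to 0, which forces
    steps of size at most 2^(-j) eventually.\<close>
  define e :: "nat \<Rightarrow> real" where "e j = (1 / 2) ^ j * ((1 / 2) ^ j) powr q" for j
  have "\<exists>N. \<forall>n\<ge>N. d n \<le> e j" for j
  proof -
    have "e j > 0" by (simp add: e_def)
    then have "eventually (\<lambda>n. d n < e j) sequentially" using d by (rule order_tendstoD(2)[rotated])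
    then show ?thesis unfolding eventually_sequentially using less_imp_le by blast
  qed
  then obtain N where N: "\<And>j n. n \<ge> N j \<Longrightarrow> d n \<le> e j" by metis
  \<comment> \<open>The sum makes r monotone and at least N j; the summand j makes it at least j, so
    that r (j + n) >= n.\<close>
  define r where "r j = j + (\<Sum>i\<le>j. N i)" for j
  have r: "r j \<ge> N j" "r j \<ge> j" "r j \<le> r (Suc j)" for j
    using member_le_sum[of j "{..j}" N] by (auto simp: r_def trans_le_add2)
  define u where "u j x = norm (h (r (Suc j)) x - h (r j) x) powr q" for j x
  have [measurable]: "u j \<in> borel_measurable M" for j unfolding u_def by measurable
  have u_le: "(\<integral>\<^sup>+x. ennreal ((2 ^ j) powr q * u j x) \<partial>M) \<le> ennreal ((1 / 2) ^ j)" for j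
  proof -
    have "(\<integral>\<^sup>+x. ennreal ((2 ^ j) powr q * u j x) \<partial>M) =
        ennreal ((2 ^ j) powr q) * (\<integral>\<^sup>+x. ennreal (u j x) \<partial>M)"
      by (subst nn_integral_cmult[symmetric]) (auto simp: ennreal_mult u_def)
    also have "(\<integral>\<^sup>+x. ennreal (u j x) \<partial>M) = ennreal (Lp_int M q (\<lambda>x. h (r (Suc j)) x - h (r j) x))"
      unfolding u_def by (rule nn_integral_Lp_int[OF q Lp_diff(1)[OF q h h]])
    also have "\<dots> \<le> ennreal (e j)"
      using cauchy[OF r(3)] N[OF r(1)] by (intro ennreal_leI) (rule order_trans)
    also have "ennreal ((2 ^ j) powr q) * ennreal (e j) = ennreal ((1 / 2) ^ j)"
      by (simp add: e_def mult.left_commute flip: ennreal_mult powr_mult power_mult_distrib)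
    finally show ?thesis by (simp add: mult_left_mono)
  qed
  have "(\<integral>\<^sup>+x. (\<Sum>j. ennreal ((2 ^ j) powr q * u j x)) \<partial>M) =
      (\<Sum>j. \<integral>\<^sup>+x. ennreal ((2 ^ j) powr q * u j x) \<partial>M)"
    by (rule nn_integral_suminf) measurable
  also have "\<dots> \<le> (\<Sum>j. ennreal ((1 / 2) ^ j))"
    by (intro suminf_le u_le summableI)
  also have "\<dots> < \<infinity>"
    by (simp add: suminf_ennreal2 summable_geometric)
  finally have "AE x in M. (\<Sum>j. ennreal ((2 ^ j) powr q * u j x)) \<noteq> \<infinity>"
    by (intro nn_integral_PInf_AE) auto
  then have AE_conv: "AE x in M. convergent (\<lambda>j. h (r j) x)"
  proof eventually_elim
    case (elim x)
    then have "summable (\<lambda>j. (2 ^ j) powr q * u j x)"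
      by (intro summable_suminf_not_top) (auto simp: u_def)
    then have "(\<lambda>j. (2 ^ j) powr q * u j x) \<longlonglongrightarrow> 0" by (rule summable_LIMSEQ_zero)
    then have "eventually (\<lambda>j. (2 ^ j) powr q * u j x < 1) sequentially" by (rule order_tendstoD(2)) simp
    then show ?case
    proof (intro convergent_if_dyadic_steps, eventually_elim)
      case (elim j)
      let ?n = "norm (h (r (Suc j)) x - h (r j) x)"
      have "(2 ^ j * ?n) powr q < 1 powr q" using elim by (simp add: u_def powr_mult)
      then have "2 ^ j * ?n < 1" using q by (meson not_le powr_mono2 less_imp_le zero_le_one)
      then show "?n \<le> (1 / 2) ^ j" by (simp add: power_one_over field_simps)
    qed
  qed
  \<comment> \<open>Where the subsequence diverges, \<open>lim\<close> is an arbitrary value; this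
    happens only on a null set and measurability is kept.\<close>
  define h' where "h' x = lim (\<lambda>j. h (r j) x)" for x
  have [measurable]: "h' \<in> borel_measurable M" unfolding h'_def by measurable
  have le: "(\<integral>\<^sup>+x. ennreal (norm (h' x - h n x) powr q) \<partial>M) \<le> ennreal (d n)" for n
  proof (rule nn_integral_le_limit[OF _ _ _ tendsto_const])
    let ?u = "\<lambda>j x. ennreal (norm (h (r (j + n)) x - h n x) powr q)"
    show "?u j \<in> borel_measurable M" for j by measurable
    show "AE x in M. (\<lambda>j. ?u j x) \<longlonglongrightarrow> ennreal (norm (h' x - h n x) powr q)"
      using AE_conv
    proof eventually_elim
      case (elim x)
      then have "(\<lambda>j. h (r j) x) \<longlonglongrightarrow> h' x" by (simp add: convergent_LIMSEQ_iff h'_def)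
      then have "(\<lambda>j. h (r (j + n)) x) \<longlonglongrightarrow> h' x" by (rule LIMSEQ_ignore_initial_segment)
      then show ?case using q
        by (intro tendsto_ennrealI tendsto_powr' tendsto_norm tendsto_diff tendsto_const) auto
    qed
    show "(\<integral>\<^sup>+x. ?u j x \<partial>M) \<le> ennreal (d n)" for j
      unfolding nn_integral_Lp_int[OF q Lp_diff(1)[OF q h h]]
      using r(2)[of "j + n"] by (intro ennreal_leI cauchy) simp
  qed
  have d0: "d n \<ge> 0" for n using cauchy[of n n] Lp_int_nonneg[of M q "\<lambda>x. h n x - h n x"] by linarith
  have diff: "(\<lambda>x. h' x - h n x) \<in> Lp_space M q" "Lp_int M q (\<lambda>x. h' x - h n x) \<le> d n" for n
    using Lp_spaceI_bound[OF q d0 _ le] by simp_all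
  have "h' \<in> Lp_space M q" using Lp_add(1)[OF q diff(1)[of 0] h[of 0]] by simp
  then show ?thesis using that diff(2) by blast
qed

text \<open>Multiplying by n instead of comparing with 1/n makes n = 0 give the zero function; with
  1/0 = 0 the comparison would keep all of f, which need not be in L^1.\<close>

definition truncate :: "('a \<Rightarrow> complex) \<Rightarrow> nat \<Rightarrow> 'a \<Rightarrow> complex" where
  "truncate f n x = (if 1 \<le> real n * norm (f x) then f x else 0)"

lemma truncate_measurable [measurable]:
  assumes [measurable]: "f \<in> borel_measurable M"
  shows "truncate f n \<in> borel_measurable M"
  unfolding truncate_def by measurable

text \<open>Where n |f| >= 1, also (n |f|)^(p-1) >= 1, so |f| <= n^(p-1) |f|^p. Only small values
  obstruct integrability of an L^p function.\<close>

lemma integrable_truncate: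
  assumes p: "p \<ge> 1" and f: "f \<in> Lp_space M p"
  shows "integrable M (truncate f n)"
proof (rule Bochner_Integration.integrable_bound)
  show "integrable M (\<lambda>x. real n powr (p - 1) * norm (f x) powr p)"
    using f p by (simp add: Lp_space_iff)
  show "truncate f n \<in> borel_measurable M"
    by (rule truncate_measurable[OF Lp_space_measurable[OF f]])
  have "norm (f x) \<le> real n powr (p - 1) * norm (f x) powr p" if "1 \<le> real n * norm (f x)" for x
  proof -
    have "1 * norm (f x) \<le> (real n * norm (f x)) powr (p - 1) * norm (f x)"
      using that p by (intro mult_right_mono ge_one_powr_ge_zero) auto
    also have "\<dots> = real n powr (p - 1) * (norm (f x) powr (p - 1) * norm (f x))"
      by (simp add: powr_mult)
    also have "norm (f x) powr (p - 1) * norm (f x) = norm (f x) powr p"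
      by (cases "f x = 0") (auto simp: powr_diff)
    finally show ?thesis by simp
  qed
  then show "AE x in M. norm (truncate f n x) \<le> norm (real n powr (p - 1) * norm (f x) powr p)"
    by (intro AE_I2) (auto simp: truncate_def)
qed

lemma truncate_Lp:
  assumes p: "p > 0" and f: "f \<in> Lp_space M p"
  shows "truncate f n \<in> Lp_space M p" "Lp_int M p (truncate f n) \<le> Lp_int M p f"
proof -
  have fi: "integrable M (\<lambda>x. norm (f x) powr p)" using f p by (simp add: Lp_space_iff)
  have [measurable]: "f \<in> borel_measurable M" using f by (simp add: Lp_space_def)
  have le: "norm (truncate f n x) powr p \<le> norm (f x) powr p" for x
    by (simp add: truncate_def)
  have ti: "integrable M (\<lambda>x. norm (truncate f n x) powr p)"
    by (rule Bochner_Integration.integrable_bound[OF fi]) (use le in \<open>auto intro!: AE_I2\<close>)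
  show "truncate f n \<in> Lp_space M p" using ti p by (simp add: Lp_space_iff)
  show "Lp_int M p (truncate f n) \<le> Lp_int M p f"
    unfolding Lp_int_def by (rule integral_mono[OF ti fi le])
qed

lemma tendsto_truncate:
  assumes p: "p > 0" and f: "f \<in> Lp_space M p"
  shows "(\<lambda>n. Lp_int M p (\<lambda>x. f x - truncate f n x)) \<longlonglongrightarrow> 0"
proof -
  have [measurable]: "f \<in> borel_measurable M" using f by (simp add: Lp_space_def)
  have "(\<lambda>n. \<integral>x. norm (f x - truncate f n x) powr p \<partial>M) \<longlonglongrightarrow> (\<integral>x. 0 \<partial>M)"
  proof (rule integral_dominated_convergence)
    show "integrable M (\<lambda>x. norm (f x) powr p)" using f p by (simp add: Lp_space_iff)
    show "AE x in M. norm (norm (f x - truncate f n x) powr p) \<le> norm (f x) powr p" for n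
      by (intro AE_I2) (auto simp: truncate_def)
    show "AE x in M. (\<lambda>n. norm (f x - truncate f n x) powr p) \<longlonglongrightarrow> 0"
    proof (intro AE_I2)
      fix x
      obtain k where k: "norm (f x) > 0 \<Longrightarrow> 1 < real k * norm (f x)"
        using ex_less_of_nat_mult by metis
      have "norm (f x - truncate f n x) powr p = 0" if "n \<ge> k" for n
      proof (cases "f x = 0")
        case False
        then have "1 < real k * norm (f x)" using k by simp
        also have "\<dots> \<le> real n * norm (f x)" using that by (intro mult_right_mono) auto
        finally show ?thesis by (simp add: truncate_def)
      qed (simp add: truncate_def)
      then show "(\<lambda>n. norm (f x - truncate f n x) powr p) \<longlonglongrightarrow> 0"
        by (intro tendsto_eventually) (auto simp: eventually_sequentially)
    qed
  qed measurable
  then show ?thesis by (simp add: Lp_int_def)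
qed

text \<open>The difference of two truncations is f on the band 1/m <= |f| < 1/n and 0 elsewhere.
  This bounds the tail by a null sequence depending on n only, as \<open>Lp_complete\<close>
  requires.\<close>

lemma truncate_diff_le:
  assumes p: "p > 0" and f: "f \<in> Lp_space M p" and "n \<le> m"
  shows "Lp_int M p (\<lambda>x. truncate f m x - truncate f n x) \<le> Lp_int M p (\<lambda>x. f x - truncate f n x)"
  unfolding Lp_int_def
proof (rule integral_mono)
  show "integrable M (\<lambda>x. norm (truncate f m x - truncate f n x) powr p)"
    "integrable M (\<lambda>x. norm (f x - truncate f n x) powr p)"
    using Lp_diff(1)[OF p truncate_Lp(1)[OF p f] truncate_Lp(1)[OF p f]]
      Lp_diff(1)[OF p f truncate_Lp(1)[OF p f]] p
    by (auto simp: Lp_space_iff)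
  fix x
  have "real n * norm (f x) \<le> real m * norm (f x)" using \<open>n \<le> m\<close> by (intro mult_right_mono) auto
  then have "norm (truncate f m x - truncate f n x) \<le> norm (f x - truncate f n x)"
    by (auto simp: truncate_def)
  then show "norm (truncate f m x - truncate f n x) powr p \<le> norm (f x - truncate f n x) powr p"
    using p by (intro powr_mono2) auto
qed

section \<open>Extension to $L^p$\<close>

locale L2_contractive_kernel_exponents = L2_contractive_kernel +
  fixes p q :: real
  assumes p: "1 < p" "p \<le> 2" and q: "q = p / (p - 1)"
begin

lemma p_pos: "p > 0" and p_ge_1: "p \<ge> 1" and q_pos: "q > 0"
  using p by (auto simp: q)

abbreviation HY_const :: real where
  "HY_const \<equiv> (C powr (2 / p - 1)) powr q"

lemma kop_Lp:
  assumes f: "f \<in> Lp_space M 1 \<inter> Lp_space M p"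
  shows "kop f \<in> Lp_space M q"
    and "Lp_int M q (kop f) \<le> HY_const * Lp_int M p f powr (q / p)"
proof -
  have i: "integrable M f" "integrable M (\<lambda>x. norm (f x) powr p)"
    using f p_pos by (auto simp: Lp_space_1_iff Lp_space_iff[OF p_pos])
  have "f \<in> borel_measurable M" using f by (auto simp: Lp_space_def)
  note m = measurable_kop[OF this]
  have "(C powr (2 / p - 1) * Lp_int M p f powr (1 / p)) powr q = HY_const * Lp_int M p f powr (q / p)"
    by (simp add: powr_mult powr_powr)
  with hausdorff_young[OF p q i]
  have le: "(\<integral>\<^sup>+l. ennreal (norm (kop f l) powr q) \<partial>M) \<le> ennreal (HY_const * Lp_int M p f powr (q / p))"
    by (simp add: Lp_int_def)
  show "kop f \<in> Lp_space M q" "Lp_int M q (kop f) \<le> HY_const * Lp_int M p f powr (q / p)"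
    by (rule Lp_spaceI_bound[OF q_pos _ m le]; simp)+
qed

lemma kop_diff_Lp:
  assumes f: "f \<in> Lp_space M 1 \<inter> Lp_space M p" and g: "g \<in> Lp_space M 1 \<inter> Lp_space M p"
  shows "Lp_int M q (\<lambda>x. kop f x - kop g x) \<le> HY_const * Lp_int M p (\<lambda>x. f x - g x) powr (q / p)"
proof -
  have "(\<lambda>x. f x - g x) \<in> Lp_space M 1 \<inter> Lp_space M p"
    using f g Lp_diff(1)[of 1] Lp_diff(1)[OF p_pos] by auto
  from kop_Lp(2)[OF this] show ?thesis
    using f g by (subst Lp_int_cong[where g = "kop (\<lambda>x. f x - g x)"]) (auto simp: kop_diff Lp_space_1_iff)
qed

lemma truncate_mem:
  "f \<in> Lp_space M p \<Longrightarrow> truncate f n \<in> Lp_space M 1 \<inter> Lp_space M p"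
  using integrable_truncate[OF p_ge_1] truncate_Lp(1)[OF p_pos] by (auto simp: Lp_space_1_iff)

text \<open>The closure of the graph of \<open>kop\<close>, restricted to the intersection of L^1
  and L^p, inside the product of L^p and L^q. A relation is used because the second component is
  determined only almost everywhere.\<close>

definition kop_limit :: "('a \<Rightarrow> complex) \<Rightarrow> ('a \<Rightarrow> complex) \<Rightarrow> bool" where
  "kop_limit f h \<longleftrightarrow> f \<in> Lp_space M p \<and> h \<in> Lp_space M q \<and>
     (\<exists>g. (\<forall>n. g n \<in> Lp_space M 1 \<inter> Lp_space M p) \<and>
       (\<lambda>n. Lp_int M p (\<lambda>x. f x - g n x)) \<longlonglongrightarrow> 0 \<and>
       (\<lambda>n. Lp_int M q (\<lambda>x. h x - kop (g n) x)) \<longlonglongrightarrow> 0)"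

lemma kop_limit_kop:
  assumes "f \<in> Lp_space M 1 \<inter> Lp_space M p"
  shows "kop_limit f (kop f)"
  unfolding kop_limit_def using assms kop_Lp(1)[OF assms]
  by (intro conjI exI[of _ "\<lambda>_. f"]) (auto simp: Lp_int_def)

lemma kop_limit_exists:
  assumes f: "f \<in> Lp_space M p"
  obtains h where "kop_limit f h"
proof -
  let ?d = "\<lambda>n. HY_const * Lp_int M p (\<lambda>x. f x - truncate f n x) powr (q / p)"
  have d: "?d \<longlonglongrightarrow> 0"
  proof -
    have "?d \<longlonglongrightarrow> HY_const * 0 powr (q / p)"
      using p_pos q_pos tendsto_truncate[OF p_pos f]
      by (intro tendsto_mult tendsto_const tendsto_powr') auto
    then show ?thesis by simp
  qed
  have cauchy: "Lp_int M q (\<lambda>x. kop (truncate f m) x - kop (truncate f n) x) \<le> ?d n" if "n \<le> m" for m n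
  proof -
    have "Lp_int M q (\<lambda>x. kop (truncate f m) x - kop (truncate f n) x) \<le>
        HY_const * Lp_int M p (\<lambda>x. truncate f m x - truncate f n x) powr (q / p)"
      by (rule kop_diff_Lp[OF truncate_mem[OF f] truncate_mem[OF f]])
    also have "\<dots> \<le> ?d n"
      using p_pos q_pos truncate_diff_le[OF p_pos f \<open>n \<le> m\<close>]
      by (intro mult_left_mono powr_mono2) auto
    finally show ?thesis .
  qed
  obtain h where "h \<in> Lp_space M q" "\<And>n. Lp_int M q (\<lambda>x. h x - kop (truncate f n) x) \<le> ?d n"
    using Lp_complete[OF q_pos kop_Lp(1)[OF truncate_mem[OF f]] d cauchy] by blast
  moreover from this(2) have "(\<lambda>n. Lp_int M q (\<lambda>x. h x - kop (truncate f n) x)) \<longlonglongrightarrow> 0"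
    by (intro tendsto_sandwich[OF _ _ tendsto_const d]) auto
  ultimately have "kop_limit f h"
    unfolding kop_limit_def using f truncate_mem[OF f] tendsto_truncate[OF p_pos f] by blast
  then show ?thesis by (rule that)
qed

text \<open>Its constant is crude. It serves to make the extension bounded and, applied to the pair
  of 0 and h - h', to make limits unique.\<close>

lemma kop_limit_bound:
  assumes "kop_limit f h"
  shows "Lp_int M q h \<le> 2 powr q * (HY_const * (2 powr p * Lp_int M p f) powr (q / p))"
proof -
  obtain g where f: "f \<in> Lp_space M p" and h: "h \<in> Lp_space M q"
    and g: "\<And>n. g n \<in> Lp_space M 1 \<inter> Lp_space M p"
    and lf: "(\<lambda>n. Lp_int M p (\<lambda>x. f x - g n x)) \<longlonglongrightarrow> 0"
    and lh: "(\<lambda>n. Lp_int M q (\<lambda>x. h x - kop (g n) x)) \<longlonglongrightarrow> 0"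
    using assms unfolding kop_limit_def by blast
  define b where "b n = 2 powr q * (Lp_int M q (\<lambda>x. h x - kop (g n) x) +
      HY_const * (2 powr p * (Lp_int M p (\<lambda>x. f x - g n x) + Lp_int M p f)) powr (q / p))" for n
  have le: "Lp_int M q h \<le> b n" for n
  proof -
    have gp: "g n \<in> Lp_space M p" using g by auto
    have "Lp_int M p (g n) = Lp_int M p (\<lambda>x. f x - (f x - g n x))" by simp
    also have "\<dots> \<le> 2 powr p * (Lp_int M p f + Lp_int M p (\<lambda>x. f x - g n x))"
      by (rule Lp_diff(2)[OF p_pos f Lp_diff(1)[OF p_pos f gp]])
    finally have 1: "HY_const * Lp_int M p (g n) powr (q / p) \<le>
        HY_const * (2 powr p * (Lp_int M p (\<lambda>x. f x - g n x) + Lp_int M p f)) powr (q / p)"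
      using p_pos q_pos by (intro mult_left_mono powr_mono2) (auto simp: add.commute)
    have "Lp_int M q h = Lp_int M q (\<lambda>x. (h x - kop (g n) x) + kop (g n) x)" by simp
    also have "\<dots> \<le> 2 powr q * (Lp_int M q (\<lambda>x. h x - kop (g n) x) + Lp_int M q (kop (g n)))"
      by (rule Lp_add(2)[OF q_pos Lp_diff(1)[OF q_pos h kop_Lp(1)[OF g]] kop_Lp(1)[OF g]])
    also have "\<dots> \<le> b n"
      unfolding b_def using order_trans[OF kop_Lp(2)[OF g] 1] by (intro mult_left_mono add_left_mono) auto
    finally show ?thesis .
  qed
  have "b \<longlonglongrightarrow> 2 powr q * (0 + HY_const * (2 powr p * (0 + Lp_int M p f)) powr (q / p))"
    unfolding b_def using p_pos q_pos
    by (intro tendsto_intros tendsto_powr' lf lh) (auto intro!: always_eventually)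
  from LIMSEQ_le_const[OF this] le show ?thesis by auto
qed

lemma kop_limit_lincomb:
  assumes "kop_limit f h" "kop_limit f' h'"
  shows "kop_limit (\<lambda>x. \<alpha> * f x + \<beta> * f' x) (\<lambda>x. \<alpha> * h x + \<beta> * h' x)"
proof -
  obtain g where f: "f \<in> Lp_space M p" and h: "h \<in> Lp_space M q"
    and g: "\<And>n. g n \<in> Lp_space M 1 \<inter> Lp_space M p"
    and lf: "(\<lambda>n. Lp_int M p (\<lambda>x. f x - g n x)) \<longlonglongrightarrow> 0"
    and lh: "(\<lambda>n. Lp_int M q (\<lambda>x. h x - kop (g n) x)) \<longlonglongrightarrow> 0"
    using assms(1) unfolding kop_limit_def by blast
  obtain g' where f': "f' \<in> Lp_space M p" and h': "h' \<in> Lp_space M q"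
    and g': "\<And>n. g' n \<in> Lp_space M 1 \<inter> Lp_space M p"
    and lf': "(\<lambda>n. Lp_int M p (\<lambda>x. f' x - g' n x)) \<longlonglongrightarrow> 0"
    and lh': "(\<lambda>n. Lp_int M q (\<lambda>x. h' x - kop (g' n) x)) \<longlonglongrightarrow> 0"
    using assms(2) unfolding kop_limit_def by blast
  have lim: "(\<lambda>n. Lp_int M r (\<lambda>x. (\<alpha> * a x + \<beta> * a' x) - (\<alpha> * b n x + \<beta> * b' n x))) \<longlonglongrightarrow> 0"
    if r: "r > 0" and m: "a \<in> Lp_space M r" "a' \<in> Lp_space M r" "\<And>n. b n \<in> Lp_space M r" "\<And>n. b' n \<in> Lp_space M r"
      and l: "(\<lambda>n. Lp_int M r (\<lambda>x. a x - b n x)) \<longlonglongrightarrow> 0"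
      and l': "(\<lambda>n. Lp_int M r (\<lambda>x. a' x - b' n x)) \<longlonglongrightarrow> 0" for r a a' b b'
  proof (rule tendsto_sandwich[OF _ _ tendsto_const])
    let ?b = "\<lambda>n. 2 powr r * (norm \<alpha> powr r * Lp_int M r (\<lambda>x. a x - b n x) +
      norm \<beta> powr r * Lp_int M r (\<lambda>x. a' x - b' n x))"
    have "?b \<longlonglongrightarrow> 2 powr r * (norm \<alpha> powr r * 0 + norm \<beta> powr r * 0)"
      by (intro tendsto_intros l l')
    then show "?b \<longlonglongrightarrow> 0" by simp
    have "Lp_int M r (\<lambda>x. (\<alpha> * a x + \<beta> * a' x) - (\<alpha> * b n x + \<beta> * b' n x)) =
        Lp_int M r (\<lambda>x. \<alpha> * (a x - b n x) + \<beta> * (a' x - b' n x))" for n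
      by (rule Lp_int_cong) (simp add: algebra_simps)
    also have "\<dots> n \<le> ?b n" for n
      by (rule Lp_lincomb(2)[OF r Lp_diff(1)[OF r m(1) m(3)] Lp_diff(1)[OF r m(2) m(4)]])
    finally show "eventually (\<lambda>n. Lp_int M r (\<lambda>x. (\<alpha> * a x + \<beta> * a' x) - (\<alpha> * b n x + \<beta> * b' n x)) \<le> ?b n) sequentially"
      by simp
  qed simp
  have gm: "g n \<in> Lp_space M p" "g' n \<in> Lp_space M p" "integrable M (g n)" "integrable M (g' n)" for n
    using g[of n] g'[of n] by (auto simp: Lp_space_1_iff)
  have "Lp_int M q (\<lambda>x. (\<alpha> * h x + \<beta> * h' x) - kop (\<lambda>x. \<alpha> * g n x + \<beta> * g' n x) x) =
      Lp_int M q (\<lambda>x. (\<alpha> * h x + \<beta> * h' x) - (\<alpha> * kop (g n) x + \<beta> * kop (g' n) x))" for n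
    by (rule Lp_int_cong) (simp add: kop_lincomb gm)
  then have "(\<lambda>n. Lp_int M q (\<lambda>x. (\<alpha> * h x + \<beta> * h' x) - kop (\<lambda>x. \<alpha> * g n x + \<beta> * g' n x) x)) \<longlonglongrightarrow> 0"
    using lim[OF q_pos h h' kop_Lp(1)[OF g] kop_Lp(1)[OF g'] lh lh'] by simp
  moreover have "(\<lambda>n. Lp_int M p (\<lambda>x. (\<alpha> * f x + \<beta> * f' x) - (\<alpha> * g n x + \<beta> * g' n x))) \<longlonglongrightarrow> 0"
    by (rule lim[OF p_pos f f' gm(1,2) lf lf'])
  moreover have "(\<lambda>x. \<alpha> * g n x + \<beta> * g' n x) \<in> Lp_space M 1 \<inter> Lp_space M p" for n
    using Lp_lincomb(1)[of 1 "g n" M "g' n"] Lp_lincomb(1)[OF p_pos gm(1,2)] g[of n] g'[of n] by auto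
  ultimately show ?thesis
    unfolding kop_limit_def
    using Lp_lincomb(1)[OF p_pos f f'] Lp_lincomb(1)[OF q_pos h h']
    by (intro conjI exI[of _ "\<lambda>n x. \<alpha> * g n x + \<beta> * g' n x"]) auto
qed

lemma kop_limit_unique:
  assumes "kop_limit f h" "kop_limit f h'"
  shows "AE x in M. h x = h' x"
proof -
  have "kop_limit (\<lambda>x. f x - f x) (\<lambda>x. h x - h' x)"
    using kop_limit_lincomb[OF assms, of 1 "-1"] by simp
  from kop_limit_bound[OF this] this have "AE x in M. h x - h' x = 0"
    by (intro Lp_int_eq_0_AE[OF q_pos]) (auto simp: kop_limit_def Lp_int_def)
  then show ?thesis by simp
qed

text \<open>Clause by clause the defining property of the chosen transform, with \<open>kop\<close>
  for the integral; once the two integrals are identified, the predicates coincide by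
  unfolding.\<close>

definition is_extension :: "(('a \<Rightarrow> complex) \<Rightarrow> 'a \<Rightarrow> complex) \<Rightarrow> bool" where
  "is_extension T \<longleftrightarrow>
     (\<forall>f\<in>Lp_space M p. T f \<in> Lp_space M q) \<and>
     (\<forall>f\<in>Lp_space M p. \<forall>g\<in>Lp_space M p. \<forall>\<alpha> \<beta>.
        AE x in M. T (\<lambda>t. \<alpha> * f t + \<beta> * g t) x = \<alpha> * T f x + \<beta> * T g x) \<and>
     (\<exists>B::real. \<forall>f\<in>Lp_space M p. Lp_norm M q (T f) \<le> ennreal B * Lp_norm M p f) \<and>
     (\<forall>f\<in>Lp_space M 1 \<inter> Lp_space M p. AE x in M. T f x = kop f x)"

text \<open>A limit is chosen separately for every function. Such a choice is linear only up to null
  sets, by uniqueness of limits, and this is exactly what the predicate demands.\<close>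

lemma is_extension_exists: "\<exists>T. is_extension T"
proof -
  have "\<forall>f\<in>Lp_space M p. \<exists>h. kop_limit f h" using kop_limit_exists by blast
  then obtain T where T: "\<And>f. f \<in> Lp_space M p \<Longrightarrow> kop_limit f (T f)"
    unfolding bchoice_iff by blast
  have Tq: "T f \<in> Lp_space M q" if "f \<in> Lp_space M p" for f
    using T[OF that] by (simp add: kop_limit_def)
  define B where "B = (2 powr q * (HY_const * (2 powr p) powr (q / p))) powr (1 / q)"
  have "Lp_norm M q (T f) \<le> ennreal B * Lp_norm M p f" if f: "f \<in> Lp_space M p" for f
  proof -
    have "Lp_int M q (T f) powr (1 / q) \<le> (2 powr q * (HY_const * (2 powr p * Lp_int M p f) powr (q / p))) powr (1 / q)"
      using q_pos by (intro powr_mono2 kop_limit_bound[OF T[OF f]]) auto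
    also have "\<dots> = B * Lp_int M p f powr (1 / p)"
      using q_pos p_pos by (simp add: B_def powr_mult powr_powr)
    finally show ?thesis
      using f Tq[OF f] p_pos q_pos by (simp add: Lp_norm_eq B_def ennreal_leI flip: ennreal_mult)
  qed
  moreover have "AE x in M. T (\<lambda>t. \<alpha> * f t + \<beta> * g t) x = \<alpha> * T f x + \<beta> * T g x"
    if "f \<in> Lp_space M p" "g \<in> Lp_space M p" for f g \<alpha> \<beta>
    by (rule kop_limit_unique[OF T[OF Lp_lincomb(1)[OF p_pos that]] kop_limit_lincomb[OF T T]]) (fact that)+
  moreover have "AE x in M. T f x = kop f x" if "f \<in> Lp_space M 1 \<inter> Lp_space M p" for f
    using kop_limit_unique[OF T kop_limit_kop[OF that]] that by simp
  ultimately have "is_extension T" unfolding is_extension_def using Tq by blast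
  then show ?thesis by blast
qed

text \<open>Proved for an arbitrary extension, since the selected one is known only through the
  predicate: boundedness is applied to f minus its truncation, and on truncations the extension
  agrees with the integral.\<close>

lemma extension_truncate:
  assumes T: "is_extension T" and f: "f \<in> Lp_space M p"
  shows "(\<lambda>n. Lp_int M q (\<lambda>x. T f x - kop (truncate f n) x)) \<longlonglongrightarrow> 0"
proof -
  obtain B where B: "\<And>f. f \<in> Lp_space M p \<Longrightarrow> Lp_norm M q (T f) \<le> ennreal B * Lp_norm M p f"
    using T unfolding is_extension_def by blast
  have Tq: "T f \<in> Lp_space M q" if "f \<in> Lp_space M p" for f
    using T that unfolding is_extension_def by blast
  have B': "Lp_int M q (T g) \<le> \<bar>B\<bar> powr q * Lp_int M p g powr (q / p)" if g: "g \<in> Lp_space M p" for g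
  proof -
    have "ennreal (Lp_int M q (T g) powr (1 / q)) \<le> ennreal B * ennreal (Lp_int M p g powr (1 / p))"
      using B[OF g] by (simp add: Lp_norm_eq[OF q_pos Tq[OF g]] Lp_norm_eq[OF p_pos g])
    \<comment> \<open>The constant of the predicate may be negative, in which case
      \<open>ennreal B\<close> is 0; the absolute value allows the return to real
      arithmetic.\<close>
    also have "\<dots> \<le> ennreal \<bar>B\<bar> * ennreal (Lp_int M p g powr (1 / p))"
      by (intro mult_right_mono ennreal_leI) auto
    finally have "Lp_int M q (T g) powr (1 / q) \<le> \<bar>B\<bar> * Lp_int M p g powr (1 / p)"
      by (simp flip: ennreal_mult)
    then have "(Lp_int M q (T g) powr (1 / q)) powr q \<le> (\<bar>B\<bar> * Lp_int M p g powr (1 / p)) powr q"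
      using q_pos by (intro powr_mono2) auto
    then show ?thesis using q_pos by (simp add: powr_powr powr_mult)
  qed
  have le: "Lp_int M q (\<lambda>x. T f x - kop (truncate f n) x) \<le>
      \<bar>B\<bar> powr q * Lp_int M p (\<lambda>x. f x - truncate f n x) powr (q / p)" for n
  proof -
    let ?g = "truncate f n"
    have g: "?g \<in> Lp_space M 1 \<inter> Lp_space M p" by (rule truncate_mem[OF f])
    have "AE x in M. T (\<lambda>t. 1 * f t + (- 1) * ?g t) x = 1 * T f x + (- 1) * T ?g x"
      using T f g unfolding is_extension_def by blast
    moreover have "AE x in M. T ?g x = kop ?g x"
      using T g unfolding is_extension_def by blast
    ultimately have "AE x in M. T (\<lambda>t. f t - ?g t) x = T f x - kop ?g x"
      by eventually_elim simp
    moreover have mem: "(\<lambda>t. f t - ?g t) \<in> Lp_space M p"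
      using g by (intro Lp_diff(1)[OF p_pos f]) auto
    moreover have [measurable]: "T (\<lambda>t. f t - ?g t) \<in> borel_measurable M" "T f \<in> borel_measurable M"
      "kop ?g \<in> borel_measurable M"
      using Tq[OF mem] Tq[OF f] kop_Lp(1)[OF g] by (auto simp: Lp_space_def)
    ultimately have "Lp_int M q (\<lambda>x. T f x - kop ?g x) = Lp_int M q (T (\<lambda>t. f t - ?g t))"
      unfolding Lp_int_def by (intro integral_cong_AE) auto
    with B'[OF mem] show ?thesis by simp
  qed
  have "(\<lambda>n. \<bar>B\<bar> powr q * Lp_int M p (\<lambda>x. f x - truncate f n x) powr (q / p)) \<longlonglongrightarrow> \<bar>B\<bar> powr q * 0 powr (q / p)"
    using p_pos q_pos by (intro tendsto_mult tendsto_const tendsto_powr' tendsto_truncate[OF p_pos f]) auto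
  then have "(\<lambda>n. \<bar>B\<bar> powr q * Lp_int M p (\<lambda>x. f x - truncate f n x) powr (q / p)) \<longlonglongrightarrow> 0" by simp
  from tendsto_sandwich[OF _ _ tendsto_const this] le show ?thesis by simp
qed

text \<open>The sharp bound holds for every exponent \<open>p'\<close> such that \<open>f\<close> also lies in \<open>L\<^bsup>p'\<^esup>\<close>, because the
  truncations of \<open>f\<close> serve all exponents simultaneously.\<close>

theorem extension_hausdorff_young:
  assumes T: "is_extension T" and f: "f \<in> Lp_space M p"
    and p': "1 < p'" "p' \<le> 2" "q' = p' / (p' - 1)" and f': "f \<in> Lp_space M p'"
  shows "T f \<in> Lp_space M q'"
    and "Lp_norm M q' (T f) \<le> ennreal (C powr (2 / p' - 1)) * Lp_norm M p' f"
proof -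
  interpret E: L2_contractive_kernel_exponents M K C p' q' by unfold_locales (use p' in auto)
  have TfLp: "T f \<in> Lp_space M q" using T f unfolding is_extension_def by blast
  note [measurable] = Lp_space_measurable[OF TfLp] Lp_space_measurable[OF kop_Lp(1)[OF truncate_mem[OF f]]]
  define u where "u n x = norm (T f x - kop (truncate f n) x) powr q" for n x
  \<comment> \<open>Convergence in L^q gives an a.e. convergent subsequence, a fact free of
    exponents, so Fatou can then be applied in the space with exponent q'.\<close>
  have "\<exists>r. strict_mono r \<and> (AE x in M. (\<lambda>n. u (r n) x) \<longlonglongrightarrow> 0)"
  proof (rule tendsto_L1_AE_subseq)
    show "integrable M (u n)" for n
      using Lp_diff(1)[OF q_pos TfLp kop_Lp(1)[OF truncate_mem[OF f]]] unfolding u_def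
      by (simp add: Lp_space_iff[OF q_pos])
    show "(\<lambda>n. \<integral>x. norm (u n x) \<partial>M) \<longlonglongrightarrow> 0"
      using extension_truncate[OF T f] by (simp add: u_def Lp_int_def)
  qed
  then obtain r where r: "AE x in M. (\<lambda>n. u (r n) x) \<longlonglongrightarrow> 0" by blast
  define b where "b = E.HY_const * Lp_int M p' f powr (q' / p')"
  have "(\<integral>\<^sup>+x. ennreal (norm (T f x) powr q') \<partial>M) \<le> ennreal b"
  proof (rule nn_integral_le_limit[OF _ _ _ tendsto_const])
    let ?u = "\<lambda>n x. ennreal (norm (kop (truncate f (r n)) x) powr q')"
    show "?u n \<in> borel_measurable M" for n by measurable
    show "AE x in M. (\<lambda>n. ?u n x) \<longlonglongrightarrow> ennreal (norm (T f x) powr q')"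
      using r
    proof eventually_elim
      case (elim x)
      then have "(\<lambda>n. u (r n) x powr (1 / q)) \<longlonglongrightarrow> 0 powr (1 / q)"
        using q_pos by (intro tendsto_powr' tendsto_const) (auto simp: u_def)
      then have "(\<lambda>n. norm (T f x - kop (truncate f (r n)) x)) \<longlonglongrightarrow> 0"
        using q_pos by (simp add: u_def powr_powr)
      then have "(\<lambda>n. T f x - (T f x - kop (truncate f (r n)) x)) \<longlonglongrightarrow> T f x - 0"
        by (intro tendsto_diff tendsto_const) (simp add: tendsto_norm_zero_iff)
      then show ?case
        using E.q_pos by (intro tendsto_ennrealI tendsto_powr' tendsto_norm tendsto_const) auto
    qed
    fix n
    note t = E.truncate_mem[OF f', of "r n"]
    have "Lp_int M q' (kop (truncate f (r n))) \<le> E.HY_const * Lp_int M p' (truncate f (r n)) powr (q' / p')"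
      by (rule E.kop_Lp(2)[OF t])
    also have "\<dots> \<le> b"
      unfolding b_def using E.p_pos E.q_pos
      by (intro mult_left_mono powr_mono2 truncate_Lp(2)[OF E.p_pos f']) auto
    finally show "(\<integral>\<^sup>+x. ?u n x \<partial>M) \<le> ennreal b"
      unfolding nn_integral_Lp_int[OF E.q_pos E.kop_Lp(1)[OF t]] by (rule ennreal_leI)
  qed
  note * = Lp_spaceI_bound[OF E.q_pos _ _ this]
  show Tq': "T f \<in> Lp_space M q'" by (rule *(1)) (auto simp: b_def)
  have "Lp_int M q' (T f) \<le> b" by (rule *(2)) (auto simp: b_def)
  then have "Lp_int M q' (T f) powr (1 / q') \<le> b powr (1 / q')"
    using E.q_pos by (intro powr_mono2) auto
  also have "\<dots> = C powr (2 / p' - 1) * Lp_int M p' f powr (1 / p')"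
    using E.q_pos E.p_pos by (simp add: b_def powr_mult powr_powr)
  finally show "Lp_norm M q' (T f) \<le> ennreal (C powr (2 / p' - 1)) * Lp_norm M p' f"
    using E.p_pos E.q_pos by (simp add: Lp_norm_eq f' Tq' ennreal_leI flip: ennreal_mult)
qed

end

section \<open>Bessel functions and the Dunkl kernel\<close>

text \<open>The coefficients of j_k as a power series in u^2, with Gamma(k+1)/Gamma(n+k+1) written
  as the reciprocal of a Pochhammer symbol.\<close>

definition bessel_coeff :: "real \<Rightarrow> nat \<Rightarrow> real" where
  "bessel_coeff k n = (-1) ^ n / (4 ^ n * fact n * pochhammer (k + 1) n)"

text \<open>Every factor k + 1 + i is at least 1/2; this gives the Bessel series an exponential
  majorant.\<close>

lemma pochhammer_ge_half_power:
  assumes "k \<ge> - 1 / 2"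
  shows "pochhammer (k + 1) n \<ge> (1 / 2 :: real) ^ n"
proof (induction n)
  case (Suc n)
  have "(1 / 2 :: real) ^ n * (1 / 2) \<le> pochhammer (k + 1) n * (k + 1 + real n)"
    by (rule mult_mono[OF Suc]) (use assms in \<open>auto intro: pochhammer_nonneg\<close>)
  then show ?case by (simp add: pochhammer_Suc)
qed simp

lemma pochhammer_pos_half: "k \<ge> - 1 / 2 \<Longrightarrow> pochhammer (k + 1 :: real) n > 0"
  by (rule pochhammer_pos) simp

lemma abs_bessel_coeff_le:
  assumes "k \<ge> - 1 / 2"
  shows "\<bar>bessel_coeff k n\<bar> \<le> (1 / 2) ^ n / fact n"
proof -
  have p: "pochhammer (k + 1) n > 0" by (rule pochhammer_pos_half[OF assms])
  have "\<bar>bessel_coeff k n\<bar> = 1 / (4 ^ n * fact n * pochhammer (k + 1) n)"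
    using p by (simp add: bessel_coeff_def abs_mult)
  also have "\<dots> \<le> 1 / (4 ^ n * fact n * (1 / 2) ^ n)"
    using pochhammer_ge_half_power[OF assms, of n] p
    by (intro divide_left_mono mult_left_mono mult_pos_pos) auto
  also have "\<dots> = (1 / 2) ^ n / fact n"
    by (simp add: field_simps flip: power_mult_distrib)
  finally show ?thesis .
qed

lemma summable_norm_bessel_coeff:
  assumes "k \<ge> - 1 / 2"
  shows "summable (\<lambda>n. norm (bessel_coeff k n * w ^ n))"
proof (rule summable_comparison_test')
  show "summable (\<lambda>n. inverse (fact n) * (\<bar>w\<bar> / 2) ^ n)" by (rule summable_exp)
  fix n
  have "norm (norm (bessel_coeff k n * w ^ n)) = \<bar>bessel_coeff k n\<bar> * \<bar>w\<bar> ^ n"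
    by (simp add: abs_mult power_abs)
  also have "\<dots> \<le> (1 / 2) ^ n / fact n * \<bar>w\<bar> ^ n"
    by (rule mult_right_mono[OF abs_bessel_coeff_le[OF assms]]) simp
  also have "\<dots> = inverse (fact n) * (\<bar>w\<bar> / 2) ^ n"
    by (simp add: field_simps)
  finally show "norm (norm (bessel_coeff k n * w ^ n)) \<le> inverse (fact n) * (\<bar>w\<bar> / 2) ^ n" .
qed

lemma summable_bessel_coeff: "k \<ge> - 1 / 2 \<Longrightarrow> summable (\<lambda>n. bessel_coeff k n * w ^ n)"
  by (rule summable_norm_cancel[OF summable_norm_bessel_coeff])

lemma bessel_j_eq:
  assumes "k \<ge> - 1 / 2"
  shows "bessel_j k u = (\<Sum>n. bessel_coeff k n * (u\<^sup>2) ^ n)"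
proof -
  have G: "Gamma (k + 1) > 0" using assms by (intro Gamma_real_pos) auto
  have *: "bessel_coeff k n * (u\<^sup>2) ^ n =
      Gamma (k + 1) * ((-1) ^ n * (u / 2) ^ (2 * n) / (fact n * Gamma (real n + k + 1)))" for n
  proof -
    have "k + 1 \<notin> \<int>\<^sub>\<le>\<^sub>0" using assms by (auto elim!: nonpos_Ints_cases)
    then have "Gamma (real n + k + 1) = Gamma (k + 1) * pochhammer (k + 1) n"
      using G by (simp add: pochhammer_Gamma add_ac)
    moreover have "(u / 2) ^ (2 * n) = (u\<^sup>2) ^ n / 4 ^ n"
      by (simp add: power_mult power_divide)
    ultimately show ?thesis using G by (simp add: bessel_coeff_def)
  qed
  have "summable (\<lambda>n. (-1) ^ n * (u / 2) ^ (2 * n) / (fact n * Gamma (real n + k + 1)))"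
    using summable_mult[OF summable_bessel_coeff[OF assms, of "u\<^sup>2"], of "1 / Gamma (k + 1)"] G
    unfolding * by simp
  then show ?thesis unfolding bessel_j_def * by (rule suminf_mult[symmetric])
qed

lemma bessel_j_0 [simp]: "k \<ge> - 1 / 2 \<Longrightarrow> bessel_j k 0 = 1"
  using powser_zero[of "bessel_coeff k"] by (simp add: bessel_j_eq bessel_coeff_def)

lemma bessel_j_minus [simp]: "bessel_j k (- u) = bessel_j k u"
  by (simp add: bessel_j_def)

text \<open>As a series in w = u^2, shifting the index gives the derivative -1/(4(k+1)) times the
  series for k + 1; the chain rule contributes 2u.\<close>

lemma has_real_derivative_bessel_j:
  assumes "k \<ge> - 1 / 2"
  shows "(bessel_j k has_real_derivative - u / (2 * (k + 1)) * bessel_j (k + 1) u) (at u)"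
proof -
  define \<phi> where "\<phi> = (\<lambda>k w. \<Sum>n. bessel_coeff k n * w ^ n)"
  have d: "diffs (bessel_coeff k) n = - 1 / (4 * (k + 1)) * bessel_coeff (k + 1) n" for n
  proof -
    have "k + 1 > 0" using assms by simp
    moreover have "pochhammer (k + 1 + 1) n > 0" using assms by (intro pochhammer_pos_half) simp
    moreover define s where "s = real (Suc n)"
    moreover have "s > 0" "fact (Suc n) = s * fact n" by (simp_all add: s_def)
    ultimately show ?thesis
      by (simp add: diffs_def bessel_coeff_def pochhammer_rec divide_simps del: of_nat_Suc fact_Suc)
  qed
  have "(\<phi> k has_real_derivative (\<Sum>n. diffs (bessel_coeff k) n * (u\<^sup>2) ^ n)) (at (u\<^sup>2))"
    unfolding \<phi>_def
    by (rule termdiffs_strong_converges_everywhere) (rule summable_bessel_coeff[OF assms])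
  also have "(\<Sum>n. diffs (bessel_coeff k) n * (u\<^sup>2) ^ n) = - 1 / (4 * (k + 1)) * \<phi> (k + 1) (u\<^sup>2)"
    unfolding d \<phi>_def mult.assoc using assms
    by (intro suminf_mult summable_bessel_coeff) simp
  finally have "(\<phi> k has_real_derivative - 1 / (4 * (k + 1)) * \<phi> (k + 1) (u\<^sup>2)) (at (u\<^sup>2))" .
  moreover have "((\<lambda>u. u\<^sup>2) has_real_derivative 2 * u) (at u)"
    using DERIV_pow[of 2 u] by simp
  ultimately have "((\<lambda>u. \<phi> k (u\<^sup>2)) has_real_derivative
      - 1 / (4 * (k + 1)) * \<phi> (k + 1) (u\<^sup>2) * (2 * u)) (at u)"
    by (rule DERIV_chain2[where f = "\<phi> k" and g = "\<lambda>u. u\<^sup>2"])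
  moreover have "bessel_j k = (\<lambda>u. \<phi> k (u\<^sup>2))"
    using assms by (simp add: fun_eq_iff bessel_j_eq \<phi>_def)
  moreover have "bessel_j (k + 1) u = \<phi> (k + 1) (u\<^sup>2)"
    using assms by (simp add: bessel_j_eq \<phi>_def)
  moreover have "- 1 / (4 * (k + 1)) * x * (2 * u) = - u / (2 * (k + 1)) * x" for x
    using assms by (simp add: field_simps)
  ultimately show ?thesis by simp
qed

text \<open>Bessel's equation with both derivatives expressed through j_(k+1) and j_(k+2). It is
  checked on coefficients of powers of u^2.\<close>

lemma bessel_j_recurrence:
  assumes "k \<ge> - 1 / 2"
  shows "bessel_j k u = bessel_j (k + 1) u - u\<^sup>2 / (4 * (k + 1) * (k + 2)) * bessel_j (k + 2) u"
proof -
  let ?c = "1 / (4 * (k + 1) * (k + 2))"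
  let ?w = "u\<^sup>2"
  have s1: "(\<lambda>n. bessel_coeff (k + 1) n * ?w ^ n) sums bessel_j (k + 1) u"
    using assms by (simp add: bessel_j_eq summable_sums summable_bessel_coeff)
  have s2: "(\<lambda>n. bessel_coeff (k + 2) n * ?w ^ n) sums bessel_j (k + 2) u"
    using assms by (simp add: bessel_j_eq summable_sums summable_bessel_coeff)
  define b where "b n = (case n of 0 \<Rightarrow> 0 | Suc m \<Rightarrow> ?c * ?w * (bessel_coeff (k + 2) m * ?w ^ m))" for n
  have "(\<lambda>n. b (Suc n)) sums (?c * ?w * bessel_j (k + 2) u)"
    unfolding b_def nat.case by (rule sums_mult[OF s2])
  then have "b sums (?c * ?w * bessel_j (k + 2) u)"
    by (subst (asm) sums_Suc_iff) (simp add: b_def)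
  from sums_diff[OF s1 this]
  have "(\<lambda>n. bessel_coeff (k + 1) n * ?w ^ n - b n) sums
    (bessel_j (k + 1) u - ?c * ?w * bessel_j (k + 2) u)" .
  moreover have "bessel_coeff (k + 1) n * ?w ^ n - b n = bessel_coeff k n * ?w ^ n" for n
  proof (cases n)
    case 0
    then show ?thesis by (simp add: b_def bessel_coeff_def)
  next
    case (Suc m)
    have pos: "k + 1 > 0" "k + 2 > 0" using assms by auto
    define P where "P = pochhammer (k + 3) m"
    have P: "P > 0" unfolding P_def using assms by (intro pochhammer_pos) simp
    have 1: "pochhammer (k + 1) (Suc m) * (k + 2 + real m) = (k + 1) * (k + 2) * P"
    proof -
      have "pochhammer (k + 2) (Suc m) = (k + 2) * P"
        unfolding P_def by (simp add: pochhammer_rec add_ac)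
      then have "pochhammer (k + 2) m * (k + 2 + real m) = (k + 2) * P"
        by (simp add: pochhammer_Suc)
      moreover have "pochhammer (k + 1) (Suc m) = (k + 1) * pochhammer (k + 2) m"
        using pochhammer_rec[of "k + 1" m] by (simp add: add.assoc)
      ultimately show ?thesis by (simp only: mult.assoc)
    qed
    have 2: "pochhammer (k + 1 + 1) (Suc m) = (k + 2) * P"
      unfolding P_def by (simp add: pochhammer_rec add_ac)
    have m: "k + 2 + real m > 0" using assms by simp
    have 3: "pochhammer (k + 1) (Suc m) = (k + 1) * (k + 2) * P / (k + 2 + real m)"
      using 1 m by (simp add: field_simps)
    have 4: "pochhammer (k + 2 + 1) m = P" by (simp add: P_def add_ac)
    have "bessel_coeff (k + 1) (Suc m) - ?c * bessel_coeff (k + 2) m = bessel_coeff k (Suc m)"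
      unfolding bessel_coeff_def 2 3 4 using P m pos
      by (simp add: divide_simps) (simp add: algebra_simps)
    then show ?thesis unfolding Suc b_def by (simp add: algebra_simps)
  qed
  ultimately have "(\<lambda>n. bessel_coeff k n * ?w ^ n) sums
    (bessel_j (k + 1) u - ?c * ?w * bessel_j (k + 2) u)" by simp
  then show ?thesis using assms by (simp add: bessel_j_eq sums_iff)
qed

text \<open>With \<open>v = j\<^sub>k'\<close>, Bessel's equation \<open>v' + (2 k + 1) v / u + j\<^sub>k = 0\<close> makes the energy
  \<open>j\<^sub>k\<^sup>2 + v\<^sup>2\<close>, which is the squared modulus of the kernel, decrease on the positive axis.\<close>

lemma bessel_energy_le_1:
  assumes k: "k \<ge> - 1 / 2"
  shows "(bessel_j k u)\<^sup>2 + (u / (2 * (k + 1)) * bessel_j (k + 1) u)\<^sup>2 \<le> 1"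
proof -
  define E where "E u = (bessel_j k u)\<^sup>2 + (u / (2 * (k + 1)) * bessel_j (k + 1) u)\<^sup>2" for u
  have k1: "k + 1 > 0" "k + 2 > 0" using k by auto
  \<comment> \<open>This is -2 (2k+1) v^2 / t with v = j_k'. Written through j_(k+1), the quotient
    by t cancels, so the formula also holds at 0; its sign is where k >= -1/2 enters.\<close>
  have D: "(E has_real_derivative - 2 * (2 * k + 1) * t * (bessel_j (k + 1) t)\<^sup>2 / (4 * (k + 1)\<^sup>2)) (at t)" for t
  proof -
    define J0 J1 J2 where J: "J0 = bessel_j k t" "J1 = bessel_j (k + 1) t" "J2 = bessel_j (k + 2) t"
    have d1: "(bessel_j (k + 1) has_real_derivative - t / (2 * (k + 2)) * J2) (at t)"
      using has_real_derivative_bessel_j[of "k + 1" t] k by (simp add: J add_ac)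
    have d0: "(bessel_j k has_real_derivative - t / (2 * (k + 1)) * J1) (at t)"
      using has_real_derivative_bessel_j[OF k, of t] by (simp add: J)
    have dl: "((\<lambda>u. u / (2 * (k + 1))) has_real_derivative 1 / (2 * (k + 1))) (at t)"
      by (rule DERIV_cdivide[OF DERIV_ident])
    have "(E has_real_derivative
        2 * J0 * (- t / (2 * (k + 1)) * J1)
        + 2 * (t / (2 * (k + 1)) * J1) * (1 / (2 * (k + 1)) * J1 + t / (2 * (k + 1)) * (- t / (2 * (k + 2)) * J2))) (at t)"
      unfolding E_def
      by (rule DERIV_cong[OF DERIV_add[OF DERIV_power[OF d0] DERIV_power[OF DERIV_mult[OF dl d1]]]])
        (simp add: J algebra_simps)
    also have "2 * J0 * (- t / (2 * (k + 1)) * J1)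
        + 2 * (t / (2 * (k + 1)) * J1) * (1 / (2 * (k + 1)) * J1 + t / (2 * (k + 1)) * (- t / (2 * (k + 2)) * J2))
      = t * J1 / (k + 1) * (1 / (2 * (k + 1)) * J1 - J0 - t\<^sup>2 / (4 * (k + 1) * (k + 2)) * J2)"
      using k1 by (simp add: divide_simps power2_eq_square) (simp add: algebra_simps)
    also have "\<dots> = t * J1 / (k + 1) * (1 / (2 * (k + 1)) * J1 - J1)"
    proof -
      have "J0 = J1 - t\<^sup>2 / (4 * (k + 1) * (k + 2)) * J2"
        unfolding J by (rule bessel_j_recurrence[OF k])
      then show ?thesis by simp
    qed
    also have "\<dots> = - 2 * (2 * k + 1) * t * J1\<^sup>2 / (4 * (k + 1)\<^sup>2)"
      using k1 by (simp add: divide_simps power2_eq_square) (simp add: algebra_simps)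
    finally show ?thesis unfolding J .
  qed
  have "E 0 = 1" using k by (simp add: E_def)
  moreover have "E \<bar>u\<bar> \<le> E 0"
  proof (rule DERIV_nonpos_imp_nonincreasing[of 0 "\<bar>u\<bar>" E])
    fix t :: real assume "0 \<le> t" "t \<le> \<bar>u\<bar>"
    then have "0 \<le> 2 * (2 * k + 1) * t * (bessel_j (k + 1) t)\<^sup>2 / (4 * (k + 1)\<^sup>2)"
      using k by (intro divide_nonneg_nonneg mult_nonneg_nonneg) auto
    also have "\<dots> = - (- 2 * (2 * k + 1) * t * (bessel_j (k + 1) t)\<^sup>2 / (4 * (k + 1)\<^sup>2))"
      by (simp only: mult_minus_left minus_divide_left minus_minus)
    finally have "- 2 * (2 * k + 1) * t * (bessel_j (k + 1) t)\<^sup>2 / (4 * (k + 1)\<^sup>2) \<le> 0"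
      by (simp only: neg_0_le_iff_le)
    with D[of t] show "\<exists>y. (E has_real_derivative y) (at t) \<and> y \<le> 0" by blast
  qed simp
  moreover have "E \<bar>u\<bar> = E u" by (simp add: E_def abs_if)
  ultimately show ?thesis unfolding E_def by simp
qed

lemma norm_dunkl_kernel_le_1:
  assumes "k \<ge> - 1 / 2"
  shows "norm (dunkl_kernel k l x) \<le> 1"
proof -
  have "dunkl_kernel k l x =
      Complex (bessel_j k (l * x)) (- (l * x / (2 * (k + 1)) * bessel_j (k + 1) (l * x)))"
    by (simp add: dunkl_kernel_def complex_eq_iff Re_divide Im_divide power2_eq_square)
  then show ?thesis
    using bessel_energy_le_1[OF assms, of "l * x"] by (simp add: cmod_def)
qed

lemma dunkl_kernel_commute: "dunkl_kernel k l x = dunkl_kernel k x l"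
  by (simp add: dunkl_kernel_def mult.commute)

lemma cnj_dunkl_kernel: "cnj (dunkl_kernel k l x) = dunkl_kernel k l (- x)"
  by (simp add: dunkl_kernel_def)

lemma continuous_on_bessel_j [continuous_intros]:
  assumes "k \<ge> - 1 / 2" "continuous_on S g"
  shows "continuous_on S (\<lambda>x. bessel_j k (g x))"
proof -
  have "continuous_on UNIV (bessel_j k)"
    using has_real_derivative_bessel_j[OF assms(1)]
    by (intro continuous_at_imp_continuous_on ballI DERIV_isCont)
  from continuous_on_compose2[OF this assms(2)] show ?thesis by simp
qed

lemma continuous_on_dunkl_kernel [continuous_intros]:
  assumes "k \<ge> - 1 / 2" "continuous_on S f" "continuous_on S g"
  shows "continuous_on S (\<lambda>x. dunkl_kernel k (f x) (g x))"
proof -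
  have "complex_of_real (2 * (k + 1)) \<noteq> 0"
    using assms(1) unfolding of_real_eq_0_iff by simp
  then show ?thesis
    unfolding dunkl_kernel_def using assms by (intro continuous_intros) auto
qed

section \<open>Gaussian integrals and the Dunkl transform\<close>

text \<open>The substitution t = s x^2 in Euler's integral for Gamma, done on compact intervals and
  followed by monotone convergence on both sides.\<close>

lemma nn_integral_gauss_moment_half:
  fixes a s :: real
  assumes a: "a > 0" and s: "s > 0"
  shows "(\<integral>\<^sup>+x. ennreal (2 * s powr a * (x powr (2 * a - 1) * exp (- s * x\<^sup>2))) * indicator {0..} x \<partial>lborel) =
    ennreal (Gamma a)"
proof -
  define f where "f t = t powr (a - 1) / exp t" for t :: real
  define h where "h x = 2 * s powr a * (x powr (2 * a - 1) * exp (- s * x\<^sup>2))" for x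
  have [measurable]: "f \<in> borel_measurable borel" "h \<in> borel_measurable borel"
    unfolding f_def h_def by measurable
  have eq: "(\<integral>\<^sup>+x. ennreal (f x) * indicator {0..s * (real n)\<^sup>2} x \<partial>lborel) =
      (\<integral>\<^sup>+x. ennreal (h x) * indicator {0..real n} x \<partial>lborel)" for n
  proof -
    have "(\<integral>\<^sup>+x. ennreal (f x) * indicator {0..s * (real n)\<^sup>2} x \<partial>lborel) =
        (\<integral>\<^sup>+x. f x * indicator {s * 0\<^sup>2..s * (real n)\<^sup>2} x \<partial>lborel)"
      by (intro nn_integral_cong) (auto simp: indicator_def)
    also have "\<dots> = (\<integral>\<^sup>+x. f (s * x\<^sup>2) * (2 * s * x) * indicator {0..real n} x \<partial>lborel)"
      by (rule nn_integral_substitution)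
        (use s in \<open>auto intro!: derivative_eq_intros continuous_intros simp: set_borel_measurable_def\<close>)
    also have "\<dots> = (\<integral>\<^sup>+x. ennreal (h x) * indicator {0..real n} x \<partial>lborel)"
    proof (intro nn_integral_cong)
      fix x :: real
      have "f (s * x\<^sup>2) * (2 * s * x) = h x" if "x \<ge> 0"
      proof (cases "x = 0")
        case False
        then have "x > 0" using that by simp
        then have 1: "(s * x\<^sup>2) powr (a - 1) = s powr (a - 1) * x powr (2 * (a - 1))"
          using s by (simp add: powr_mult powr_powr flip: powr_numeral)
        have 2: "s powr (a - 1) * s = s powr a" using s by (simp add: powr_diff)
        have 3: "x powr (2 * (a - 1)) * x = x powr (2 * a - 1)"
        proof -
          have "x powr (2 * (a - 1)) * x = x powr (2 * (a - 1)) * x powr 1" using \<open>x > 0\<close> by simp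
          also have "\<dots> = x powr (2 * (a - 1) + 1)" by (rule powr_add[symmetric])
          finally show ?thesis by (simp add: algebra_simps)
        qed
        have "(s * x\<^sup>2) powr (a - 1) * (2 * s * x) =
            2 * (s powr (a - 1) * s) * (x powr (2 * (a - 1)) * x)"
          unfolding 1 by (simp only: mult_ac)
        then have "(s * x\<^sup>2) powr (a - 1) * (2 * s * x) = 2 * s powr a * x powr (2 * a - 1)"
          unfolding 2 3 .
        then show ?thesis unfolding f_def h_def by (simp add: exp_minus divide_inverse mult_ac)
      qed (simp add: f_def h_def)
      then show "ennreal (f (s * x\<^sup>2) * (2 * s * x) * indicator {0..real n} x) = ennreal (h x) * indicator {0..real n} x"
        by (auto simp: indicator_def)
    qed
    finally show ?thesis .
  qed
  have inc: "(\<lambda>n. \<integral>\<^sup>+x. ennreal (g x) * indicator {0..c n} x \<partial>lborel) \<longlonglongrightarrow>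
      (\<integral>\<^sup>+x. ennreal (g x) * indicator {0..} x \<partial>lborel)"
    if [measurable]: "g \<in> borel_measurable borel" and c: "incseq c" "filterlim c at_top sequentially"
    for g c :: "_ \<Rightarrow> real"
  proof (rule nn_integral_LIMSEQ)
    show "incseq (\<lambda>n x. ennreal (g x) * indicator {0..c n} x)"
      using c(1) by (auto simp: incseq_def le_fun_def indicator_def intro: order_trans)
    show "(\<lambda>n. ennreal (g x) * indicator {0..c n} x) \<longlonglongrightarrow> ennreal (g x) * indicator {0..} x" for x
    proof (rule tendsto_eventually)
      have "eventually (\<lambda>n. c n \<ge> x) sequentially" using c(2) by (simp add: filterlim_at_top)
      then show "eventually (\<lambda>n. ennreal (g x) * indicator {0..c n} x = ennreal (g x) * indicator {0..} x) sequentially"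
        by eventually_elim (auto simp: indicator_def)
    qed
  qed measurable
  have "incseq (\<lambda>n. s * (real n)\<^sup>2)"
    using s by (auto simp: incseq_def intro!: mult_left_mono power_mono)
  moreover have "filterlim (\<lambda>n. s * (real n)\<^sup>2) at_top sequentially"
    by (rule filterlim_tendsto_pos_mult_at_top[OF tendsto_const s])
      (intro filterlim_pow_at_top filterlim_real_sequentially, simp)
  ultimately have "(\<lambda>n. \<integral>\<^sup>+x. ennreal (f x) * indicator {0..s * (real n)\<^sup>2} x \<partial>lborel) \<longlonglongrightarrow>
      (\<integral>\<^sup>+x. ennreal (f x) * indicator {0..} x \<partial>lborel)"
    by (intro inc) measurable
  moreover have "(\<lambda>n. \<integral>\<^sup>+x. ennreal (h x) * indicator {0..real n} x \<partial>lborel) \<longlonglongrightarrow>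
      (\<integral>\<^sup>+x. ennreal (h x) * indicator {0..} x \<partial>lborel)"
    by (intro inc filterlim_real_sequentially) (auto simp: incseq_def)
  ultimately have "(\<integral>\<^sup>+x. ennreal (h x) * indicator {0..} x \<partial>lborel) = (\<integral>\<^sup>+x. ennreal (f x) * indicator {0..} x \<partial>lborel)"
    unfolding eq by (rule LIMSEQ_unique[rotated])
  also have "\<dots> = ennreal (Gamma a)"
    unfolding f_def by (rule nn_integral_has_integral_lebesgue'[OF _ Gamma_integral_real[OF a]]) simp
  finally show ?thesis unfolding h_def .
qed

lemma nn_integral_gauss_moment:
  fixes a s :: real
  assumes a: "a > 0" and s: "s > 0"
  shows "(\<integral>\<^sup>+x. ennreal (\<bar>x\<bar> powr (2 * a - 1) * exp (- s * x\<^sup>2)) \<partial>lborel) = ennreal (Gamma a / s powr a)"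
proof -
  define h where "h x = \<bar>x\<bar> powr (2 * a - 1) * exp (- s * x\<^sup>2)" for x
  have [measurable]: "h \<in> borel_measurable borel" unfolding h_def by measurable
  have half: "(\<integral>\<^sup>+x. ennreal (h x) * indicator {0..} x \<partial>lborel) = ennreal (Gamma a / (2 * s powr a))"
  proof -
    have "(\<integral>\<^sup>+x. ennreal (h x) * indicator {0..} x \<partial>lborel) =
        (\<integral>\<^sup>+x. ennreal (1 / (2 * s powr a)) *
          (ennreal (2 * s powr a * (x powr (2 * a - 1) * exp (- s * x\<^sup>2))) * indicator {0..} x) \<partial>lborel)"
      using s by (intro nn_integral_cong) (auto simp: h_def indicator_def simp flip: ennreal_mult)
    also have "\<dots> = ennreal (1 / (2 * s powr a)) * ennreal (Gamma a)"
      using nn_integral_gauss_moment_half[OF assms] by (subst nn_integral_cmult) auto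
    also have "\<dots> = ennreal (Gamma a / (2 * s powr a))"
      using Gamma_real_pos[OF a] s by (simp flip: ennreal_mult)
    finally show ?thesis .
  qed
  have "(\<integral>\<^sup>+x. ennreal (h x) \<partial>lborel) =
      (\<integral>\<^sup>+x. ennreal (h x) * indicator {0..} x + ennreal (h x) * indicator {..0} x \<partial>lborel)"
    using AE_lborel_singleton[of 0]
    by (intro nn_integral_cong_AE) (auto elim!: eventually_mono simp: indicator_def)
  also have "\<dots> = (\<integral>\<^sup>+x. ennreal (h x) * indicator {0..} x \<partial>lborel) + (\<integral>\<^sup>+x. ennreal (h x) * indicator {..0} x \<partial>lborel)"
    by (rule nn_integral_add) measurable
  also have "(\<integral>\<^sup>+x. ennreal (h x) * indicator {..0} x \<partial>lborel) = (\<integral>\<^sup>+x. ennreal (h x) * indicator {0..} x \<partial>lborel)"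
    by (subst nn_integral_real_affine[where c = "-1" and t = 0])
      (auto simp: h_def indicator_def intro!: nn_integral_cong)
  finally have "(\<integral>\<^sup>+x. ennreal (h x) \<partial>lborel) =
      ennreal (Gamma a / (2 * s powr a)) + ennreal (Gamma a / (2 * s powr a))"
    unfolding half .
  also have "\<dots> = ennreal (Gamma a / s powr a)"
    using Gamma_real_pos[OF a] s by (simp flip: ennreal_plus)
  finally show ?thesis unfolding h_def .
qed

section \<open>The weighted measure: dilations, reflection and Gaussian moments\<close>

definition dunkl_weight :: "real \<Rightarrow> real \<Rightarrow> real" where
  "dunkl_weight k x = \<bar>x\<bar> powr (2 * k + 1) / (2 powr (k + 1) * Gamma (k + 1))"

lemma dunkl_measure_eq: "dunkl_measure k = density lborel (\<lambda>x. ennreal (dunkl_weight k x))"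
  by (simp add: dunkl_measure_def dunkl_weight_def)

lemma dunkl_weight_measurable [measurable]: "dunkl_weight k \<in> borel_measurable borel"
  unfolding dunkl_weight_def by measurable

lemma Gamma_dunkl_pos: "k \<ge> - 1 / 2 \<Longrightarrow> Gamma (k + 1 :: real) > 0"
  by (rule Gamma_real_pos) simp

lemma dunkl_weight_nonneg: "k \<ge> - 1 / 2 \<Longrightarrow> dunkl_weight k x \<ge> 0"
  using Gamma_dunkl_pos[of k] by (simp add: dunkl_weight_def)

text \<open>This turns the odd part of the kernel for k, paired with an odd function, into a Bessel
  integral for k + 1.\<close>

lemma dunkl_weight_Suc:
  assumes "k \<ge> - 1 / 2"
  shows "dunkl_weight (k + 1) x = dunkl_weight k x * (x\<^sup>2 / (2 * (k + 1)))"
proof -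
  have k: "k + 1 > 0" using assms by simp
  have "Gamma (k + 1 + 1) = (k + 1) * Gamma (k + 1)"
    using k by (intro Gamma_plus1) (auto elim!: nonpos_Ints_cases)
  moreover have "(2::real) powr (k + 1 + 1) = 2 * 2 powr (k + 1)"
    by (simp add: powr_add)
  moreover have "\<bar>x\<bar> powr (2 * (k + 1) + 1) = \<bar>x\<bar> powr (2 * k + 1) * x\<^sup>2"
  proof (cases "x = 0")
    case False
    have "\<bar>x\<bar> powr (2 * (k + 1) + 1) = \<bar>x\<bar> powr (2 * k + 1 + 2)" by (simp add: algebra_simps)
    also have "\<dots> = \<bar>x\<bar> powr (2 * k + 1) * \<bar>x\<bar> powr 2" by (rule powr_add)
    finally show ?thesis using False by simp
  qed simp
  ultimately show ?thesis
    using k Gamma_dunkl_pos[OF assms] by (simp add: dunkl_weight_def)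
qed

lemma sets_dunkl_measure [simp, measurable_cong]: "sets (dunkl_measure k) = sets borel"
  by (simp add: dunkl_measure_def)

lemma space_dunkl_measure [simp]: "space (dunkl_measure k) = UNIV"
  by (simp add: dunkl_measure_def)

lemma borel_measurable_dunkl_measure [simp]: "borel_measurable (dunkl_measure k) = borel_measurable borel"
  by (rule measurable_cong_sets) simp_all

lemma sigma_finite_dunkl_measure: "sigma_finite_measure (dunkl_measure k)"
  unfolding dunkl_measure_eq
  by (subst sigma_finite_measure.sigma_finite_iff_density_finite[OF sigma_finite_lborel]) auto

lemma AE_dunkl_measure_nonzero: "AE x in dunkl_measure k. x \<noteq> 0"
  unfolding dunkl_measure_eq using AE_lborel_singleton[of "0::real"]
  by (subst AE_density) (auto elim!: eventually_mono)

lemma nn_integral_dunkl_measure: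
  assumes "f \<in> borel_measurable borel"
  shows "(\<integral>\<^sup>+x. f x \<partial>dunkl_measure k) = (\<integral>\<^sup>+x. ennreal (dunkl_weight k x) * f x \<partial>lborel)"
  unfolding dunkl_measure_eq using assms by (subst nn_integral_density) auto

lemma integral_dunkl_measure:
  fixes f :: "real \<Rightarrow> 'b :: {banach, second_countable_topology}"
  assumes "k \<ge> - 1 / 2" "f \<in> borel_measurable borel"
  shows "(\<integral>x. f x \<partial>dunkl_measure k) = (\<integral>x. dunkl_weight k x *\<^sub>R f x \<partial>lborel)"
  unfolding dunkl_measure_eq using assms by (subst integral_density) (auto simp: dunkl_weight_nonneg)

text \<open>The measure is homogeneous of degree 2k + 2. The case b = -1 is reflection invariance;
  the general case normalises the L^2 bound of the canonical transform.\<close>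

lemma nn_integral_dunkl_measure_scale:
  assumes [measurable]: "f \<in> borel_measurable borel" and b: "b \<noteq> 0"
  shows "(\<integral>\<^sup>+x. f (x / b) \<partial>dunkl_measure k) = ennreal (\<bar>b\<bar> powr (2 * k + 2)) * (\<integral>\<^sup>+x. f x \<partial>dunkl_measure k)"
proof -
  have "(\<integral>\<^sup>+x. f (x / b) \<partial>dunkl_measure k) = (\<integral>\<^sup>+x. ennreal (dunkl_weight k x) * f (x / b) \<partial>lborel)"
    by (rule nn_integral_dunkl_measure) measurable
  also have "\<dots> = ennreal \<bar>b\<bar> * (\<integral>\<^sup>+x. ennreal (dunkl_weight k (0 + b * x)) * f ((0 + b * x) / b) \<partial>lborel)"
    by (rule nn_integral_real_affine[OF _ b]) measurable
  also have "\<dots> = ennreal \<bar>b\<bar> * (\<integral>\<^sup>+x. ennreal (\<bar>b\<bar> powr (2 * k + 1)) * (ennreal (dunkl_weight k x) * f x) \<partial>lborel)"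
  proof -
    have "dunkl_weight k (b * x) = \<bar>b\<bar> powr (2 * k + 1) * dunkl_weight k x" for x
      by (simp add: dunkl_weight_def abs_mult powr_mult)
    then show ?thesis using b by (simp add: ennreal_mult' mult.assoc)
  qed
  also have "\<dots> = ennreal \<bar>b\<bar> * ennreal (\<bar>b\<bar> powr (2 * k + 1)) * (\<integral>\<^sup>+x. ennreal (dunkl_weight k x) * f x \<partial>lborel)"
    by (subst nn_integral_cmult) (auto simp: mult.assoc)
  also have "ennreal \<bar>b\<bar> * ennreal (\<bar>b\<bar> powr (2 * k + 1)) = ennreal (\<bar>b\<bar> powr (2 * k + 2))"
  proof -
    have "\<bar>b\<bar> powr (2 * k + 2) = \<bar>b\<bar> powr 1 * \<bar>b\<bar> powr (2 * k + 1)"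
      by (subst powr_add[symmetric]) (simp add: add.commute)
    then show ?thesis using b by (simp add: ennreal_mult)
  qed
  finally show ?thesis by (simp add: nn_integral_dunkl_measure)
qed

lemma distr_dunkl_measure_uminus: "distr (dunkl_measure k) borel uminus = dunkl_measure k"
proof (rule measure_eqI)
  fix A :: "real set" assume "A \<in> sets (distr (dunkl_measure k) borel uminus)"
  then have [measurable]: "A \<in> sets borel" by simp
  have "emeasure (distr (dunkl_measure k) borel uminus) A = (\<integral>\<^sup>+x. indicator A (x / -1) \<partial>dunkl_measure k)"
    by (simp add: nn_integral_distr flip: nn_integral_indicator)
  also have "\<dots> = emeasure (dunkl_measure k) A"
    by (subst nn_integral_dunkl_measure_scale) auto
  finally show "emeasure (distr (dunkl_measure k) borel uminus) A = emeasure (dunkl_measure k) A" .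
qed simp

lemma integral_dunkl_measure_reflect:
  fixes f :: "real \<Rightarrow> 'b :: {banach, second_countable_topology}"
  assumes [measurable]: "f \<in> borel_measurable borel"
  shows "(\<integral>x. f (- x) \<partial>dunkl_measure k) = (\<integral>x. f x \<partial>dunkl_measure k)"
  by (subst (2) distr_dunkl_measure_uminus[symmetric]) (simp add: integral_distr)

lemma integrable_dunkl_measure_reflect:
  fixes f :: "real \<Rightarrow> 'b :: {banach, second_countable_topology}"
  assumes "integrable (dunkl_measure k) f"
  shows "integrable (dunkl_measure k) (\<lambda>x. f (- x))"
proof -
  have [measurable]: "f \<in> borel_measurable borel" using borel_measurable_integrable[OF assms] by simp
  show ?thesis
    using assms by (subst (asm) distr_dunkl_measure_uminus[symmetric]) (simp add: integrable_distr_eq)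
qed

lemma integral_dunkl_measure_odd:
  fixes f :: "real \<Rightarrow> complex"
  assumes "f \<in> borel_measurable borel" "\<And>x. f (- x) = - f x"
  shows "(\<integral>x. f x \<partial>dunkl_measure k) = 0"
  using integral_dunkl_measure_reflect[OF assms(1), of k] by (simp add: assms(2))

lemma gauss_moment_dunkl:
  assumes k: "k \<ge> - 1 / 2" and s: "s > 0"
  shows "integrable (dunkl_measure k) (\<lambda>x. x ^ (2 * n) * exp (- s * x\<^sup>2))"
    and "(\<integral>x. x ^ (2 * n) * exp (- s * x\<^sup>2) \<partial>dunkl_measure k) =
      pochhammer (k + 1) n / (s ^ n * (2 * s) powr (k + 1))"
proof -
  let ?m = "pochhammer (k + 1) n / (s ^ n * (2 * s) powr (k + 1))"
  let ?a = "real n + k + 1"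
  have a: "?a > 0" using k by simp
  define c where "c = 2 powr (k + 1) * Gamma (k + 1)"
  have c: "c > 0" using Gamma_dunkl_pos[OF k] by (simp add: c_def)
  have "(\<integral>\<^sup>+x. ennreal (x ^ (2 * n) * exp (- s * x\<^sup>2)) \<partial>dunkl_measure k) =
      (\<integral>\<^sup>+x. ennreal (dunkl_weight k x) * ennreal (x ^ (2 * n) * exp (- s * x\<^sup>2)) \<partial>lborel)"
    by (rule nn_integral_dunkl_measure) measurable
  also have "\<dots> = (\<integral>\<^sup>+x. ennreal (1 / c) * ennreal (\<bar>x\<bar> powr (2 * ?a - 1) * exp (- s * x\<^sup>2)) \<partial>lborel)"
  proof (intro nn_integral_cong_AE, use AE_lborel_singleton[of "0::real"] in eventually_elim)
    case (elim x)
    have "\<bar>x\<bar> powr (2 * ?a - 1) = \<bar>x\<bar> powr (2 * k + 1 + real (2 * n))" by (simp add: algebra_simps)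
    also have "\<dots> = \<bar>x\<bar> powr (2 * k + 1) * \<bar>x\<bar> powr real (2 * n)" by (rule powr_add)
    also have "\<bar>x\<bar> powr real (2 * n) = x ^ (2 * n)"
      using elim by (subst powr_realpow) (auto simp: power_even_abs)
    finally show ?case
      using c by (simp add: dunkl_weight_def c_def flip: ennreal_mult)
  qed
  also have "\<dots> = ennreal (1 / c) * ennreal (Gamma ?a / s powr ?a)"
    by (subst nn_integral_cmult, simp) (simp only: nn_integral_gauss_moment[OF a s])
  also have "\<dots> = ennreal (1 / c * (Gamma ?a / s powr ?a))"
    using c Gamma_real_pos[OF a] by (simp flip: ennreal_mult)
  also have "1 / c * (Gamma ?a / s powr ?a) = ?m"
  proof -
    have "k + 1 \<notin> \<int>\<^sub>\<le>\<^sub>0" using k by (auto elim!: nonpos_Ints_cases)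
    then have "Gamma ?a = Gamma (k + 1) * pochhammer (k + 1) n"
      using Gamma_dunkl_pos[OF k] by (simp add: pochhammer_Gamma add_ac)
    moreover have "s powr ?a = s ^ n * s powr (k + 1)"
      using s by (simp add: powr_add powr_realpow)
    moreover have "(2 * s) powr (k + 1) = 2 powr (k + 1) * s powr (k + 1)"
      using s by (simp add: powr_mult)
    ultimately show ?thesis using Gamma_dunkl_pos[OF k] s by (simp add: c_def)
  qed
  finally have "(\<integral>\<^sup>+x. ennreal (x ^ (2 * n) * exp (- s * x\<^sup>2)) \<partial>dunkl_measure k) = ennreal ?m" .
  moreover have "0 \<le> ?m" using pochhammer_pos_half[OF k, of n] s by simp
  ultimately show "integrable (dunkl_measure k) (\<lambda>x. x ^ (2 * n) * exp (- s * x\<^sup>2))"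
    "(\<integral>x. x ^ (2 * n) * exp (- s * x\<^sup>2) \<partial>dunkl_measure k) = ?m"
    by (subst (asm) nn_integral_eq_integrable; simp)+
qed

lemma norm_mult_le_of_norm_le_1:
  fixes a b :: "'a :: real_normed_div_algebra"
  shows "norm a \<le> 1 \<Longrightarrow> norm (a * b) \<le> norm b"
  by (simp add: norm_mult mult_left_le_one_le)

lemma abs_bessel_j_le_1: "k \<ge> - 1 / 2 \<Longrightarrow> \<bar>bessel_j k u\<bar> \<le> 1"
  using bessel_energy_le_1[of k u] by (simp add: abs_square_le_1[symmetric])
    (smt (verit) zero_le_power2)

lemma bessel_j_measurable:
  assumes "k \<ge> - 1 / 2" "g \<in> borel_measurable M"
  shows "(\<lambda>x. bessel_j k (g x)) \<in> borel_measurable M"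
  using assms(2)
  by (rule measurable_compose[OF _ borel_measurable_continuous_onI])
    (rule continuous_on_bessel_j[OF assms(1) continuous_on_id])

lemma abs_le_one_plus_square: "\<bar>x\<bar> \<le> 1 + x\<^sup>2" for x :: real
  using zero_le_power2[of "\<bar>x\<bar> - 1"] by (simp add: power2_eq_square algebra_simps)

lemma integrable_gauss:
  assumes "k \<ge> - 1 / 2" "s > 0"
  shows "integrable (dunkl_measure k) (\<lambda>x. exp (- s * x\<^sup>2))"
    and "integrable (dunkl_measure k) (\<lambda>x. \<bar>x\<bar> * exp (- s * x\<^sup>2))"
proof -
  show 1: "integrable (dunkl_measure k) (\<lambda>x. exp (- s * x\<^sup>2))"
    using gauss_moment_dunkl(1)[OF assms, of 0] by simp
  have 2: "integrable (dunkl_measure k) (\<lambda>x. exp (- s * x\<^sup>2) + x ^ (2 * 1) * exp (- s * x\<^sup>2))"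
    by (rule Bochner_Integration.integrable_add[OF 1 gauss_moment_dunkl(1)[OF assms]])
  show "integrable (dunkl_measure k) (\<lambda>x. \<bar>x\<bar> * exp (- s * x\<^sup>2))"
  proof (rule Bochner_Integration.integrable_bound[OF 2])
    have "\<bar>x\<bar> * exp (- s * x\<^sup>2) \<le> (1 + x\<^sup>2) * exp (- s * x\<^sup>2)" for x
      by (intro mult_right_mono abs_le_one_plus_square) auto
    then have "\<bar>x\<bar> * exp (- s * x\<^sup>2) \<le> exp (- s * x\<^sup>2) + x ^ (2 * 1) * exp (- s * x\<^sup>2)" for x
      by (simp only: distrib_right mult_1_left mult_1_right)
    from order_trans[OF this abs_ge_self] show "AE x in dunkl_measure k. norm (\<bar>x\<bar> * exp (- s * x\<^sup>2)) \<le>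
        norm (exp (- s * x\<^sup>2) + x ^ (2 * 1) * exp (- s * x\<^sup>2))"
      by (intro AE_I2) (simp only: real_norm_def abs_mult abs_abs abs_exp_cancel)
  qed (simp, measurable)
qed

text \<open>Termwise integration: the Pochhammer symbol in the n-th Gaussian moment cancels the one
  in the Bessel coefficient and leaves an exponential series.\<close>

lemma bessel_gauss_integral:
  assumes k: "k \<ge> - 1 / 2" and s: "s > 0"
  shows "(\<integral>x. bessel_j k (l * x) * exp (- s * x\<^sup>2) \<partial>dunkl_measure k) =
    (2 * s) powr (- (k + 1)) * exp (- l\<^sup>2 / (4 * s))"
proof -
  define f where "f n x = bessel_coeff k n * (l\<^sup>2) ^ n * (x ^ (2 * n) * exp (- s * x\<^sup>2))" for n and x :: real
  define c where "c = (2 * s) powr (- (k + 1))"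
  have f_int: "integrable (dunkl_measure k) (f n)" for n
    unfolding f_def using gauss_moment_dunkl(1)[OF assms, of n] by simp
  have f_eq: "f n x = bessel_coeff k n * ((l * x)\<^sup>2) ^ n * exp (- s * x\<^sup>2)" for n x
    by (simp add: f_def power_mult power_mult_distrib)
  have coeff: "bessel_coeff k n * (l\<^sup>2) ^ n * (pochhammer (k + 1) n / (s ^ n * (2 * s) powr (k + 1))) =
      c * ((- l\<^sup>2 / (4 * s)) ^ n /\<^sub>R fact n)" for n
  proof -
    have E: "(- l\<^sup>2 / (4 * s)) ^ n = (- 1) ^ n * (l\<^sup>2) ^ n / (4 ^ n * s ^ n)"
      by (simp add: power_divide power_mult_distrib power_minus[of "l\<^sup>2 / (4 * s)"])
    have "bessel_coeff k n * (l\<^sup>2) ^ n * (pochhammer (k + 1) n / (s ^ n * (2 * s) powr (k + 1))) =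
        1 / (2 * s) powr (k + 1) * ((- 1) ^ n * (l\<^sup>2) ^ n / (4 ^ n * s ^ n) / fact n)"
      using pochhammer_pos_half[OF k, of n] by (simp add: bessel_coeff_def)
    also have "1 / (2 * s) powr (k + 1) = c" by (simp only: c_def powr_minus_divide)
    finally show ?thesis unfolding E by (simp add: divide_inverse mult_ac)
  qed
  have int: "(\<integral>x. f n x \<partial>dunkl_measure k) = c * ((- l\<^sup>2 / (4 * s)) ^ n /\<^sub>R fact n)" for n
    unfolding f_def coeff[symmetric] using gauss_moment_dunkl[OF assms, of n] by simp
  \<comment> \<open>Absolute values only flip the sign in the exponent of the resulting exponential
    series, so the interchange of sum and integral is justified.\<close>
  have int_norm: "(\<integral>x. norm (f n x) \<partial>dunkl_measure k) = c * ((l\<^sup>2 / (4 * s)) ^ n /\<^sub>R fact n)" for n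
  proof -
    have "norm (f n x) = norm (bessel_coeff k n * (l\<^sup>2) ^ n) * (x ^ (2 * n) * exp (- s * x\<^sup>2))" for x
      by (simp add: f_def abs_mult power_mult)
    then have "(\<integral>x. norm (f n x) \<partial>dunkl_measure k) = norm (bessel_coeff k n * (l\<^sup>2) ^ n) *
        (pochhammer (k + 1) n / (s ^ n * (2 * s) powr (k + 1)))"
      using gauss_moment_dunkl[OF assms, of n] by simp
    also have "\<dots> = norm (c * ((- l\<^sup>2 / (4 * s)) ^ n /\<^sub>R fact n))"
      unfolding coeff[symmetric] using pochhammer_pos_half[OF k, of n] s by (simp add: abs_mult)
    also have "\<dots> = c * ((l\<^sup>2 / (4 * s)) ^ n /\<^sub>R fact n)"
      using s by (simp add: abs_mult power_abs c_def)
    finally show ?thesis .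
  qed
  have "(\<lambda>n. \<integral>x. f n x \<partial>dunkl_measure k) sums (\<integral>x. (\<Sum>n. f n x) \<partial>dunkl_measure k)"
  proof (rule sums_integral[OF f_int])
    show "AE x in dunkl_measure k. summable (\<lambda>n. norm (f n x))"
    proof (intro AE_I2)
      fix x
      have "summable (\<lambda>n. norm (bessel_coeff k n * ((l * x)\<^sup>2) ^ n) * exp (- s * x\<^sup>2))"
        by (intro summable_mult2 summable_norm_bessel_coeff k)
      then show "summable (\<lambda>n. norm (f n x))" by (simp add: f_eq abs_mult)
    qed
    show "summable (\<lambda>n. \<integral>x. norm (f n x) \<partial>dunkl_measure k)"
      unfolding int_norm by (intro summable_mult summable_exp_generic)
  qed
  moreover have "(\<Sum>n. f n x) = bessel_j k (l * x) * exp (- s * x\<^sup>2)" for x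
    unfolding f_eq bessel_j_eq[OF k] by (rule suminf_mult2[symmetric, OF summable_bessel_coeff[OF k]])
  moreover have "(\<lambda>n. \<integral>x. f n x \<partial>dunkl_measure k) sums (c * exp (- l\<^sup>2 / (4 * s)))"
    unfolding int by (intro sums_mult exp_converges)
  ultimately show ?thesis unfolding c_def by (simp add: sums_iff)
qed

section \<open>The Dunkl transform and its values on Gaussians\<close>

definition dunkl :: "real \<Rightarrow> (real \<Rightarrow> complex) \<Rightarrow> real \<Rightarrow> complex" where
  "dunkl k f l = (\<integral>x. f x * dunkl_kernel k l x \<partial>dunkl_measure k)"

lemma dunkl_kernel_eq:
  "dunkl_kernel k l x = of_real (bessel_j k (l * x)) -
     \<i> * of_real (l * x / (2 * (k + 1)) * bessel_j (k + 1) (l * x))"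
  by (simp add: dunkl_kernel_def)

lemma dunkl_kernel_measurable:
  assumes k: "k \<ge> - 1 / 2" and [measurable]: "f \<in> borel_measurable M" "g \<in> borel_measurable M"
  shows "(\<lambda>x. dunkl_kernel k (f x) (g x)) \<in> borel_measurable M"
proof -
  have [measurable]: "(\<lambda>x. bessel_j k (f x * g x)) \<in> borel_measurable M"
    "(\<lambda>x. bessel_j (k + 1) (f x * g x)) \<in> borel_measurable M"
    using k by (auto intro!: bessel_j_measurable)
  show ?thesis unfolding dunkl_kernel_def by measurable
qed

lemma integrable_mult_dunkl_kernel:
  fixes f :: "real \<Rightarrow> complex"
  assumes k: "k \<ge> - 1 / 2" and f: "integrable (dunkl_measure k) f"
  shows "integrable (dunkl_measure k) (\<lambda>x. f x * dunkl_kernel k l x)"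
proof (rule Bochner_Integration.integrable_bound[OF f])
  have [measurable]: "f \<in> borel_measurable borel" using borel_measurable_integrable[OF f] by simp
  have [measurable]: "(\<lambda>x. dunkl_kernel k l x) \<in> borel_measurable borel"
    by (rule dunkl_kernel_measurable[OF k]) auto
  show "(\<lambda>x. f x * dunkl_kernel k l x) \<in> borel_measurable (dunkl_measure k)" by simp
  show "AE x in dunkl_measure k. norm (f x * dunkl_kernel k l x) \<le> norm (f x)"
    using norm_dunkl_kernel_le_1[OF k] by (simp add: norm_mult mult_left_le)
qed

lemma dunkl_lincomb:
  assumes k: "k \<ge> - 1 / 2" and "integrable (dunkl_measure k) f" "integrable (dunkl_measure k) g"
  shows "dunkl k (\<lambda>x. \<alpha> * f x + \<beta> * g x) = (\<lambda>l. \<alpha> * dunkl k f l + \<beta> * dunkl k g l)"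
  using assms(2,3)[THEN integrable_mult_dunkl_kernel[OF k]]
  by (auto simp: dunkl_def distrib_right mult.assoc)

lemma norm_dunkl_le:
  assumes k: "k \<ge> - 1 / 2" and f: "integrable (dunkl_measure k) f"
  shows "norm (dunkl k f l) \<le> (\<integral>x. norm (f x) \<partial>dunkl_measure k)"
proof -
  have "norm (dunkl k f l) \<le> (\<integral>x. norm (f x * dunkl_kernel k l x) \<partial>dunkl_measure k)"
    unfolding dunkl_def by (rule integral_norm_bound)
  also have "\<dots> \<le> (\<integral>x. norm (f x) \<partial>dunkl_measure k)"
    using norm_dunkl_kernel_le_1[OF k] f integrable_mult_dunkl_kernel[OF k f]
    by (intro integral_mono integrable_norm) (auto simp: norm_mult mult_left_le)
  finally show ?thesis .
qed

text \<open>Besides measurability, continuity is what later permits the uniform approximation of the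
  cut-off transform by test functions.\<close>

lemma continuous_on_dunkl:
  assumes k: "k \<ge> - 1 / 2" and f: "integrable (dunkl_measure k) f"
  shows "continuous_on UNIV (dunkl k f)"
proof (rule continuous_at_imp_continuous_on, intro ballI)
  fix l :: real
  have cont: "continuous_on UNIV (\<lambda>l. dunkl_kernel k l x)" for x
    using k by (intro continuous_intros)
  have [measurable]: "(\<lambda>x. f x * dunkl_kernel k l x) \<in> borel_measurable (dunkl_measure k)" for l
    using integrable_mult_dunkl_kernel[OF assms] by (rule borel_measurable_integrable)
  show "isCont (dunkl k f) l"
    unfolding continuous_at_sequentially comp_def
  proof (intro allI impI)
    fix X :: "nat \<Rightarrow> real" assume X: "X \<longlonglongrightarrow> l"
    show "(\<lambda>n. dunkl k f (X n)) \<longlonglongrightarrow> dunkl k f l"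
      unfolding dunkl_def
    proof (rule integral_dominated_convergence)
      show "integrable (dunkl_measure k) (\<lambda>x. norm (f x))" using f by simp
      show "AE x in dunkl_measure k. (\<lambda>n. f x * dunkl_kernel k (X n) x) \<longlonglongrightarrow> f x * dunkl_kernel k l x"
        using cont X
        by (intro AE_I2 tendsto_mult tendsto_const continuous_on_tendsto_compose[OF cont]) auto
      show "AE x in dunkl_measure k. norm (f x * dunkl_kernel k (X n) x) \<le> norm (f x)" for n
        using norm_dunkl_kernel_le_1[OF k] by (simp add: norm_mult mult_left_le)
    qed measurable
  qed
qed

lemma dunkl_gauss:
  assumes k: "k \<ge> - 1 / 2" and s: "s > 0"
  shows "dunkl k (\<lambda>x. of_real (exp (- s * x\<^sup>2))) l =
    of_real ((2 * s) powr (- (k + 1)) * exp (- l\<^sup>2 / (4 * s)))"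
proof -
  let ?\<mu> = "dunkl_measure k"
  let ?o = "\<lambda>x. l * x / (2 * (k + 1)) * bessel_j (k + 1) (l * x)"
  have [measurable]: "(\<lambda>x. bessel_j k (l * x)) \<in> borel_measurable borel"
    "(\<lambda>x. bessel_j (k + 1) (l * x)) \<in> borel_measurable borel"
    using k by (auto intro!: bessel_j_measurable)
  have i1: "integrable ?\<mu> (\<lambda>x. bessel_j k (l * x) * exp (- s * x\<^sup>2))"
    by (rule Bochner_Integration.integrable_bound[OF integrable_gauss(1)[OF assms]])
      (auto simp: abs_mult intro!: AE_I2 mult_left_le_one_le abs_bessel_j_le_1 k)
  have le: "\<bar>?o x\<bar> \<le> 1" for x
    using bessel_energy_le_1[OF k, of "l * x"] by (subst abs_square_le_1[symmetric]) (smt (verit) zero_le_power2)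
  have i2: "integrable ?\<mu> (\<lambda>x. ?o x * exp (- s * x\<^sup>2))"
  proof (rule Bochner_Integration.integrable_bound[OF integrable_gauss(1)[OF assms]])
    show "AE x in ?\<mu>. norm (?o x * exp (- s * x\<^sup>2)) \<le> norm (exp (- s * x\<^sup>2))"
      using le by (intro AE_I2 norm_mult_le_of_norm_le_1) (simp only: real_norm_def)
  qed simp
  have "dunkl k (\<lambda>x. of_real (exp (- s * x\<^sup>2))) l =
      (\<integral>x. of_real (bessel_j k (l * x) * exp (- s * x\<^sup>2)) - \<i> * of_real (?o x * exp (- s * x\<^sup>2)) \<partial>?\<mu>)"
    unfolding dunkl_def dunkl_kernel_eq by (intro Bochner_Integration.integral_cong refl) (simp add: algebra_simps)
  also have "\<dots> = of_real (\<integral>x. bessel_j k (l * x) * exp (- s * x\<^sup>2) \<partial>?\<mu>) -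
      \<i> * (\<integral>x. of_real (?o x * exp (- s * x\<^sup>2)) \<partial>?\<mu>)"
    by (simp only: Bochner_Integration.integral_diff[OF integrable_of_real[OF i1]
          integrable_mult_right[OF integrable_of_real[OF i2]]]
        integral_mult_right_zero integral_complex_of_real)
  also have "(\<integral>x. complex_of_real (?o x * exp (- s * x\<^sup>2)) \<partial>?\<mu>) = 0"
    by (rule integral_dunkl_measure_odd) auto
  finally show ?thesis by (simp only: bessel_gauss_integral[OF assms] mult_zero_right diff_zero)
qed

text \<open>Now the even part of the kernel integrates to 0. In the odd part a factor x^2 appears,
  which changes the measure for k into that for k + 1; hence the exponent -(k+2).\<close>

lemma dunkl_gauss_odd:
  assumes k: "k \<ge> - 1 / 2" and s: "s > 0"
  shows "dunkl k (\<lambda>x. of_real (x * exp (- s * x\<^sup>2))) l =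
    - \<i> * of_real (l * ((2 * s) powr (- (k + 2)) * exp (- l\<^sup>2 / (4 * s))))"
proof -
  let ?\<mu> = "dunkl_measure k"
  let ?o = "\<lambda>x. l * x / (2 * (k + 1)) * bessel_j (k + 1) (l * x)"
  have [measurable]: "(\<lambda>x. bessel_j k (l * x)) \<in> borel_measurable borel"
    "(\<lambda>x. bessel_j (k + 1) (l * x)) \<in> borel_measurable borel"
    using k by (auto intro!: bessel_j_measurable)
  have i1: "integrable ?\<mu> (\<lambda>x. bessel_j k (l * x) * (x * exp (- s * x\<^sup>2)))"
    by (rule Bochner_Integration.integrable_bound[OF integrable_gauss(2)[OF assms]])
      (auto simp: abs_mult intro!: AE_I2 mult_left_le_one_le abs_bessel_j_le_1 k)
  have le: "\<bar>?o x\<bar> \<le> 1" for x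
    using bessel_energy_le_1[OF k, of "l * x"] by (subst abs_square_le_1[symmetric]) (smt (verit) zero_le_power2)
  have i2: "integrable ?\<mu> (\<lambda>x. ?o x * (x * exp (- s * x\<^sup>2)))"
  proof (rule Bochner_Integration.integrable_bound[OF integrable_gauss(2)[OF assms]])
    have "norm (?o x * (x * exp (- s * x\<^sup>2))) \<le> norm (x * exp (- s * x\<^sup>2))" for x
      using le by (intro norm_mult_le_of_norm_le_1) (simp only: real_norm_def)
    then show "AE x in ?\<mu>. norm (?o x * (x * exp (- s * x\<^sup>2))) \<le> norm (\<bar>x\<bar> * exp (- s * x\<^sup>2))"
      by (intro AE_I2) (simp only: abs_mult real_norm_def abs_abs)
  qed simp
  have "dunkl k (\<lambda>x. of_real (x * exp (- s * x\<^sup>2))) l =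
      (\<integral>x. of_real (bessel_j k (l * x) * (x * exp (- s * x\<^sup>2))) - \<i> * of_real (?o x * (x * exp (- s * x\<^sup>2))) \<partial>?\<mu>)"
    unfolding dunkl_def dunkl_kernel_eq by (intro Bochner_Integration.integral_cong refl) (simp add: algebra_simps)
  also have "\<dots> = (\<integral>x. of_real (bessel_j k (l * x) * (x * exp (- s * x\<^sup>2))) \<partial>?\<mu>) -
      \<i> * of_real (\<integral>x. ?o x * (x * exp (- s * x\<^sup>2)) \<partial>?\<mu>)"
    by (simp only: Bochner_Integration.integral_diff[OF integrable_of_real[OF i1]
          integrable_mult_right[OF integrable_of_real[OF i2]]]
        integral_mult_right_zero integral_complex_of_real)
  also have "(\<integral>x. complex_of_real (bessel_j k (l * x) * (x * exp (- s * x\<^sup>2))) \<partial>?\<mu>) = 0"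
    by (rule integral_dunkl_measure_odd) auto
  also have "(\<integral>x. ?o x * (x * exp (- s * x\<^sup>2)) \<partial>?\<mu>) =
      (\<integral>x. dunkl_weight k x *\<^sub>R (?o x * (x * exp (- s * x\<^sup>2))) \<partial>lborel)"
    by (rule integral_dunkl_measure[OF k]) measurable
  also have "\<dots> = (\<integral>x. dunkl_weight (k + 1) x *\<^sub>R (l * (bessel_j (k + 1) (l * x) * exp (- s * x\<^sup>2))) \<partial>lborel)"
    by (intro Bochner_Integration.integral_cong refl)
      (simp add: dunkl_weight_Suc[OF k] power2_eq_square)
  also have "\<dots> = (\<integral>x. l * (bessel_j (k + 1) (l * x) * exp (- s * x\<^sup>2)) \<partial>dunkl_measure (k + 1))"
    by (rule integral_dunkl_measure[symmetric]) (use k in auto)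
  also have "\<dots> = l * ((2 * s) powr (- (k + 2)) * exp (- l\<^sup>2 / (4 * s)))"
    using bessel_gauss_integral[of "k + 1" s l] k s by (simp add: add.commute)
  finally show ?thesis by simp
qed

section \<open>Plancherel\<close>

lemma dunkl_cmult: "dunkl k (\<lambda>x. c * f x) = (\<lambda>l. c * dunkl k f l)"
  by (rule ext) (simp add: dunkl_def mult.assoc)

text \<open>Fubini, with the integrand dominated by |f(x)| |g(l)|, and the symmetry of the kernel in
  its two arguments.\<close>

lemma dunkl_mult_formula:
  assumes k: "k \<ge> - 1 / 2" and f: "integrable (dunkl_measure k) f" and g: "integrable (dunkl_measure k) g"
  shows "(\<integral>l. dunkl k f l * g l \<partial>dunkl_measure k) = (\<integral>x. f x * dunkl k g x \<partial>dunkl_measure k)"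
proof -
  let ?\<mu> = "dunkl_measure k"
  interpret sigma_finite_measure ?\<mu> by (rule sigma_finite_dunkl_measure)
  interpret pair_sigma_finite ?\<mu> ?\<mu> ..
  have [measurable]: "f \<in> borel_measurable ?\<mu>" "g \<in> borel_measurable ?\<mu>"
    using f g by (auto intro: borel_measurable_integrable)
  have m[measurable]: "(\<lambda>(x, l). f x * dunkl_kernel k l x * g l) \<in> borel_measurable (?\<mu> \<Otimes>\<^sub>M ?\<mu>)"
  proof -
    have [measurable]: "(\<lambda>z. dunkl_kernel k (snd z) (fst z)) \<in> borel_measurable (?\<mu> \<Otimes>\<^sub>M ?\<mu>)"
      by (rule dunkl_kernel_measurable[OF k]) measurable
    show ?thesis unfolding split_beta' by measurable
  qed
  have le: "norm (f x * dunkl_kernel k l x * g l) \<le> norm (f x) * norm (g l)" for x l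
    using norm_dunkl_kernel_le_1[OF k, of l x]
    by (auto simp: norm_mult intro!: mult_right_mono mult_right_le_one_le)
  have int1: "integrable ?\<mu> (\<lambda>l. f x * dunkl_kernel k l x * g l)" for x
    using integrable_mult_dunkl_kernel[OF k g, of x]
    by (simp add: mult.assoc mult.commute[of "dunkl_kernel _ _ _"] dunkl_kernel_commute[of k _ x])
  have int: "integrable (?\<mu> \<Otimes>\<^sub>M ?\<mu>) (\<lambda>(x, l). f x * dunkl_kernel k l x * g l)"
  proof (rule Fubini_integrable[OF m])
    show "integrable ?\<mu> (\<lambda>x. \<integral>l. norm (case (x, l) of (x, l) \<Rightarrow> f x * dunkl_kernel k l x * g l) \<partial>?\<mu>)"
    proof (rule Bochner_Integration.integrable_bound)
      show "integrable ?\<mu> (\<lambda>x. norm (f x) * (\<integral>l. norm (g l) \<partial>?\<mu>))" using f by simp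
      show "(\<lambda>x. \<integral>l. norm (case (x, l) of (x, l) \<Rightarrow> f x * dunkl_kernel k l x * g l) \<partial>?\<mu>) \<in> borel_measurable ?\<mu>"
        by measurable
      show "AE x in ?\<mu>. norm (\<integral>l. norm (case (x, l) of (x, l) \<Rightarrow> f x * dunkl_kernel k l x * g l) \<partial>?\<mu>) \<le>
          norm (norm (f x) * (\<integral>l. norm (g l) \<partial>?\<mu>))"
      proof (intro AE_I2)
        fix x
        have "(\<integral>l. norm (f x * dunkl_kernel k l x * g l) \<partial>?\<mu>) \<le> (\<integral>l. norm (f x) * norm (g l) \<partial>?\<mu>)"
          using int1 g by (intro integral_mono le integrable_norm integrable_mult_right) auto
        then show "norm (\<integral>l. norm (case (x, l) of (x, l) \<Rightarrow> f x * dunkl_kernel k l x * g l) \<partial>?\<mu>) \<le>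
            norm (norm (f x) * (\<integral>l. norm (g l) \<partial>?\<mu>))"
          by (simp add: abs_mult)
      qed
    qed
    show "AE x in ?\<mu>. integrable ?\<mu> (\<lambda>l. case (x, l) of (x, l) \<Rightarrow> f x * dunkl_kernel k l x * g l)"
      using int1 by simp
  qed
  have "(\<integral>l. dunkl k f l * g l \<partial>?\<mu>) = (\<integral>l. (\<integral>x. f x * dunkl_kernel k l x * g l \<partial>?\<mu>) \<partial>?\<mu>)"
    by (simp add: dunkl_def)
  also have "\<dots> = (\<integral>x. (\<integral>l. f x * dunkl_kernel k l x * g l \<partial>?\<mu>) \<partial>?\<mu>)"
    by (rule Fubini_integral[OF int])
  also have "\<dots> = (\<integral>x. f x * dunkl k g x \<partial>?\<mu>)"
    by (simp add: dunkl_def mult.assoc mult.commute[of "dunkl_kernel _ _ _"] dunkl_kernel_commute[of k _ x for x])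
  finally show ?thesis .
qed

text \<open>Functions that satisfy the inversion formula. Among them, the products of a polynomial in
  \<open>e\<^bsup>-x\<^sup>2\<^esup>\<close> with \<open>e\<^bsup>-x\<^sup>2\<^esup>\<close> or \<open>x e\<^bsup>-x\<^sup>2\<^esup>\<close> are dense enough for Plancherel.\<close>

definition dunkl_test :: "real \<Rightarrow> (real \<Rightarrow> complex) \<Rightarrow> bool" where
  "dunkl_test k g \<longleftrightarrow> integrable (dunkl_measure k) g \<and> (\<exists>B. \<forall>x. norm (g x) \<le> B) \<and>
     integrable (dunkl_measure k) (dunkl k g) \<and> (\<forall>x. dunkl k (dunkl k g) x = g (- x))"

lemma dunkl_test_lincomb:
  assumes k: "k \<ge> - 1 / 2" and f: "dunkl_test k f" and g: "dunkl_test k g"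
  shows "dunkl_test k (\<lambda>x. \<alpha> * f x + \<beta> * g x)"
proof -
  obtain B B' where B: "\<And>x. norm (f x) \<le> B" "\<And>x. norm (g x) \<le> B'"
    using f g unfolding dunkl_test_def by blast
  have "norm (\<alpha> * f x + \<beta> * g x) \<le> norm \<alpha> * B + norm \<beta> * B'" for x
    by (intro norm_triangle_le add_mono) (auto simp: norm_mult intro!: mult_left_mono B)
  then show ?thesis
    using f g by (auto simp: dunkl_test_def dunkl_lincomb[OF k])
qed

lemma dunkl_test_sum:
  assumes k: "k \<ge> - 1 / 2" and "\<And>i. dunkl_test k (g i)"
  shows "dunkl_test k (\<lambda>x. \<Sum>i\<le>(n::nat). c i * g i x)"
proof (induction n)
  case 0
  show ?case using dunkl_test_lincomb[OF k assms(2) assms(2), of "c 0" 0 0 0] by simp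
next
  case (Suc n)
  show ?case using dunkl_test_lincomb[OF k Suc assms(2), of 1 "c (Suc n)" "Suc n"] by simp
qed

text \<open>The width changes by s -> 1/(4s), an involution, and with t = 1/(4s) the constants
  multiply to 1 because (2s)(2t) = 1.\<close>

lemma dunkl_test_gauss:
  assumes k: "k \<ge> - 1 / 2" and s: "s > 0"
  shows "dunkl_test k (\<lambda>x. of_real (exp (- s * x\<^sup>2)))"
proof -
  let ?t = "1 / (4 * s)"
  let ?c = "complex_of_real ((2 * s) powr (- (k + 1)))"
  have t: "?t > 0" using s by simp
  have eq: "dunkl k (\<lambda>x. of_real (exp (- s * x\<^sup>2))) = (\<lambda>l. ?c * of_real (exp (- ?t * l\<^sup>2)))"
    by (rule ext, simp only: dunkl_gauss[OF k s]) simp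
  have "(2 * s) powr (- (k + 1)) * (2 * ?t) powr (- (k + 1)) = 1"
    using s by (simp flip: powr_mult)
  then have one: "?c * complex_of_real ((2 * ?t) powr (- (k + 1))) = 1"
    by (metis of_real_1 of_real_mult)
  have "dunkl k (dunkl k (\<lambda>x. of_real (exp (- s * x\<^sup>2)))) x = of_real (exp (- s * (- x)\<^sup>2))" for x
    unfolding eq dunkl_cmult dunkl_gauss[OF k t] of_real_mult mult.assoc[symmetric] one
    using s by simp
  moreover have "integrable (dunkl_measure k) (\<lambda>x. complex_of_real (exp (- s * x\<^sup>2)))"
    "integrable (dunkl_measure k) (\<lambda>x. ?c * complex_of_real (exp (- ?t * x\<^sup>2)))"
    by (intro integrable_mult_right integrable_of_real integrable_gauss(1) k s t)+
  moreover have "norm (complex_of_real (exp (- s * x\<^sup>2))) \<le> 1" for x using s by simp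
  ultimately show ?thesis unfolding dunkl_test_def unfolding eq by blast
qed

text \<open>As for the even Gaussian, with the additional factor (-i)^2 = -1, which is the
  reflection of an odd function.\<close>

lemma dunkl_test_gauss_odd:
  assumes k: "k \<ge> - 1 / 2" and s: "s > 0"
  shows "dunkl_test k (\<lambda>x. of_real (x * exp (- s * x\<^sup>2)))"
proof -
  let ?t = "1 / (4 * s)"
  let ?c = "complex_of_real ((2 * s) powr (- (k + 2)))"
  have t: "?t > 0" using s by simp
  have eq: "dunkl k (\<lambda>x. of_real (x * exp (- s * x\<^sup>2))) = (\<lambda>l. (- \<i> * ?c) * of_real (l * exp (- ?t * l\<^sup>2)))"
    by (rule ext, simp only: dunkl_gauss_odd[OF k s]) simp
  have "(2 * s) powr (- (k + 2)) * (2 * ?t) powr (- (k + 2)) = 1"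
    using s by (simp flip: powr_mult)
  then have one: "?c * complex_of_real ((2 * ?t) powr (- (k + 2))) = 1"
    by (metis of_real_1 of_real_mult)
  have "dunkl k (dunkl k (\<lambda>x. of_real (x * exp (- s * x\<^sup>2)))) x = of_real (- x * exp (- s * (- x)\<^sup>2))" for x
  proof -
    have "dunkl k (dunkl k (\<lambda>x. of_real (x * exp (- s * x\<^sup>2)))) x =
        (- \<i> * - \<i>) * (?c * complex_of_real ((2 * ?t) powr (- (k + 2)))) * of_real (x * exp (- x\<^sup>2 / (4 * ?t)))"
      unfolding eq dunkl_cmult dunkl_gauss_odd[OF k t] by (simp only: of_real_mult mult_ac)
    then show ?thesis unfolding one using s by simp
  qed
  moreover have int: "integrable (dunkl_measure k) (\<lambda>x. x * exp (- s * x\<^sup>2))" if s: "s > 0" for s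
    by (rule Bochner_Integration.integrable_bound[OF integrable_gauss(2)[OF k s]]) (auto simp: abs_mult)
  moreover have "integrable (dunkl_measure k) (\<lambda>x. complex_of_real (x * exp (- s * x\<^sup>2)))"
    "integrable (dunkl_measure k) (\<lambda>x. (- \<i> * ?c) * complex_of_real (x * exp (- ?t * x\<^sup>2)))"
    by (intro integrable_mult_right integrable_of_real int s t)+
  moreover have "norm (complex_of_real (x * exp (- s * x\<^sup>2))) \<le> 1 + 1 / s" for x
  proof -
    have "s * x\<^sup>2 \<le> exp (s * x\<^sup>2)" using exp_ge_add_one_self[of "s * x\<^sup>2"] by linarith
    then have 1: "x\<^sup>2 * exp (- s * x\<^sup>2) \<le> 1 / s"
      using s by (simp add: exp_minus field_simps)
    have 2: "exp (- s * x\<^sup>2) \<le> 1" using s by simp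
    have "\<bar>x\<bar> * exp (- s * x\<^sup>2) \<le> (1 + x\<^sup>2) * exp (- s * x\<^sup>2)"
      by (intro mult_right_mono abs_le_one_plus_square) auto
    also have "\<dots> \<le> 1 + 1 / s" using 1 2 by (simp only: distrib_right mult_1_left)
    finally show ?thesis by (simp only: norm_of_real abs_mult abs_exp_cancel)
  qed
  ultimately show ?thesis unfolding dunkl_test_def unfolding eq by blast
qed

lemma integrable_bounded_square:
  fixes g :: "'a \<Rightarrow> complex"
  assumes g: "integrable M g" and B: "\<And>x. norm (g x) \<le> B"
  shows "integrable M (\<lambda>x. (norm (g x))\<^sup>2)"
proof (rule Bochner_Integration.integrable_bound)
  show "integrable M (\<lambda>x. B * norm (g x))" using g by simp
  have [measurable]: "g \<in> borel_measurable M" using g by simp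
  show "(\<lambda>x. (norm (g x))\<^sup>2) \<in> borel_measurable M" by measurable
  have "0 \<le> B" using B[of undefined] norm_ge_zero order_trans by blast
  then show "AE x in M. norm ((norm (g x))\<^sup>2) \<le> norm (B * norm (g x))"
    using B by (auto simp: power2_eq_square abs_mult intro!: mult_right_mono)
qed

text \<open>Apply the multiplication formula to the transform of \<open>g\<close> and to \<open>x \<mapsto> cnj (g (- x))\<close>.\<close>

lemma dunkl_test_isometry:
  assumes k: "k \<ge> - 1 / 2" and g: "dunkl_test k g"
  shows "(\<integral>l. (norm (dunkl k g l))\<^sup>2 \<partial>dunkl_measure k) = (\<integral>x. (norm (g x))\<^sup>2 \<partial>dunkl_measure k)"
proof -
  let ?\<mu> = "dunkl_measure k"
  have i: "integrable ?\<mu> g" "integrable ?\<mu> (dunkl k g)" using g by (auto simp: dunkl_test_def)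
  have [measurable]: "g \<in> borel_measurable borel" using borel_measurable_integrable[OF i(1)] by simp
  define h where "h x = cnj (g (- x))" for x
  have h: "integrable ?\<mu> h"
    unfolding h_def by (intro integrable_cnj integrable_dunkl_measure_reflect i)
  have Dh: "dunkl k h l = cnj (dunkl k g l)" for l
  proof -
    have [measurable]: "(\<lambda>x. dunkl_kernel k l x) \<in> borel_measurable borel"
      by (rule dunkl_kernel_measurable[OF k]) auto
    have "dunkl k h l = (\<integral>x. cnj (g (- x)) * dunkl_kernel k l (- (- x)) \<partial>?\<mu>)"
      by (simp add: dunkl_def h_def)
    also have "\<dots> = (\<integral>x. cnj (g (- x) * dunkl_kernel k l (- x)) \<partial>?\<mu>)"
      by (simp add: cnj_dunkl_kernel)
    also have "\<dots> = cnj (\<integral>x. g (- x) * dunkl_kernel k l (- x) \<partial>?\<mu>)"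
      by (rule Bochner_Integration.integral_cnj)
    also have "(\<integral>x. g (- x) * dunkl_kernel k l (- x) \<partial>?\<mu>) = dunkl k g l"
      unfolding dunkl_def by (rule integral_dunkl_measure_reflect) measurable
    finally show ?thesis .
  qed
  have "complex_of_real (\<integral>l. (norm (dunkl k g l))\<^sup>2 \<partial>?\<mu>) = (\<integral>l. dunkl k g l * dunkl k h l \<partial>?\<mu>)"
    unfolding Bochner_Integration.integral_complex_of_real[symmetric] by (simp only: Dh complex_norm_square)
  also have "\<dots> = (\<integral>x. dunkl k (dunkl k g) x * h x \<partial>?\<mu>)"
    by (rule dunkl_mult_formula[OF k i(2) h, symmetric])
  also have "\<dots> = (\<integral>x. complex_of_real ((norm (g (- x)))\<^sup>2) \<partial>?\<mu>)"
    using g unfolding dunkl_test_def by (simp only: h_def complex_norm_square)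
  also have "\<dots> = (\<integral>x. complex_of_real ((norm (g x))\<^sup>2) \<partial>?\<mu>)"
    by (rule integral_dunkl_measure_reflect) measurable
  also have "\<dots> = complex_of_real (\<integral>x. (norm (g x))\<^sup>2 \<partial>?\<mu>)"
    by (rule integral_complex_of_real)
  finally show ?thesis unfolding of_real_eq_iff .
qed

text \<open>The contraction in weak form: the transform is moved from f to g, and Cauchy-Schwarz
  meets the isometry on test functions.\<close>

lemma dunkl_pairing_le:
  assumes k: "k \<ge> - 1 / 2" and g: "dunkl_test k g"
    and f: "integrable (dunkl_measure k) f" "integrable (dunkl_measure k) (\<lambda>x. (norm (f x))\<^sup>2)"
  shows "(norm (\<integral>l. dunkl k f l * g l \<partial>dunkl_measure k))\<^sup>2 \<le>
    (\<integral>x. (norm (f x))\<^sup>2 \<partial>dunkl_measure k) * (\<integral>x. (norm (g x))\<^sup>2 \<partial>dunkl_measure k)"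
proof -
  have i: "integrable (dunkl_measure k) g" "integrable (dunkl_measure k) (dunkl k g)"
    using g by (auto simp: dunkl_test_def)
  have D: "norm (dunkl k g x) \<le> (\<integral>x. norm (g x) \<partial>dunkl_measure k)" for x
    by (rule norm_dunkl_le[OF k i(1)])
  have fi: "integrable (dunkl_measure k) (\<lambda>x. f x * dunkl k g x)"
  proof (rule Bochner_Integration.integrable_bound)
    show "integrable (dunkl_measure k) (\<lambda>x. norm (f x) * (\<integral>x. norm (g x) \<partial>dunkl_measure k))"
      using f by simp
    show "AE x in dunkl_measure k. norm (f x * dunkl k g x) \<le>
        norm (norm (f x) * (\<integral>x. norm (g x) \<partial>dunkl_measure k))"
      using D by (intro AE_I2) (auto simp: norm_mult abs_mult intro!: mult_left_mono)
    show "(\<lambda>x. f x * dunkl k g x) \<in> borel_measurable (dunkl_measure k)"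
      using f(1) i(2) by (intro borel_measurable_times borel_measurable_integrable)
  qed
  have "(norm (\<integral>x. f x * dunkl k g x \<partial>dunkl_measure k))\<^sup>2 \<le>
    (\<integral>x. (norm (f x))\<^sup>2 \<partial>dunkl_measure k) * (\<integral>x. (norm (dunkl k g x))\<^sup>2 \<partial>dunkl_measure k)"
    by (rule cauchy_schwarz_integral[OF fi borel_measurable_integrable[OF f(1)]
          borel_measurable_integrable[OF i(2)] f(2) integrable_bounded_square[OF i(2) D]])
  then show ?thesis
    unfolding dunkl_mult_formula[OF k f(1) i(1)] dunkl_test_isometry[OF k g] .
qed

text \<open>Weierstrass approximation in the variable \<open>u = e\<^bsup>-x\<^sup>2\<^esup>\<close>, in which an even function becomes a
  function on \<open>(0,1]\<close>.\<close>

lemma approx_even_gauss_poly: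
  fixes e :: "real \<Rightarrow> real"
  assumes cont: "continuous_on UNIV e" and even: "\<And>x. e (- x) = e x"
    and supp: "\<And>x. \<bar>x\<bar> \<ge> R \<Longrightarrow> e x = 0" and R: "R > 0" and \<epsilon>: "\<epsilon> > 0"
  obtains a n where "\<And>x. \<bar>(\<Sum>i\<le>(n::nat). a i * exp (- x\<^sup>2) ^ i) - e x * exp (x\<^sup>2)\<bar> < \<epsilon>"
proof -
  define d where "d = exp (- R\<^sup>2)"
  \<comment> \<open>The floor d keeps the logarithm and the quotient continuous at u = 0. Dividing
    by u = exp(-x^2) stores a factor exp(x^2), so that restoring exp(-x^2) later gives the uniform
    error Gaussian decay.\<close>
  define \<Phi> where "\<Phi> u = e (sqrt (- ln (max u d))) / max u d" for u
  have d: "d > 0" by (simp add: d_def)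
  have "continuous_on {0..1} \<Phi>"
    unfolding \<Phi>_def using d
    by (intro continuous_intros continuous_on_compose2[OF cont]) (auto simp: max_def)
  then obtain g where g: "real_polynomial_function g" "\<And>u. u \<in> {0..1} \<Longrightarrow> \<bar>\<Phi> u - g u\<bar> < \<epsilon>"
    using Stone_Weierstrass_real_polynomial_function[of "{0..1}" \<Phi> \<epsilon>] \<epsilon> by auto
  then obtain a n where an: "g = (\<lambda>x. \<Sum>i\<le>n. a i * x ^ i)"
    unfolding real_polynomial_function_iff_sum by blast
  have eq: "\<Phi> (exp (- x\<^sup>2)) = e x * exp (x\<^sup>2)" for x
  proof (cases "\<bar>x\<bar> \<le> R")
    case True
    then have "x\<^sup>2 \<le> R\<^sup>2" using R by (simp add: abs_le_square_iff[symmetric])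
    then have *: "max (exp (- x\<^sup>2)) d = exp (- x\<^sup>2)" by (simp add: d_def max_def)
    have "e \<bar>x\<bar> = e x" using even by (simp add: abs_if)
    then show ?thesis
      unfolding \<Phi>_def * ln_exp minus_minus real_sqrt_abs by (simp add: exp_minus divide_inverse)
  next
    case False
    then have "R\<^sup>2 \<le> x\<^sup>2" using R by (simp add: abs_le_square_iff[symmetric])
    then have *: "max (exp (- x\<^sup>2)) d = exp (- R\<^sup>2)" by (simp add: d_def max_def)
    show ?thesis unfolding \<Phi>_def * using supp[of R] supp[of x] False R by simp
  qed
  show ?thesis
  proof (rule that)
    fix x
    show "\<bar>(\<Sum>i\<le>n. a i * exp (- x\<^sup>2) ^ i) - e x * exp (x\<^sup>2)\<bar> < \<epsilon>"
      using g(2)[of "exp (- x\<^sup>2)"] by (simp add: eq an abs_minus_commute)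
  qed
qed

lemma dunkl_test_gauss_poly:
  assumes k: "k \<ge> - 1 / 2"
  shows "dunkl_test k (\<lambda>x. of_real ((\<Sum>i\<le>n. a i * exp (- x\<^sup>2) ^ i) * exp (- x\<^sup>2)))"
    and "dunkl_test k (\<lambda>x. of_real (x * ((\<Sum>i\<le>n. a i * exp (- x\<^sup>2) ^ i) * exp (- x\<^sup>2))))"
proof -
  \<comment> \<open>The additional factor exp(-x^2) shifts the exponents to i + 1, so every summand
    is a Gaussian of positive width parameter.\<close>
  have eq: "(\<Sum>i\<le>n. a i * exp (- x\<^sup>2) ^ i) * exp (- x\<^sup>2) = (\<Sum>i\<le>n. a i * exp (- real (Suc i) * x\<^sup>2))" for x
  proof -
    have "exp (- x\<^sup>2) ^ i * exp (- x\<^sup>2) = exp (- real (Suc i) * x\<^sup>2)" for i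
    proof -
      have "exp (- real (Suc i) * x\<^sup>2) = exp (real (Suc i) * (- x\<^sup>2))"
        by (simp only: mult_minus_left mult_minus_right)
      also have "\<dots> = exp (- x\<^sup>2) ^ Suc i" by (rule exp_of_nat_mult)
      finally show ?thesis by simp
    qed
    then show ?thesis by (simp only: sum_distrib_right mult.assoc)
  qed
  have "dunkl_test k (\<lambda>x. \<Sum>i\<le>n. of_real (a i) * of_real (exp (- real (Suc i) * x\<^sup>2)))"
    by (intro dunkl_test_sum dunkl_test_gauss k) simp
  then show "dunkl_test k (\<lambda>x. of_real ((\<Sum>i\<le>n. a i * exp (- x\<^sup>2) ^ i) * exp (- x\<^sup>2)))"
    unfolding eq by (simp only: of_real_sum of_real_mult)
  have "dunkl_test k (\<lambda>x. \<Sum>i\<le>n. of_real (a i) * of_real (x * exp (- real (Suc i) * x\<^sup>2)))"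
    by (intro dunkl_test_sum dunkl_test_gauss_odd k) simp
  then show "dunkl_test k (\<lambda>x. of_real (x * ((\<Sum>i\<le>n. a i * exp (- x\<^sup>2) ^ i) * exp (- x\<^sup>2))))"
    unfolding eq sum_distrib_left mult.left_commute[of _ "a _"] by (simp only: of_real_sum of_real_mult)
qed

text \<open>The even part of h and the odd part divided by x are both even functions, to which the
  Weierstrass argument applies. Vanishing of h near 0 makes the division by x harmless.\<close>

lemma approx_dunkl_test_real:
  fixes h :: "real \<Rightarrow> real"
  assumes k: "k \<ge> - 1 / 2" and cont: "continuous_on UNIV h" and \<delta>: "\<delta> > 0" "\<And>x. \<bar>x\<bar> \<le> \<delta> \<Longrightarrow> h x = 0"
    and supp: "\<And>x. \<bar>x\<bar> \<ge> R \<Longrightarrow> h x = 0" and R: "R > 0" and \<epsilon>: "\<epsilon> > 0"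
  obtains g where "dunkl_test k (\<lambda>x. of_real (g x))" "\<And>x. \<bar>g x - h x\<bar> \<le> \<epsilon> * ((1 + \<bar>x\<bar>) * exp (- x\<^sup>2))"
proof -
  define he where "he x = (h x + h (- x)) / 2" for x
  \<comment> \<open>For |x| >= \<delta> this is (h(x) - h(-x))/(2x), and closer to 0 the numerator
    vanishes; the maximum keeps the denominator away from 0, so continuity is immediate.\<close>
  define ho where "ho x = (h x - h (- x)) * x / (2 * max (x\<^sup>2) (\<delta>\<^sup>2))" for x
  have pos: "2 * max (x\<^sup>2) (\<delta>\<^sup>2) \<noteq> 0" for x :: real
    using \<delta>(1) by (auto simp: max_def)
  have split: "h x = he x + x * ho x" for x
  proof (cases "\<bar>x\<bar> \<le> \<delta>")
    case True
    then show ?thesis using \<delta>(2)[of x] \<delta>(2)[of "- x"] by (simp add: he_def ho_def)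
  next
    case False
    then have "\<delta>\<^sup>2 \<le> x\<^sup>2" using \<delta>(1) by (simp add: abs_le_square_iff[symmetric])
    moreover have "x \<noteq> 0" using False \<delta>(1) by (cases "x = 0") simp_all
    ultimately show ?thesis by (simp add: he_def ho_def max_def power2_eq_square field_simps)
  qed
  have cont': "continuous_on UNIV (\<lambda>x. h (- x))"
    by (intro continuous_on_compose2[OF cont] continuous_intros) auto
  have ce: "continuous_on UNIV he" unfolding he_def by (intro continuous_intros cont cont') auto
  have co: "continuous_on UNIV ho" unfolding ho_def by (intro continuous_intros cont cont') (use pos in auto)
  have even: "he (- x) = he x" "ho (- x) = ho x" for x by (auto simp: he_def ho_def algebra_simps)
  have zero: "he x = 0" "ho x = 0" if "\<bar>x\<bar> \<ge> R" for x using supp that by (auto simp: he_def ho_def)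
  obtain a n where e: "\<And>x. \<bar>(\<Sum>i\<le>(n::nat). a i * exp (- x\<^sup>2) ^ i) - he x * exp (x\<^sup>2)\<bar> < \<epsilon>"
    using approx_even_gauss_poly[OF ce even(1) zero(1) R \<epsilon>] by blast
  obtain b m where o: "\<And>x. \<bar>(\<Sum>i\<le>(m::nat). b i * exp (- x\<^sup>2) ^ i) - ho x * exp (x\<^sup>2)\<bar> < \<epsilon>"
    using approx_even_gauss_poly[OF co even(2) zero(2) R \<epsilon>] by blast
  define P where "P x = (\<Sum>i\<le>n. a i * exp (- x\<^sup>2) ^ i)" for x
  define Q where "Q x = (\<Sum>i\<le>m. b i * exp (- x\<^sup>2) ^ i)" for x
  define g where "g x = P x * exp (- x\<^sup>2) + x * (Q x * exp (- x\<^sup>2))" for x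
  have "dunkl_test k (\<lambda>x. 1 * of_real (P x * exp (- x\<^sup>2)) + 1 * of_real (x * (Q x * exp (- x\<^sup>2))))"
    unfolding P_def Q_def by (intro dunkl_test_lincomb dunkl_test_gauss_poly k)
  then have "dunkl_test k (\<lambda>x. of_real (g x))" by (simp only: g_def of_real_add mult_1_left)
  moreover have "\<bar>g x - h x\<bar> \<le> \<epsilon> * ((1 + \<bar>x\<bar>) * exp (- x\<^sup>2))" for x
  proof -
    have "exp (x\<^sup>2) * exp (- x\<^sup>2) = 1" by (simp flip: exp_add)
    then have "g x - h x = ((P x - he x * exp (x\<^sup>2)) + x * (Q x - ho x * exp (x\<^sup>2))) * exp (- x\<^sup>2)"
      unfolding g_def split[of x] by (simp add: algebra_simps)
    also have "\<bar>\<dots>\<bar> = \<bar>(P x - he x * exp (x\<^sup>2)) + x * (Q x - ho x * exp (x\<^sup>2))\<bar> * exp (- x\<^sup>2)"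
      by (simp add: abs_mult)
    also have "\<dots> \<le> (\<epsilon> + \<bar>x\<bar> * \<epsilon>) * exp (- x\<^sup>2)"
    proof (intro mult_right_mono order_trans[OF abs_triangle_ineq] add_mono)
      show "\<bar>P x - he x * exp (x\<^sup>2)\<bar> \<le> \<epsilon>" using e[of x] by (simp add: P_def)
      show "\<bar>x * (Q x - ho x * exp (x\<^sup>2))\<bar> \<le> \<bar>x\<bar> * \<epsilon>"
        using o[of x] unfolding abs_mult Q_def by (intro mult_left_mono) auto
    qed simp
    finally show ?thesis by (simp add: algebra_simps)
  qed
  ultimately show ?thesis by (rule that)
qed

lemma approx_dunkl_test:
  fixes h :: "real \<Rightarrow> complex"
  assumes k: "k \<ge> - 1 / 2" and cont: "continuous_on UNIV h" and \<delta>: "\<delta> > 0" "\<And>x. \<bar>x\<bar> \<le> \<delta> \<Longrightarrow> h x = 0"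
    and supp: "\<And>x. \<bar>x\<bar> \<ge> R \<Longrightarrow> h x = 0" and R: "R > 0" and \<epsilon>: "\<epsilon> > 0"
  obtains g where "dunkl_test k g" "\<And>x. norm (g x - h x) \<le> \<epsilon> * ((1 + \<bar>x\<bar>) * exp (- x\<^sup>2))"
proof -
  have cR: "continuous_on UNIV (\<lambda>x. Re (h x))" and cI: "continuous_on UNIV (\<lambda>x. Im (h x))"
    by (intro continuous_intros cont)+
  obtain u where u: "dunkl_test k (\<lambda>x. of_real (u x))" "\<And>x. \<bar>u x - Re (h x)\<bar> \<le> \<epsilon> / 2 * ((1 + \<bar>x\<bar>) * exp (- x\<^sup>2))"
    by (rule approx_dunkl_test_real[OF k cR \<delta>(1) _ _ R, of "\<epsilon> / 2"]) (use \<delta>(2) supp \<epsilon> in auto)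
  obtain v where v: "dunkl_test k (\<lambda>x. of_real (v x))" "\<And>x. \<bar>v x - Im (h x)\<bar> \<le> \<epsilon> / 2 * ((1 + \<bar>x\<bar>) * exp (- x\<^sup>2))"
    by (rule approx_dunkl_test_real[OF k cI \<delta>(1) _ _ R, of "\<epsilon> / 2"]) (use \<delta>(2) supp \<epsilon> in auto)
  show ?thesis
  proof (rule that)
    show "dunkl_test k (\<lambda>x. 1 * of_real (u x) + \<i> * of_real (v x))"
      by (intro dunkl_test_lincomb k u v)
    fix x
    have "norm (1 * of_real (u x) + \<i> * of_real (v x) - h x) \<le> \<bar>u x - Re (h x)\<bar> + \<bar>v x - Im (h x)\<bar>"
      by (rule order_trans[OF cmod_le]) simp
    with u(2)[of x] v(2)[of x]
    show "norm (1 * of_real (u x) + \<i> * of_real (v x) - h x) \<le> \<epsilon> * ((1 + \<bar>x\<bar>) * exp (- x\<^sup>2))"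
      by (simp add: field_simps)
  qed
qed

text \<open>Let F be the transform, \<tau> a cutoff, J the integral of |F|^2 \<tau> and X that of
  |f|^2. Testing the pairing inequality with approximations of h = cnj F times \<tau> gives J^2 <= X
  times the integral of |h|^2, which is at most X J because \<tau> <= 1. Since J is finite, J <= X,
  and Fatou removes the cutoff.\<close>

theorem dunkl_L2_contraction:
  assumes k: "k \<ge> - 1 / 2"
    and f: "integrable (dunkl_measure k) f" "integrable (dunkl_measure k) (\<lambda>x. (norm (f x))\<^sup>2)"
  shows "(\<integral>\<^sup>+l. ennreal ((norm (dunkl k f l))\<^sup>2) \<partial>dunkl_measure k) \<le> (\<integral>\<^sup>+x. ennreal ((norm (f x))\<^sup>2) \<partial>dunkl_measure k)"
proof -
  let ?\<mu> = "dunkl_measure k"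
  define F where "F = dunkl k f"
  define B where "B = (\<integral>x. norm (f x) \<partial>?\<mu>)"
  define X where "X = (\<integral>x. (norm (f x))\<^sup>2 \<partial>?\<mu>)"
  have FB: "norm (F x) \<le> B" for x unfolding F_def B_def by (rule norm_dunkl_le[OF k f(1)])
  have B0: "B \<ge> 0" using order_trans[OF norm_ge_zero FB] .
  have cF: "continuous_on UNIV F" unfolding F_def by (rule continuous_on_dunkl[OF k f(1)])
  then have [measurable]: "F \<in> borel_measurable borel" by (rule borel_measurable_continuous_onI)
  \<comment> \<open>With N = n + 1 this vanishes for |x| <= 1/N and for |x| >= N, as the
    approximation lemma requires, and equals 1 for 2/N <= |x| <= N - 1. The limit 1 is missed only
    at 0, a null set.\<close>
  define \<tau> where "\<tau> n x = max 0 (min 1 (real (Suc n) * \<bar>x\<bar> - 1)) * max 0 (min 1 (real (Suc n) - \<bar>x\<bar>))" for n and x :: real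
  have [measurable]: "\<tau> n \<in> borel_measurable borel" for n unfolding \<tau>_def by measurable
  have c\<tau>: "continuous_on UNIV (\<tau> n)" for n unfolding \<tau>_def by (intro continuous_intros)
  have \<tau>01: "0 \<le> \<tau> n x" "\<tau> n x \<le> 1" for n x
    unfolding \<tau>_def by (auto intro!: mult_le_one)
  have le: "(\<integral>\<^sup>+x. ennreal ((norm (F x))\<^sup>2 * \<tau> n x) \<partial>?\<mu>) \<le> ennreal X" for n
  proof -
    define N where "N = real (Suc n)"
    have N: "N > 0" by (simp add: N_def)
    define h where "h x = cnj (F x) * of_real (\<tau> n x)" for x
    have ch: "continuous_on UNIV h" unfolding h_def by (intro continuous_intros cF c\<tau>)
    have [measurable]: "h \<in> borel_measurable borel" by (rule borel_measurable_continuous_onI[OF ch])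
    have h0: "h x = 0" if "\<bar>x\<bar> \<le> 1 / N" for x
    proof -
      have "N * \<bar>x\<bar> - 1 \<le> 0" using that N by (simp add: field_simps)
      then have "max 0 (min 1 (N * \<bar>x\<bar> - 1)) = 0" by simp
      then show ?thesis by (simp only: h_def \<tau>_def N_def[symmetric]) simp
    qed
    have hR: "h x = 0" if "\<bar>x\<bar> \<ge> N" for x
    proof -
      have "max 0 (min 1 (N - \<bar>x\<bar>)) = 0" using that by simp
      then show ?thesis by (simp only: h_def \<tau>_def N_def[symmetric]) simp
    qed
    have "\<exists>g. dunkl_test k g \<and> (\<forall>x. norm (g x - h x) \<le> 1 / real (Suc m) * ((1 + \<bar>x\<bar>) * exp (- x\<^sup>2)))" for m
    proof -
      have \<delta>: "0 < 1 / N" and \<epsilon>: "0 < 1 / real (Suc m)" using N by auto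
      show ?thesis using approx_dunkl_test[OF k ch \<delta> h0 hR N \<epsilon>] by blast
    qed
    then obtain g where g: "\<And>m. dunkl_test k (g m)"
      "\<And>m x. norm (g m x - h x) \<le> 1 / real (Suc m) * ((1 + \<bar>x\<bar>) * exp (- x\<^sup>2))"
      by metis
    have [measurable]: "g m \<in> borel_measurable borel" for m
      using g(1)[of m] borel_measurable_integrable[of ?\<mu> "g m"] by (simp add: dunkl_test_def)
    \<comment> \<open>A common majorant of h and all its approximations: |h| <= B on |x| <= N, where
      1 <= exp(N^2) exp(-x^2), and the errors are at most (1 + |x|) exp(-x^2). Being integrable and
      bounded, w dominates both limits below.\<close>
    define w where "w x = (B * exp (N\<^sup>2) + 1) * exp (- x\<^sup>2) + \<bar>x\<bar> * exp (- x\<^sup>2)" for x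
    have wi: "integrable ?\<mu> w"
      unfolding w_def using integrable_gauss[OF k, of 1] by simp
    have w0: "w x \<ge> 0" for x unfolding w_def using B0 by (intro add_nonneg_nonneg mult_nonneg_nonneg) auto
    have hw: "norm (h x) + (1 + \<bar>x\<bar>) * exp (- x\<^sup>2) \<le> w x" for x
    proof -
      have "norm (h x) \<le> B * exp (N\<^sup>2) * exp (- x\<^sup>2)"
      proof (cases "\<bar>x\<bar> \<ge> N")
        case False
        then have "x\<^sup>2 \<le> N\<^sup>2" using N by (simp add: abs_le_square_iff[symmetric])
        then have "1 \<le> exp (N\<^sup>2) * exp (- x\<^sup>2)" by (simp flip: exp_add)
        then have "B * 1 \<le> B * (exp (N\<^sup>2) * exp (- x\<^sup>2))" using B0 by (rule mult_left_mono)
        moreover have "norm (h x) \<le> B * 1"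
          unfolding h_def norm_mult using \<tau>01[of n x] FB[of x] B0 by (intro mult_mono) auto
        ultimately show ?thesis by (simp add: mult.assoc)
      qed (use hR B0 in simp)
      then show ?thesis by (simp add: w_def algebra_simps)
    qed
    have hw1: "norm (h x) \<le> w x" for x
    proof -
      have "0 \<le> (1 + \<bar>x\<bar>) * exp (- x\<^sup>2)" by simp
      with hw[of x] show ?thesis by linarith
    qed
    have gw: "norm (g m x) \<le> w x" for m x
    proof -
      have "norm (g m x) \<le> norm (h x) + norm (g m x - h x)" by (rule norm_triangle_sub)
      also have "norm (g m x - h x) \<le> 1 * ((1 + \<bar>x\<bar>) * exp (- x\<^sup>2))"
        by (rule order_trans[OF g(2)], rule mult_right_mono) auto
      finally show ?thesis using hw[of x] by simp
    qed
    have w_bound: "w x \<le> B * exp (N\<^sup>2) + 3" for x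
    proof -
      have "\<bar>x\<bar> \<le> 1 + x\<^sup>2" by (rule abs_le_one_plus_square)
      also have "\<dots> \<le> exp (x\<^sup>2)" by (rule exp_ge_add_one_self)
      finally have 1: "\<bar>x\<bar> * exp (- x\<^sup>2) \<le> 1" by (simp add: exp_minus field_simps)
      have 2: "(B * exp (N\<^sup>2) + 1) * exp (- x\<^sup>2) \<le> (B * exp (N\<^sup>2) + 1) * 1"
        using B0 by (intro mult_left_mono) auto
      show ?thesis using add_mono[OF 2 1] by (simp only: w_def) simp
    qed
    have w2: "integrable ?\<mu> (\<lambda>x. (w x)\<^sup>2)"
    proof (rule Bochner_Integration.integrable_bound)
      show "integrable ?\<mu> (\<lambda>x. (B * exp (N\<^sup>2) + 3) * w x)" using wi by simp
      show "AE x in ?\<mu>. norm ((w x)\<^sup>2) \<le> norm ((B * exp (N\<^sup>2) + 3) * w x)"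
      proof (intro AE_I2)
        fix x
        have "w x * w x \<le> (B * exp (N\<^sup>2) + 3) * w x" by (rule mult_right_mono[OF w_bound w0])
        then show "norm ((w x)\<^sup>2) \<le> norm ((B * exp (N\<^sup>2) + 3) * w x)"
          using w0[of x] by (simp add: power2_eq_square)
      qed
      show "(\<lambda>x. (w x)\<^sup>2) \<in> borel_measurable ?\<mu>" using wi by simp
    qed
    have gh: "(\<lambda>m. g m x) \<longlonglongrightarrow> h x" for x
    proof -
      have "(\<lambda>m. 1 / real (Suc m) * ((1 + \<bar>x\<bar>) * exp (- x\<^sup>2))) \<longlonglongrightarrow> 0 * ((1 + \<bar>x\<bar>) * exp (- x\<^sup>2))"
        using LIMSEQ_inverse_real_of_nat by (intro tendsto_mult tendsto_const) (simp add: inverse_eq_divide)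
      then have "(\<lambda>m. g m x - h x) \<longlonglongrightarrow> 0"
        by (intro Lim_null_comparison[OF always_eventually[OF allI[OF g(2)]]]) simp
      then show ?thesis by (simp add: LIM_zero_iff)
    qed
    define J where "J = (\<integral>x. (norm (F x))\<^sup>2 * \<tau> n x \<partial>?\<mu>)"
    have Ji: "integrable ?\<mu> (\<lambda>x. (norm (F x))\<^sup>2 * \<tau> n x)"
    proof (rule Bochner_Integration.integrable_bound)
      show "integrable ?\<mu> (\<lambda>x. B * w x)" using wi by simp
      have "(norm (F x))\<^sup>2 * \<tau> n x \<le> B * w x" for x
      proof -
        have "(norm (F x))\<^sup>2 * \<tau> n x = norm (F x) * norm (h x)"
          using \<tau>01[of n x] by (simp add: h_def norm_mult power2_eq_square)
        also have "\<dots> \<le> B * w x" using B0 by (intro mult_mono FB hw1) auto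
        finally show ?thesis .
      qed
      then show "AE x in ?\<mu>. norm ((norm (F x))\<^sup>2 * \<tau> n x) \<le> norm (B * w x)"
        using \<tau>01 B0 w0 by (intro AE_I2) (simp add: abs_mult)
    qed simp
    have J0: "J \<ge> 0" unfolding J_def using \<tau>01 by (intro integral_nonneg_AE) auto
    have lim1: "(\<lambda>m. \<integral>x. F x * g m x \<partial>?\<mu>) \<longlonglongrightarrow> (\<integral>x. F x * h x \<partial>?\<mu>)"
    proof (rule integral_dominated_convergence)
      show "integrable ?\<mu> (\<lambda>x. B * w x)" using wi by simp
      show "AE x in ?\<mu>. (\<lambda>m. F x * g m x) \<longlonglongrightarrow> F x * h x"
        by (intro AE_I2 tendsto_intros gh)
      show "AE x in ?\<mu>. norm (F x * g m x) \<le> B * w x" for m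
        unfolding norm_mult using B0 by (intro AE_I2 mult_mono FB gw) auto
    qed auto
    have lim2: "(\<lambda>m. \<integral>x. (norm (g m x))\<^sup>2 \<partial>?\<mu>) \<longlonglongrightarrow> (\<integral>x. (norm (h x))\<^sup>2 \<partial>?\<mu>)"
    proof (rule integral_dominated_convergence[OF _ _ w2])
      show "AE x in ?\<mu>. (\<lambda>m. (norm (g m x))\<^sup>2) \<longlonglongrightarrow> (norm (h x))\<^sup>2"
        by (intro AE_I2 tendsto_intros gh)
      show "AE x in ?\<mu>. norm ((norm (g m x))\<^sup>2) \<le> (w x)\<^sup>2" for m
        using gw by (intro AE_I2) (auto intro: power_mono)
    qed auto
    have "(norm (\<integral>x. F x * h x \<partial>?\<mu>))\<^sup>2 \<le> X * (\<integral>x. (norm (h x))\<^sup>2 \<partial>?\<mu>)"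
    proof (rule LIMSEQ_le)
      show "(\<lambda>m. (norm (\<integral>x. F x * g m x \<partial>?\<mu>))\<^sup>2) \<longlonglongrightarrow> (norm (\<integral>x. F x * h x \<partial>?\<mu>))\<^sup>2"
        by (intro tendsto_intros lim1)
      show "(\<lambda>m. X * (\<integral>x. (norm (g m x))\<^sup>2 \<partial>?\<mu>)) \<longlonglongrightarrow> X * (\<integral>x. (norm (h x))\<^sup>2 \<partial>?\<mu>)"
        by (intro tendsto_intros lim2)
      show "\<exists>M. \<forall>m\<ge>M. (norm (\<integral>x. F x * g m x \<partial>?\<mu>))\<^sup>2 \<le> X * (\<integral>x. (norm (g m x))\<^sup>2 \<partial>?\<mu>)"
        using dunkl_pairing_le[OF k g(1) f] by (auto simp: F_def X_def)
    qed
    also have "(\<integral>x. F x * h x \<partial>?\<mu>) = of_real J"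
    proof -
      have "F x * h x = complex_of_real ((norm (F x))\<^sup>2 * \<tau> n x)" for x
        by (simp only: h_def of_real_mult complex_norm_square mult.assoc)
      then show ?thesis by (simp only: J_def Bochner_Integration.integral_complex_of_real)
    qed
    also have "X * (\<integral>x. (norm (h x))\<^sup>2 \<partial>?\<mu>) \<le> X * J"
    proof (rule mult_left_mono)
      have hsq: "(norm (h x))\<^sup>2 = ((norm (F x))\<^sup>2 * \<tau> n x) * \<tau> n x" for x
        using \<tau>01[of n x] by (simp add: h_def norm_mult power2_eq_square)
      have hle: "(norm (h x))\<^sup>2 \<le> (norm (F x))\<^sup>2 * \<tau> n x" for x
        unfolding hsq using \<tau>01[of n x] by (intro mult_right_le_one_le) auto
      have "integrable ?\<mu> (\<lambda>x. (norm (h x))\<^sup>2)"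
        by (rule Bochner_Integration.integrable_bound[OF Ji])
          (use hle in \<open>auto intro!: AE_I2 order_trans[OF _ abs_ge_self]\<close>)
      then show "(\<integral>x. (norm (h x))\<^sup>2 \<partial>?\<mu>) \<le> J"
        unfolding J_def by (rule integral_mono[OF _ Ji hle])
      show "0 \<le> X" unfolding X_def by (intro integral_nonneg_AE) auto
    qed
    finally have "J * J \<le> X * J" using J0 by (simp add: power2_eq_square)
    then have "J \<le> X"
    proof (cases "J = 0")
      case True
      then show ?thesis unfolding X_def by (auto intro!: integral_nonneg_AE)
    next
      case False
      then show ?thesis using J0 \<open>J * J \<le> X * J\<close> by (simp add: mult_le_cancel_right)
    qed
    moreover have "(\<integral>\<^sup>+x. ennreal ((norm (F x))\<^sup>2 * \<tau> n x) \<partial>?\<mu>) = ennreal J"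
      unfolding J_def using \<tau>01 by (intro nn_integral_eq_integral Ji) auto
    ultimately show ?thesis by (simp add: ennreal_leI)
  qed
  have "(\<integral>\<^sup>+x. ennreal ((norm (F x))\<^sup>2) \<partial>?\<mu>) \<le> ennreal X"
  proof (rule nn_integral_le_limit[OF _ _ le tendsto_const])
    show "AE x in ?\<mu>. (\<lambda>n. ennreal ((norm (F x))\<^sup>2 * \<tau> n x)) \<longlonglongrightarrow> ennreal ((norm (F x))\<^sup>2)"
      using AE_dunkl_measure_nonzero[of k]
    proof eventually_elim
      case (elim x)
      obtain n0 :: nat where n0: "2 / \<bar>x\<bar> < real n0" "\<bar>x\<bar> + 1 < real n0"
        using reals_Archimedean2[of "max (2 / \<bar>x\<bar>) (\<bar>x\<bar> + 1)"] by auto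
      have "\<tau> n x = 1" if "n \<ge> n0" for n
      proof -
        have n: "real n0 \<le> real (Suc n)" using that by simp
        have "2 < real (Suc n) * \<bar>x\<bar>"
          using less_le_trans[OF n0(1) n] elim by (simp add: field_simps)
        moreover have "\<bar>x\<bar> + 1 < real (Suc n)" using n0(2) n by linarith
        ultimately show ?thesis by (simp only: \<tau>_def)
      qed
      then show ?case
        by (intro tendsto_eventually eventually_sequentiallyI[of n0]) simp
    qed
  qed simp
  also have "ennreal X = (\<integral>\<^sup>+x. ennreal ((norm (f x))\<^sup>2) \<partial>?\<mu>)"
    unfolding X_def using f by (intro nn_integral_eq_integral[symmetric]) auto
  finally show ?thesis unfolding F_def .
qed

section \<open>The linear canonical Dunkl transform\<close>

lemma Lp_norm_eq_0:
  assumes "AE x in M. h x = 0" "p > 0"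
  shows "Lp_norm M p h = 0"
proof -
  have "(\<integral>\<^sup>+x. ennreal (norm (h x) powr p) \<partial>M) = (\<integral>\<^sup>+x. 0 \<partial>M)"
    using assms by (intro nn_integral_cong_AE) (auto elim!: eventually_mono)
  then show ?thesis using assms by (simp add: Lp_norm_def ennreal_rpow_def)
qed

text \<open>Hoelder's inequality for \<open>h = h \<cdot> 1\<close> on the support of \<open>h\<close>.\<close>

lemma Lp_norm_le_support:
  assumes [measurable]: "h \<in> borel_measurable M" and r: "0 < r" "r \<le> s"
  shows "Lp_norm M r h \<le> ennreal_rpow (emeasure M {x \<in> space M. h x \<noteq> 0}) (1 / r - 1 / s) * Lp_norm M s h"
proof -
  define A where "A = {x \<in> space M. h x \<noteq> 0}"
  have [measurable]: "A \<in> sets M" unfolding A_def by measurable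
  have A0: "(AE x in M. h x = 0) \<longleftrightarrow> emeasure M A = 0"
    by (rule AE_iff_measurable) (auto simp: A_def)
  have s: "s > 0" using r by simp
  \<comment> \<open>The conventions in [0,\<infinity>] decide the degenerate cases: x^0 = 1 if r =
    s, and the left side is 0 if h vanishes a.e. Otherwise both factors are nonzero, so an infinite
    one makes the product infinite.\<close>
  consider "r = s" | "AE x in M. h x = 0" | "r < s" "\<not> (AE x in M. h x = 0)" "emeasure M A = \<infinity> \<or> Lp_norm M s h = \<infinity>"
    | "r < s" "\<not> (AE x in M. h x = 0)" "emeasure M A \<noteq> \<infinity>" "Lp_norm M s h \<noteq> \<infinity>"
    using r by fastforce
  then have "Lp_norm M r h \<le> ennreal_rpow (emeasure M A) (1 / r - 1 / s) * Lp_norm M s h"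
  proof cases
    case 1
    then show ?thesis by (simp add: ennreal_rpow_def)
  next
    case 2
    then show ?thesis using r by (simp add: Lp_norm_eq_0)
  next
    case hyp: 3
    have a: "1 / r - 1 / s > 0" using hyp r by (simp add: field_simps)
    have "emeasure M A \<noteq> 0"
      using hyp(2) A0 by simp
    then have 1: "ennreal_rpow (emeasure M A) (1 / r - 1 / s) \<noteq> 0"
      using a by (cases "emeasure M A = \<infinity>") (auto simp: ennreal_rpow_def enn2real_eq_0_iff)
    have "(\<integral>\<^sup>+x. ennreal (norm (h x) powr s) \<partial>M) \<noteq> 0"
      using hyp(2) by (subst nn_integral_0_iff_AE) auto
    then have 2: "Lp_norm M s h \<noteq> 0"
      using s by (cases "(\<integral>\<^sup>+x. ennreal (norm (h x) powr s) \<partial>M) = \<infinity>")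
        (auto simp: Lp_norm_def ennreal_rpow_def enn2real_eq_0_iff)
    have "ennreal_rpow (emeasure M A) (1 / r - 1 / s) * Lp_norm M s h = \<infinity>"
      using hyp(3) 1 2 a by (auto simp: ennreal_rpow_def ennreal_mult_eq_top_iff)
    then show ?thesis by simp
  next
    case hyp: 4
    have hs: "h \<in> Lp_space M s" using hyp by (simp add: Lp_space_def less_top)
    define Z where "Z = Lp_int M s h"
    define G where "G = measure M A"
    define \<theta> where "\<theta> = r / s"
    have \<theta>: "0 < \<theta>" "\<theta> < 1" using hyp r by (auto simp: \<theta>_def)
    have Z: "Z > 0"
      using hyp(2) Lp_int_eq_0_AE[OF s hs] Lp_int_nonneg[of M s h] unfolding Z_def by (meson not_le)
    have GA: "emeasure M A = ennreal G" using hyp(3) by (simp add: G_def emeasure_eq_ennreal_measure)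
    have "emeasure M A \<noteq> 0"
      using hyp(2) A0 by simp
    then have G: "G > 0" unfolding GA by (simp add: G_def zero_less_measure_iff)
    \<comment> \<open>The bound to be reached. Young's inequality is applied to |h|^s / Z and the
      indicator of A divided by G, both of integral 1, so the weights \<theta> and 1 - \<theta>
      integrate to exactly c.\<close>
    define c where "c = Z powr \<theta> * G powr (1 - \<theta>)"
    have c: "c > 0" using Z G by (simp add: c_def)
    have ZZ: "(\<integral>\<^sup>+x. ennreal (norm (h x) powr s) \<partial>M) = ennreal Z"
      unfolding Z_def by (rule nn_integral_Lp_int[OF s hs])
    have le: "norm (h x) powr r \<le> c * \<theta> / Z * norm (h x) powr s + c * (1 - \<theta>) / G * indicator A x" if x: "x \<in> space M" for x
    proof (cases "h x = 0")
      case False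
      have "norm (h x) powr r = c * ((norm (h x) powr s / Z) powr \<theta> * (1 / G) powr (1 - \<theta>))"
        using Z G s by (simp add: c_def powr_divide powr_powr \<theta>_def)
      also have "\<dots> \<le> c * (\<theta> * (norm (h x) powr s / Z) + (1 - \<theta>) * (1 / G))"
        using \<theta> Z G False c by (intro mult_left_mono Youngs_inequality_0) auto
      finally show ?thesis using False x by (simp add: A_def algebra_simps)
    qed (use r s c \<theta> Z G in \<open>auto simp: A_def\<close>)
    have "(\<integral>\<^sup>+x. ennreal (norm (h x) powr r) \<partial>M) \<le>
        (\<integral>\<^sup>+x. ennreal (c * \<theta> / Z) * ennreal (norm (h x) powr s) + ennreal (c * (1 - \<theta>) / G) * indicator A x \<partial>M)"
    proof (rule nn_integral_mono)
      fix x assume "x \<in> space M"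
      have "ennreal (norm (h x) powr r) \<le> ennreal (c * \<theta> / Z * norm (h x) powr s + c * (1 - \<theta>) / G * indicator A x)"
        by (rule ennreal_leI[OF le]) fact
      also have "\<dots> = ennreal (c * \<theta> / Z) * ennreal (norm (h x) powr s) + ennreal (c * (1 - \<theta>) / G) * indicator A x"
        using c \<theta> Z G by (cases "x \<in> A") (simp_all flip: ennreal_mult ennreal_plus)
      finally show "ennreal (norm (h x) powr r) \<le>
          ennreal (c * \<theta> / Z) * ennreal (norm (h x) powr s) + ennreal (c * (1 - \<theta>) / G) * indicator A x" .
    qed
    also have "\<dots> = ennreal (c * \<theta> / Z) * ennreal Z + ennreal (c * (1 - \<theta>) / G) * ennreal G"
      by (subst nn_integral_add) (auto simp: nn_integral_cmult ZZ GA nn_integral_cmult_indicator)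
    also have "\<dots> = ennreal (c * \<theta> / Z * Z + c * (1 - \<theta>) / G * G)"
      using c \<theta> Z G by (simp flip: ennreal_plus ennreal_mult)
    also have "c * \<theta> / Z * Z + c * (1 - \<theta>) / G * G = c" using Z G by (simp add: right_diff_distrib)
    finally have "(\<integral>\<^sup>+x. ennreal (norm (h x) powr r) \<partial>M) \<le> ennreal c" .
    from Lp_spaceI_bound[OF r(1) less_imp_le[OF c] _ this]
    have hr: "h \<in> Lp_space M r" and "Lp_int M r h \<le> c" by auto
    then have "Lp_int M r h powr (1 / r) \<le> c powr (1 / r)" using r by (intro powr_mono2) auto
    also have "\<dots> = G powr (1 / r - 1 / s) * Z powr (1 / s)"
      using Z G r s by (simp add: c_def powr_mult powr_powr \<theta>_def diff_divide_distrib mult.commute)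
    finally show ?thesis
      using hyp(1) r s G by (simp add: Lp_norm_eq[OF r(1) hr] Lp_norm_eq[OF s hs] GA Z_def[symmetric]
          ennreal_rpow_ennreal ennreal_leI flip: ennreal_mult)
  qed
  then show ?thesis unfolding A_def .
qed

section \<open>The canonical transform as an instance\<close>

definition lcdt_kernel :: "real \<Rightarrow> real^2^2 \<Rightarrow> real \<Rightarrow> real \<Rightarrow> complex" where
  "lcdt_kernel k M l x =
     (let a = M $ 1 $ 1; b = M $ 1 $ 2; d = M $ 2 $ 2 in
        1 / ((\<i> * of_real b) powr of_real (k + 1)) *
        (exp (\<i> / 2 * of_real (d / b * l\<^sup>2 + a / b * x\<^sup>2)) * dunkl_kernel k (l / b) x))"

lemma norm_chirp: "norm (exp (\<i> / 2 * complex_of_real t)) = 1"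
  by (simp add: norm_exp_eq_Re)

text \<open>The chirp in x is absorbed into f without changing |f|, and the chirp in l has modulus
  1. There remain the Dunkl transform at l/b and the prefactor, whose powers of |b| cancel in
  L^2.\<close>

lemma L2_contractive_kernel_lcdt:
  fixes M :: "real^2^2"
  assumes k: "k \<ge> - 1 / 2" and b: "M $ 1 $ 2 \<noteq> 0"
  shows "L2_contractive_kernel (dunkl_measure k) (lcdt_kernel k M) (\<bar>M $ 1 $ 2\<bar> powr (- (k + 1)))"
proof -
  let ?\<mu> = "dunkl_measure k"
  interpret sigma_finite_measure ?\<mu> by (rule sigma_finite_dunkl_measure)
  define a b d where abd: "a = M $ 1 $ 1" "b = M $ 1 $ 2" "d = M $ 2 $ 2"
  define \<kappa> where "\<kappa> = 1 / ((\<i> * complex_of_real b) powr of_real (k + 1))"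
  have b0: "b \<noteq> 0" using b by (simp add: abd)
  have n\<kappa>: "norm \<kappa> = \<bar>b\<bar> powr (- (k + 1))"
  proof -
    have "norm ((\<i> * complex_of_real b) powr of_real (k + 1)) = \<bar>b\<bar> powr (k + 1)"
      by (subst norm_powr_real_powr') (simp_all add: norm_mult del: of_real_add)
    then show ?thesis by (simp only: \<kappa>_def norm_divide norm_one powr_minus_divide)
  qed
  have K: "lcdt_kernel k M l x = \<kappa> * (exp (\<i> / 2 * of_real (d / b * l\<^sup>2 + a / b * x\<^sup>2)) * dunkl_kernel k (l / b) x)" for l x
    by (simp add: lcdt_kernel_def \<kappa>_def abd Let_def)
  show ?thesis
  proof
    show "\<bar>M $ 1 $ 2\<bar> powr (- (k + 1)) > 0" using b by simp
    show "norm (lcdt_kernel k M l x) \<le> \<bar>M $ 1 $ 2\<bar> powr (- (k + 1))" for l x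
      unfolding K norm_mult norm_chirp n\<kappa> abd(2)[symmetric]
      using norm_dunkl_kernel_le_1[OF k, of "l / b" x] by (simp add: mult_left_le)
    have "(\<lambda>z. dunkl_kernel k (fst z / b) (snd z)) \<in> borel_measurable (?\<mu> \<Otimes>\<^sub>M ?\<mu>)"
      by (rule dunkl_kernel_measurable[OF k]) measurable
    then show "(\<lambda>(l, x). lcdt_kernel k M l x) \<in> borel_measurable (?\<mu> \<Otimes>\<^sub>M ?\<mu>)"
      unfolding K split_beta' by measurable
  next
    fix f :: "real \<Rightarrow> complex"
    assume f: "integrable ?\<mu> f" "integrable ?\<mu> (\<lambda>x. (norm (f x))\<^sup>2)"
    have [measurable]: "f \<in> borel_measurable borel" using borel_measurable_integrable[OF f(1)] by simp
    define g where "g x = f x * exp (\<i> / 2 * of_real (a / b * x\<^sup>2))" for x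
    have ng: "norm (g x) = norm (f x)" for x by (simp only: g_def norm_mult norm_chirp mult_1_right)
    have [measurable]: "g \<in> borel_measurable borel" unfolding g_def by measurable
    have g: "integrable ?\<mu> g"
      by (rule Bochner_Integration.integrable_bound[OF f(1)]) (auto simp: ng)
    have eq: "(\<integral>x. f x * lcdt_kernel k M l x \<partial>?\<mu>) =
        \<kappa> * exp (\<i> / 2 * of_real (d / b * l\<^sup>2)) * dunkl k g (l / b)" for l
    proof -
      have "(\<integral>x. f x * lcdt_kernel k M l x \<partial>?\<mu>) =
          (\<integral>x. \<kappa> * exp (\<i> / 2 * of_real (d / b * l\<^sup>2)) * (g x * dunkl_kernel k (l / b) x) \<partial>?\<mu>)"
        by (intro Bochner_Integration.integral_cong refl)
          (simp only: K g_def of_real_add distrib_left exp_add mult_ac)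
      then show ?thesis by (simp add: dunkl_def)
    qed
    have [measurable]: "dunkl k g \<in> borel_measurable borel"
      by (rule borel_measurable_continuous_onI[OF continuous_on_dunkl[OF k g]])
    have "(\<integral>\<^sup>+l. ennreal ((norm (\<integral>x. f x * lcdt_kernel k M l x \<partial>?\<mu>))\<^sup>2) \<partial>?\<mu>) =
        (\<integral>\<^sup>+l. ennreal ((\<bar>b\<bar> powr (- (k + 1)))\<^sup>2) * ennreal ((norm (dunkl k g (l / b)))\<^sup>2) \<partial>?\<mu>)"
      by (simp only: eq norm_mult norm_chirp n\<kappa> mult_1_right power_mult_distrib)
        (simp add: ennreal_mult)
    also have "\<dots> = ennreal ((\<bar>b\<bar> powr (- (k + 1)))\<^sup>2) * (\<integral>\<^sup>+l. ennreal ((norm (dunkl k g (l / b)))\<^sup>2) \<partial>?\<mu>)"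
      by (rule nn_integral_cmult) measurable
    also have "(\<integral>\<^sup>+l. ennreal ((norm (dunkl k g (l / b)))\<^sup>2) \<partial>?\<mu>) =
        ennreal (\<bar>b\<bar> powr (2 * k + 2)) * (\<integral>\<^sup>+l. ennreal ((norm (dunkl k g l))\<^sup>2) \<partial>?\<mu>)"
      by (rule nn_integral_dunkl_measure_scale[OF _ b0]) measurable
    also have "ennreal ((\<bar>b\<bar> powr (- (k + 1)))\<^sup>2) * (ennreal (\<bar>b\<bar> powr (2 * k + 2)) * (\<integral>\<^sup>+l. ennreal ((norm (dunkl k g l))\<^sup>2) \<partial>?\<mu>)) =
        ennreal ((\<bar>b\<bar> powr (- (k + 1)))\<^sup>2 * \<bar>b\<bar> powr (2 * k + 2)) * (\<integral>\<^sup>+l. ennreal ((norm (dunkl k g l))\<^sup>2) \<partial>?\<mu>)"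
      by (simp add: ennreal_mult mult.assoc)
    also have "(\<bar>b\<bar> powr (- (k + 1)))\<^sup>2 * \<bar>b\<bar> powr (2 * k + 2) = 1"
    proof -
      have "(\<bar>b\<bar> powr (- (k + 1)))\<^sup>2 = \<bar>b\<bar> powr (- (k + 1) + - (k + 1))"
        by (simp only: power2_eq_square powr_add)
      then have "(\<bar>b\<bar> powr (- (k + 1)))\<^sup>2 * \<bar>b\<bar> powr (2 * k + 2) = \<bar>b\<bar> powr (- (k + 1) + - (k + 1) + (2 * k + 2))"
        by (simp only: powr_add)
      also have "- (k + 1) + - (k + 1) + (2 * k + 2) = 0" by simp
      finally show ?thesis using b0 by simp
    qed
    also have "ennreal 1 * (\<integral>\<^sup>+l. ennreal ((norm (dunkl k g l))\<^sup>2) \<partial>?\<mu>) \<le> (\<integral>\<^sup>+x. ennreal ((norm (g x))\<^sup>2) \<partial>?\<mu>)"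
      using dunkl_L2_contraction[OF k g] f(2) by (simp add: ng)
    finally show "(\<integral>\<^sup>+l. ennreal ((norm (\<integral>x. f x * lcdt_kernel k M l x \<partial>?\<mu>))\<^sup>2) \<partial>?\<mu>) \<le> (\<integral>\<^sup>+x. ennreal ((norm (f x))\<^sup>2) \<partial>?\<mu>)"
      by (simp add: ng)
  qed
qed

text \<open>Two exponents occur: p selects the operator, p' is where it is bounded. The final
  estimate takes p' = p1 and p equal to either given exponent.\<close>

lemma lcdt_hausdorff_young:
  fixes M :: "real^2^2"
  assumes k: "k \<ge> - 1 / 2" and b: "M $ 1 $ 2 \<noteq> 0" and p: "1 < p" "p \<le> 2" and p': "1 < p'" "p' \<le> 2"
    and f: "f \<in> Lp_space (dunkl_measure k) p" "f \<in> Lp_space (dunkl_measure k) p'"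
  shows "lcdt k M p f \<in> borel_measurable borel"
    and "Lp_norm (dunkl_measure k) (p' / (p' - 1)) (lcdt k M p f) \<le>
      ennreal ((\<bar>M $ 1 $ 2\<bar> powr (- (k + 1))) powr (2 / p' - 1)) * Lp_norm (dunkl_measure k) p' f"
proof -
  interpret L2_contractive_kernel "dunkl_measure k" "lcdt_kernel k M" "\<bar>M $ 1 $ 2\<bar> powr (- (k + 1))"
    by (rule L2_contractive_kernel_lcdt[OF k b])
  interpret E: L2_contractive_kernel_exponents "dunkl_measure k" "lcdt_kernel k M"
      "\<bar>M $ 1 $ 2\<bar> powr (- (k + 1))" p "p / (p - 1)"
    by unfold_locales (use p in auto)
  have kop: "kop f = lcdt_integral k M f" for f
  proof
    fix l
    have "kop f l = (\<integral>x. 1 / ((\<i> * of_real (M $ 1 $ 2)) powr of_real (k + 1)) *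
        (f x * exp (\<i> / 2 * of_real (M $ 2 $ 2 / M $ 1 $ 2 * l\<^sup>2 + M $ 1 $ 1 / M $ 1 $ 2 * x\<^sup>2)) *
          dunkl_kernel k (l / M $ 1 $ 2) x) \<partial>dunkl_measure k)"
      unfolding kop_def lcdt_kernel_def Let_def
      by (intro Bochner_Integration.integral_cong refl) (simp only: mult_ac)
    then show "kop f l = lcdt_integral k M f l" by (simp add: lcdt_integral_def Let_def)
  qed
  have "E.is_extension T \<longleftrightarrow> is_lcdt_extension k M p T" for T
    unfolding E.is_extension_def is_lcdt_extension_def Let_def kop ..
  \<comment> \<open>Existence of some extension is what makes the function selected by
    \<open>SOME\<close> an extension.\<close>
  then have T: "E.is_extension (lcdt k M p)"
    using E.is_extension_exists unfolding lcdt_def by (metis someI_ex)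
  show "lcdt k M p f \<in> borel_measurable borel"
    using T f(1) unfolding E.is_extension_def Lp_space_def by auto
  show "Lp_norm (dunkl_measure k) (p' / (p' - 1)) (lcdt k M p f) \<le>
      ennreal ((\<bar>M $ 1 $ 2\<bar> powr (- (k + 1))) powr (2 / p' - 1)) * Lp_norm (dunkl_measure k) p' f"
    by (rule E.extension_hausdorff_young(2)[OF T f(1) p' refl f(2)])
qed

text \<open>For f in both spaces the transform may be read as the operator selected for either
  exponent; the inequality is asserted for both readings.\<close>

theorem theorem3p17:
  fixes k p1 p2 q1 q2 :: real and M :: "real^2^2" and f :: "real \<Rightarrow> complex"
  assumes "k \<ge> - 1 / 2"
    and "det M = 1" and "M $ 1 $ 2 \<noteq> 0"
    and "1 < p1" and "p1 \<le> p2" and "p2 \<le> 2"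
    and "1 / p1 + 1 / q1 = 1" and "1 / p2 + 1 / q2 = 1"
    and "f \<in> Lp_space (dunkl_measure k) p1 \<inter> Lp_space (dunkl_measure k) p2"
  shows "\<forall>p\<in>{p1, p2}.
    Lp_norm (dunkl_measure k) q2 (lcdt k M p f)
      \<le> ennreal ((\<bar>M $ 1 $ 2\<bar> powr (- (k + 1))) powr (1 - 2 / q1))
        * ennreal_rpow (emeasure (dunkl_measure k) {x. lcdt k M p f x \<noteq> 0}) ((q1 - q2) / (q1 * q2))
        * ennreal_rpow (emeasure (dunkl_measure k) {t. f t \<noteq> 0}) ((p2 - p1) / (p1 * p2))
        * Lp_norm (dunkl_measure k) p2 f"
proof
  fix p assume p: "p \<in> {p1, p2}"
  let ?\<mu> = "dunkl_measure k"
  let ?T = "lcdt k M p f"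
  have conj: "q = p / (p - 1)" if "1 < p" "1 / p + 1 / q = 1" for p q :: real
  proof -
    have "1 / q = (p - 1) / p" using that by (simp add: field_simps)
    then have "q = 1 / ((p - 1) / p)" by (metis div_by_1 divide_divide_eq_right mult_1)
    then show ?thesis by simp
  qed
  have q: "q1 = p1 / (p1 - 1)" "q2 = p2 / (p2 - 1)"
    using conj assms by auto
  have q_pos: "0 < q2" "q2 \<le> q1" "0 < q1"
    using assms(4-6) unfolding q by (auto simp: field_simps)
  have T: "?T \<in> borel_measurable borel"
    "Lp_norm ?\<mu> q1 ?T \<le> ennreal ((\<bar>M $ 1 $ 2\<bar> powr (- (k + 1))) powr (2 / p1 - 1)) * Lp_norm ?\<mu> p1 f"
  proof -
    have "1 < p" "p \<le> 2" "1 < p1" "p1 \<le> 2" "f \<in> Lp_space ?\<mu> p" "f \<in> Lp_space ?\<mu> p1"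
      using p assms by auto
    from lcdt_hausdorff_young[OF assms(1,3) this] show "?T \<in> borel_measurable borel"
      "Lp_norm ?\<mu> q1 ?T \<le> ennreal ((\<bar>M $ 1 $ 2\<bar> powr (- (k + 1))) powr (2 / p1 - 1)) * Lp_norm ?\<mu> p1 f"
      unfolding q(1) .
  qed
  have e: "2 / p1 - 1 = 1 - 2 / q1" "1 / q2 - 1 / q1 = (q1 - q2) / (q1 * q2)"
    "1 / p1 - 1 / p2 = (p2 - p1) / (p1 * p2)"
    using assms(4-7) q_pos by (auto simp: field_simps)
  have "Lp_norm ?\<mu> q2 ?T \<le> ennreal_rpow (emeasure ?\<mu> {x. ?T x \<noteq> 0}) ((q1 - q2) / (q1 * q2)) * Lp_norm ?\<mu> q1 ?T"
    using Lp_norm_le_support[of ?T ?\<mu> q2 q1] T(1) q_pos by (simp add: e)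
  also have "\<dots> \<le> ennreal_rpow (emeasure ?\<mu> {x. ?T x \<noteq> 0}) ((q1 - q2) / (q1 * q2)) *
      (ennreal ((\<bar>M $ 1 $ 2\<bar> powr (- (k + 1))) powr (1 - 2 / q1)) *
        (ennreal_rpow (emeasure ?\<mu> {t. f t \<noteq> 0}) ((p2 - p1) / (p1 * p2)) * Lp_norm ?\<mu> p2 f))"
  proof (intro mult_left_mono order_trans[OF T(2)])
    have "f \<in> borel_measurable ?\<mu>" using assms(9) by (simp add: Lp_space_def)
    then have "Lp_norm ?\<mu> p1 f \<le>
        ennreal_rpow (emeasure ?\<mu> {t. f t \<noteq> 0}) ((p2 - p1) / (p1 * p2)) * Lp_norm ?\<mu> p2 f"
      using Lp_norm_le_support[of f ?\<mu> p1 p2] assms(4,5) by (simp add: e)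
    then show "ennreal ((\<bar>M $ 1 $ 2\<bar> powr (- (k + 1))) powr (2 / p1 - 1)) * Lp_norm ?\<mu> p1 f \<le>
        ennreal ((\<bar>M $ 1 $ 2\<bar> powr (- (k + 1))) powr (1 - 2 / q1)) *
        (ennreal_rpow (emeasure ?\<mu> {t. f t \<noteq> 0}) ((p2 - p1) / (p1 * p2)) * Lp_norm ?\<mu> p2 f)"
      unfolding e(1) by (rule mult_left_mono) simp
  qed simp
  finally show "Lp_norm ?\<mu> q2 ?T
      \<le> ennreal ((\<bar>M $ 1 $ 2\<bar> powr (- (k + 1))) powr (1 - 2 / q1))
        * ennreal_rpow (emeasure ?\<mu> {x. ?T x \<noteq> 0}) ((q1 - q2) / (q1 * q2))
        * ennreal_rpow (emeasure ?\<mu> {t. f t \<noteq> 0}) ((p2 - p1) / (p1 * p2))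
        * Lp_norm ?\<mu> p2 f"
    by (simp only: mult_ac)
qed

end
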